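(* Let $\rho>0$. For every $h\in X_{0,2/\rho}$, $$\langle h,Lh\rangle_{-1,2/\rho}\le-\|h\|_{-1,2/\rho}^2 .$$ As a consequence, for every $h^0\in X_{-1,2/\rho}$, $$\|e^{tL}h^0\|_{-1,2/\rho}\le\|h^0\|_{-1,2/\rho}\,e^{-t}\qquad(t\ge0).$$
   Context: All functions live on $(0,\infty)$; integrals without limits are over $(0,\infty)$; $L^2(e^{\mu y})=L^2((0,\infty);e^{\mu y}dy)$; convolution is $(u*v)(y)=\int_0^y u(x)v(y-x)\,dx$. Fix $\rho>0$ and $g_\rho(y)=\frac4\rho e^{-2y/\rho}$. For a function $h$ integrable on $(\epsilon,\infty)$ for all $\epsilon>0$, $H(y):=\int_y^\infty h(x)\,dx$. For $\mu>0$ define $X_{-1,\mu}:=\{H' \mid H\in L^2(e^{\mu y}),\ \int H=0\}$, and for integer $k\ge0$, $X_{k,\mu}:=\{h\mid y^{k+1}D^kh\in L^2(e^{\mu y}),\ \int y\,h=0\}$ (derivatives in the sense of distributions on $(0,\infty)$). Put $\|h\|_{k,\mu}^2:=\int_0^\infty y^{2(k+1)}(D^kh)^2e^{\mu y}\,dy$, where $D^{-1}h:=-H$ (for $h\in X_{-1,\mu}$, $H$ is the function of $L^2(e^{\mu y})$ with $-H'=h$, so $\|h\|_{-1,\mu}^2=\int H^2e^{\mu y}$); these are Hilbert norms, with scalar products $\langle\cdot,\cdot\rangle_{k,\mu}$. The linearized self-similar coagulation operator is $$Lh:=y\,\partial_yh-\frac4\rho H+\frac2\rho\,H*g_\rho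 ,$$ with $\partial_y h$ in the sense of distributions. For $0<\mu<4/\rho$ and integer $k\ge-1$, $L$ maps $X_{k+1,\mu}$ into $X_{k,\mu}$ and, as an unbounded operator on $X_{k,\mu}$ with domain $X_{k+1,\mu}$, generates an evolution semigroup $e^{tL}$ on $X_{k,\mu}$. *)

theory Defs
  imports "HOL-Analysis.Analysis"
begin

section \<open>Distributions on the half-line\<close>

text \<open>A distribution on \<open>(0, \<infinity>)\<close> is given by its values on test functions. The value
  on every other function is set to 0, so that equality of functionals is equality of distributions.
  Continuity is not imposed: every functional below is built from locally integrable functions
  by differentiation and multiplication by \<open>y\<close>.\<close>

type_synonym dist = "(real \<Rightarrow> real) \<Rightarrow> real"

definition test_fun :: "(real \<Rightarrow> real) \<Rightarrow> bool" where
  "test_fun \<phi> \<longleftrightarrow>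
     (\<forall>n x. (deriv ^^ n) \<phi> differentiable (at x)) \<and>
     (\<exists>a b. 0 < a \<and> (\<forall>x. x \<notin> {a..b} \<longrightarrow> \<phi> x = 0))"

definition dist_of :: "(real \<Rightarrow> real) \<Rightarrow> dist" where
  "dist_of f = (\<lambda>\<phi>. if test_fun \<phi> then (LBINT y:{0<..}. f y * \<phi> y) else 0)"

definition dist_deriv :: "dist \<Rightarrow> dist" where
  "dist_deriv T = (\<lambda>\<phi>. if test_fun \<phi> then - T (deriv \<phi>) else 0)"

definition dist_mult_y :: "dist \<Rightarrow> dist" where
  "dist_mult_y T = (\<lambda>\<phi>. if test_fun \<phi> then T (\<lambda>y. y * \<phi> y) else 0)"


section \<open>The weighted spaces\<close>

definition L2_exp :: "real \<Rightarrow> (real \<Rightarrow> real) set" where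
  "L2_exp \<mu> = {f. set_borel_measurable lborel {0<..} f \<and>
                  set_integrable lborel {0<..} (\<lambda>y. (f y)\<^sup>2 * exp (\<mu> * y))}"

text \<open>In the next two definitions the vanishing integral is that of a function in \<open>L\<^sup>2(e\<^sup>\<mu>\<^sup>y)\<close>,
  which is integrable on \<open>(0, \<infinity>)\<close> because \<open>\<mu> > 0\<close> wherever the spaces are used.\<close>

definition X_minus1 :: "real \<Rightarrow> dist set" where
  "X_minus1 \<mu> = {dist_deriv (dist_of H) | H. H \<in> L2_exp \<mu> \<and> (LBINT y:{0<..}. H y) = 0}"

text \<open>The elements of \<open>X\<^sub>0\<close> are taken as functions; as a subspace of \<open>X\<^sub>-\<^sub>1\<close> it is
  the image of this set under \<^const>\<open>dist_of\<close>.\<close>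

definition X_zero :: "real \<Rightarrow> (real \<Rightarrow> real) set" where
  "X_zero \<mu> = {h. set_borel_measurable lborel {0<..} h \<and>
                  (\<lambda>y. y * h y) \<in> L2_exp \<mu> \<and> (LBINT y:{0<..}. y * h y) = 0}"

text \<open>For \<open>\<mu> > 0\<close> the function chosen here is unique up to null sets, because no nonzero
  constant lies in \<open>L\<^sup>2(e\<^sup>\<mu>\<^sup>y)\<close>.\<close>

definition primitive :: "real \<Rightarrow> dist \<Rightarrow> real \<Rightarrow> real" where
  "primitive \<mu> T = (SOME H. H \<in> L2_exp \<mu> \<and> T = (\<lambda>\<phi>. - dist_deriv (dist_of H) \<phi>))"

definition inner_minus1 :: "real \<Rightarrow> dist \<Rightarrow> dist \<Rightarrow> real" where
  "inner_minus1 \<mu> T U = (LBINT y:{0<..}. primitive \<mu> T y * primitive \<mu> U y * exp (\<mu> * y))"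

definition norm_minus1 :: "real \<Rightarrow> dist \<Rightarrow> real" where
  "norm_minus1 \<mu> T = sqrt (inner_minus1 \<mu> T T)"


section \<open>The linearized coagulation operator\<close>

definition g :: "real \<Rightarrow> real \<Rightarrow> real" where
  "g \<rho> y = 4 / \<rho> * exp (- 2 * y / \<rho>)"

definition conv :: "(real \<Rightarrow> real) \<Rightarrow> (real \<Rightarrow> real) \<Rightarrow> real \<Rightarrow> real" where
  "conv u v y = (LBINT x:{0..y}. u x * v (y - x))"

definition tail_integral :: "(real \<Rightarrow> real) \<Rightarrow> real \<Rightarrow> real" where
  "tail_integral h y = (LBINT x:{y<..}. h x)"

definition L :: "real \<Rightarrow> (real \<Rightarrow> real) \<Rightarrow> dist" where
  "L \<rho> h = (\<lambda>\<phi>. dist_mult_y (dist_deriv (dist_of h)) \<phi>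
      - 4 / \<rho> * dist_of (tail_integral h) \<phi>
      + 2 / \<rho> * dist_of (conv (tail_integral h) (g \<rho>)) \<phi>)"


section \<open>The semigroup\<close>

text \<open>Strongly continuous semigroups of bounded linear operators on a space \<open>X\<close> of distributions
  with norm \<open>N\<close>; only the restriction of \<open>S t\<close> to \<open>X\<close>, for \<open>t \<ge> 0\<close>, is meaningful.\<close>

definition C0_semigroup :: "dist set \<Rightarrow> (dist \<Rightarrow> real) \<Rightarrow> (real \<Rightarrow> dist \<Rightarrow> dist) \<Rightarrow> bool" where
  "C0_semigroup X N S \<longleftrightarrow>
     (\<forall>t\<ge>0. \<forall>T\<in>X. S t T \<in> X) \<and>
     (\<forall>t\<ge>0. \<forall>T\<in>X. \<forall>U\<in>X. \<forall>a b.
        S t (\<lambda>\<phi>. a * T \<phi> + b * U \<phi>) = (\<lambda>\<phi>. a * S t T \<phi> + b * S t U \<phi>)) \<and>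
     (\<forall>t\<ge>0. \<exists>C. \<forall>T\<in>X. N (S t T) \<le> C * N T) \<and>
     (\<forall>T\<in>X. S 0 T = T) \<and>
     (\<forall>s\<ge>0. \<forall>t\<ge>0. \<forall>T\<in>X. S (s + t) T = S s (S t T)) \<and>
     (\<forall>T\<in>X. \<forall>s\<ge>0. ((\<lambda>t. N (\<lambda>\<phi>. S t T \<phi> - S s T \<phi>)) \<longlongrightarrow> 0) (at s within {0..}))"

definition generator_graph ::
    "dist set \<Rightarrow> (dist \<Rightarrow> real) \<Rightarrow> (real \<Rightarrow> dist \<Rightarrow> dist) \<Rightarrow> (dist \<times> dist) set" where
  "generator_graph X N S = {(T, V). T \<in> X \<and> V \<in> X \<and>
     ((\<lambda>t. N (\<lambda>\<phi>. (S t T \<phi> - T \<phi>) / t - V \<phi>)) \<longlongrightarrow> 0) (at_right 0)}"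

text \<open>\<open>S t = e\<^sup>t\<^sup>L\<close> on \<open>X\<^sub>-\<^sub>1\<close>: the generator of \<open>S\<close> is exactly \<open>L\<close> with domain \<open>X\<^sub>0\<close>. A strongly
  continuous semigroup is determined by its generator.\<close>

definition semigroup_of_L :: "real \<Rightarrow> real \<Rightarrow> (real \<Rightarrow> dist \<Rightarrow> dist) \<Rightarrow> bool" where
  "semigroup_of_L \<rho> \<mu> S \<longleftrightarrow>
     C0_semigroup (X_minus1 \<mu>) (norm_minus1 \<mu>) S \<and>
     generator_graph (X_minus1 \<mu>) (norm_minus1 \<mu>) S = {(dist_of h, L \<rho> h) | h. h \<in> X_zero \<mu>}"

end

theory Submission
  imports Defs "HOL-Real_Asymp.Real_Asymp"
begin

text \<open>
  Put \<open>\<mu> = 2 / \<rho>\<close>, so that \<open>g y = 2 \<mu> exp (- \<mu> y)\<close>, and let \<open>H\<close> be the tail integral of \<open>h\<close>. Then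
  \<open>L h = - K'\<close> with \<open>K = - y h - H + H * g\<close>. Since \<open>2 \<integral> y h H e\<^sup>\<mu>\<^sup>y = \<integral> H\<^sup>2 (1 + \<mu> y) e\<^sup>\<mu>\<^sup>y\<close>, dissipativity
  reduces to \<open>4 \<mu> \<integral> H W \<le> \<integral> H\<^sup>2 (1 + \<mu> y) e\<^sup>\<mu>\<^sup>y\<close>, where \<open>W y\<close> is the integral of \<open>H x e\<^sup>\<mu>\<^sup>x\<close> over \<open>(0, y)\<close>.
  Let \<open>M y\<close> be the integral of \<open>H\<close> over \<open>(0, y)\<close>; it tends to 0 at infinity because \<open>H\<close> has mean zero.
  The difference of the two integrands is \<open>(1 + \<mu> y) e\<^sup>\<mu>\<^sup>y (H + \<mu> M - M / y)\<^sup>2\<close> plus the derivative of a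
  function vanishing at both ends; the square vanishes for the extremal \<open>M y = y exp (- \<mu> y)\<close>.

  On the domain of the generator, dissipativity makes the upper right Dini derivative of
  \<open>e\<^sup>2\<^sup>t \<parallel>S t T\<parallel>\<^sup>2\<close> nonpositive, which gives the decay there. The domain is dense: a function in the
  weighted space is approximated by truncation and forward averages, which are tail integrals of
  difference quotients, and the mean is corrected by a multiple of \<open>exp (- \<mu> y)\<close>.
\<close>

section \<open>Dissipative semigroups on semi-inner product spaces\<close>

text \<open>The exponent of the weight is that of \<open>g\<close>, so
  \<open>exp (\<mu> * y)\<close> cancels the decay of the convolution kernel and
  \<open>H * g\<close> contributes \<open>2 * \<mu> * H * W\<close> to the scalar product, with no
  weight left. For \<open>M y = y * exp (- \<mu> * y)\<close> one finds
  \<open>H y = (1 - \<mu> * y) * exp (- \<mu> * y)\<close>, \<open>W y = y - \<mu> * y^2 / 2\<close>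
  and \<open>K = - H\<close>: here \<open>h\<close> is an eigenfunction of \<open>L\<close> for the
  eigenvalue -1, proportional to \<open>2 g + y g'\<close>, the derivative of \<open>g\<close> under
  dilations. Dissipativity is an equality there, the rate 1 is optimal, and the proof may lose
  nothing in this direction. Hence the square of the defect in the equation
  \<open>M' = M / y - \<mu> * M\<close> of the extremal.

  Two obstacles shape the rest. The primitive of a distribution is a choice, fixed only almost
  everywhere, so a vanishing distributional derivative has to be shown to give a null function. And
  \<open>h\<close> has no pointwise bound and may fail to be integrable at 0: integrations by parts
  become exchanges of the order of integration over a triangle, and boundary terms are controlled by
  tails of the energy integral.\<close>

locale semi_inner_space =
  fixes X :: "('a \<Rightarrow> real) set" and ip :: "('a \<Rightarrow> real) \<Rightarrow> ('a \<Rightarrow> real) \<Rightarrow> real"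
  assumes lin_closed: "T \<in> X \<Longrightarrow> U \<in> X \<Longrightarrow> (\<lambda>x. a * T x + b * U x) \<in> X"
    and ip_commute: "T \<in> X \<Longrightarrow> U \<in> X \<Longrightarrow> ip T U = ip U T"
    and ip_lin_left: "T \<in> X \<Longrightarrow> U \<in> X \<Longrightarrow> V \<in> X \<Longrightarrow>
      ip (\<lambda>x. a * T x + b * U x) V = a * ip T V + b * ip U V"
    and ip_nonneg: "T \<in> X \<Longrightarrow> 0 \<le> ip T T"
begin

definition nrm :: "('a \<Rightarrow> real) \<Rightarrow> real" where
  "nrm T = sqrt (ip T T)"

lemma nrm_nonneg: "T \<in> X \<Longrightarrow> 0 \<le> nrm T"
  by (simp add: nrm_def ip_nonneg)

lemma nrm_square: "T \<in> X \<Longrightarrow> (nrm T)\<^sup>2 = ip T T"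
  by (simp add: nrm_def ip_nonneg)

lemma ip_square_lin:
  assumes "T \<in> X" "U \<in> X"
  shows "ip (\<lambda>x. a * T x + b * U x) (\<lambda>x. a * T x + b * U x)
    = a\<^sup>2 * ip T T + 2 * a * b * ip T U + b\<^sup>2 * ip U U"
  using assms by (simp add: ip_lin_left lin_closed ip_commute[OF _ lin_closed] power2_eq_square
      ip_commute[of U T] algebra_simps)

text \<open>Functions that agree almost everywhere are not identified, so \<open>ip\<close> may be
  degenerate and a null \<open>U\<close> is a case of its own: the quadratic form is then affine in
  \<open>b\<close> and stays nonnegative only if its slope vanishes.\<close>

lemma ip_Cauchy_Schwarz:
  assumes "T \<in> X" "U \<in> X"
  shows "\<bar>ip T U\<bar> \<le> nrm T * nrm U"
proof -
  have pos: "0 \<le> a\<^sup>2 * ip T T + 2 * a * b * ip T U + b\<^sup>2 * ip U U" for a b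
    using ip_nonneg[OF lin_closed[OF assms]] ip_square_lin[OF assms] by metis
  have "(ip T U)\<^sup>2 \<le> ip T T * ip U U"
  proof (cases "ip U U = 0")
    case True
    have "ip T U = 0"
    proof (rule ccontr)
      assume "ip T U \<noteq> 0"
      \<comment> \<open>The chosen \<open>b\<close> gives the form the value
        \<open>ip T T - (ip T T + 1) = - 1\<close>.\<close>
      then show False
        using pos[of 1 "- (ip T T + 1) / (2 * ip T U)"] True by (simp add: field_simps)
    qed
    then show ?thesis using True by simp
  next
    case False
    then have "0 < ip U U" using ip_nonneg[OF assms(2)] by simp
    \<comment> \<open>The minimising ratio of the coefficients, scaled by \<open>ip U U\<close> so
      that nothing is divided.\<close>
    moreover have "0 \<le> ip U U * (ip T T * ip U U - (ip T U)\<^sup>2)"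
      using pos[of "ip U U" "- ip T U"] by (simp add: power2_eq_square algebra_simps)
    ultimately show ?thesis by (simp add: zero_le_mult_iff)
  qed
  then have "sqrt ((ip T U)\<^sup>2) \<le> sqrt (ip T T * ip U U)" by (rule real_sqrt_le_mono)
  then show ?thesis by (simp add: nrm_def real_sqrt_mult)
qed

lemma nrm_lin:
  assumes "T \<in> X" "U \<in> X"
  shows "nrm (\<lambda>x. a * T x + b * U x) \<le> \<bar>a\<bar> * nrm T + \<bar>b\<bar> * nrm U"
proof (rule power2_le_imp_le)
  have "(nrm (\<lambda>x. a * T x + b * U x))\<^sup>2 = a\<^sup>2 * (nrm T)\<^sup>2 + 2 * (a * b * ip T U) + b\<^sup>2 * (nrm U)\<^sup>2"
    using assms by (simp add: nrm_square lin_closed ip_square_lin)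
  also have "a * b * ip T U \<le> \<bar>a\<bar> * \<bar>b\<bar> * (nrm T * nrm U)"
  proof -
    have "a * b * ip T U \<le> \<bar>a * b\<bar> * \<bar>ip T U\<bar>"
      by (metis abs_ge_self abs_mult)
    also have "\<dots> \<le> \<bar>a * b\<bar> * (nrm T * nrm U)"
      by (intro mult_left_mono ip_Cauchy_Schwarz assms) auto
    finally show ?thesis by (simp add: abs_mult)
  qed
  finally show "(nrm (\<lambda>x. a * T x + b * U x))\<^sup>2 \<le> (\<bar>a\<bar> * nrm T + \<bar>b\<bar> * nrm U)\<^sup>2"
    by (simp add: power2_sum power_mult_distrib algebra_simps)
qed (use assms in \<open>simp add: nrm_nonneg\<close>)

lemma diff_closed: "T \<in> X \<Longrightarrow> U \<in> X \<Longrightarrow> (\<lambda>x. T x - U x) \<in> X"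
  using lin_closed[of T U 1 "- 1"] by simp

lemma nrm_triangle_diff:
  assumes "T \<in> X" "U \<in> X"
  shows "nrm T \<le> nrm U + nrm (\<lambda>x. T x - U x)"
  using nrm_lin[OF assms(2) diff_closed[OF assms], of 1 1] by simp

lemma nrm_diff_commute:
  assumes "T \<in> X" "U \<in> X"
  shows "nrm (\<lambda>x. T x - U x) = nrm (\<lambda>x. U x - T x)"
  using ip_square_lin[OF assms, of 1 "-1"] ip_square_lin[OF assms, of "-1" 1]
  by (simp add: nrm_def)

lemma abs_nrm_diff:
  assumes "T \<in> X" "U \<in> X"
  shows "\<bar>nrm T - nrm U\<bar> \<le> nrm (\<lambda>x. T x - U x)"
  using nrm_triangle_diff[OF assms] nrm_triangle_diff[OF assms(2,1)] nrm_diff_commute[OF assms]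
  by linarith

end

section \<open>Decay along orbits of a dissipative semigroup\<close>

text \<open>A continuation argument for the tilted function \<open>F s - \<epsilon> * s\<close>: by
  continuity there is a last time at which it does not exceed its initial value, and the bound to
  the right of that time carries the inequality further, unless the end \<open>t\<close> is reached.
  Only growth to the right is controlled, because the generator is a limit from the right.\<close>

lemma upper_right_Dini_nonincreasing:
  fixes F :: "real \<Rightarrow> real"
  assumes cont: "continuous_on {0..t} F" and t: "0 \<le> t"
    and dini: "\<And>s \<epsilon>. 0 \<le> s \<Longrightarrow> s < t \<Longrightarrow> 0 < \<epsilon> \<Longrightarrow>
      \<forall>\<^sub>F r in at_right 0. F (s + r) \<le> F s + \<epsilon> * r"
  shows "F t \<le> F 0"
proof -
  have *: "F t - \<epsilon> * t \<le> F 0" if e: "0 < \<epsilon>" for \<epsilon>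
  proof (rule ccontr)
    define G where "G s = F s - \<epsilon> * s" for s
    assume "\<not> F t - \<epsilon> * t \<le> F 0"
    then have Gt: "G 0 < G t" by (simp add: G_def)
    have contG: "continuous_on {0..t} G"
      unfolding G_def by (intro continuous_intros cont)
    define A where "A = {s \<in> {0..t}. G s \<le> G 0}"
    have "closed A"
      unfolding A_def using continuous_closed_preimage[OF contG _ closed_atMost[of "G 0"]]
      by (simp add: Int_def vimage_def conj_commute)
    moreover have "bounded A"
      by (rule bounded_subset[of "{0..t}"]) (auto simp: A_def)
    ultimately have "compact A" by (simp add: compact_eq_bounded_closed)
    moreover have "0 \<in> A" using t by (simp add: A_def)
    ultimately obtain s where s: "s \<in> A" "\<And>r. r \<in> A \<Longrightarrow> r \<le> s"
      using compact_attains_sup[of A] by blast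
    have "0 \<le> s" "s \<le> t" "G s \<le> G 0" using s(1) by (auto simp: A_def)
    with Gt have "s < t" by (cases "s = t") auto
    have "\<forall>\<^sub>F r in at_right 0. r < t - s"
      using eventually_at_right_real[of 0 "t - s"] \<open>s < t\<close> by (auto elim: eventually_mono)
    then have "\<forall>\<^sub>F r in at_right 0. F (s + r) \<le> F s + \<epsilon> * r \<and> r < t - s \<and> 0 < r"
      using dini[OF \<open>0 \<le> s\<close> \<open>s < t\<close> e] eventually_at_right_less[of "0::real"]
      by (simp add: eventually_conj_iff)
    then obtain r where r: "F (s + r) \<le> F s + \<epsilon> * r" "r < t - s" "0 < r"
      using eventually_happens'[OF trivial_limit_at_right_real] by blast
    then have "G (s + r) \<le> G s" by (simp add: G_def algebra_simps)
    then have "s + r \<in> A" using r \<open>0 \<le> s\<close> \<open>G s \<le> G 0\<close> by (simp add: A_def)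
    with s(2) r show False by fastforce
  qed
  show ?thesis
  proof (rule field_le_epsilon)
    fix e :: real assume "0 < e"
    \<comment> \<open>The denominator \<open>t + 1\<close> covers \<open>t = 0\<close> as
      well.\<close>
    then have "F t - e / (t + 1) * t \<le> F 0" using t by (intro *) simp
    moreover have "e / (t + 1) * t \<le> e" using t \<open>0 < e\<close> by (simp add: field_simps)
    ultimately show "F t \<le> F 0 + e" by linarith
  qed
qed

lemma C0_semigroupD:
  assumes "C0_semigroup X N S"
  shows "\<And>t T. 0 \<le> t \<Longrightarrow> T \<in> X \<Longrightarrow> S t T \<in> X"
    and "\<And>t T U a b. 0 \<le> t \<Longrightarrow> T \<in> X \<Longrightarrow> U \<in> X \<Longrightarrow>
        S t (\<lambda>\<phi>. a * T \<phi> + b * U \<phi>) = (\<lambda>\<phi>. a * S t T \<phi> + b * S t U \<phi>)"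
    and "\<And>t. 0 \<le> t \<Longrightarrow> \<exists>C. \<forall>T\<in>X. N (S t T) \<le> C * N T"
    and "\<And>T. T \<in> X \<Longrightarrow> S 0 T = T"
    and "\<And>s t T. 0 \<le> s \<Longrightarrow> 0 \<le> t \<Longrightarrow> T \<in> X \<Longrightarrow> S (s + t) T = S s (S t T)"
    and "\<And>T s. T \<in> X \<Longrightarrow> 0 \<le> s \<Longrightarrow> ((\<lambda>t. N (\<lambda>\<phi>. S t T \<phi> - S s T \<phi>)) \<longlongrightarrow> 0) (at s within {0..})"
  using assms unfolding C0_semigroup_def by simp_all

text \<open>\<open>w\<close> is \<open>u + s V + s q\<close>, where \<open>q\<close> is the error of
  the difference quotient and has norm \<open>r\<close>. Dissipativity enters through the cross term
  \<open>2 * s * ip u V\<close>; the other terms are of second order in \<open>s\<close> or carry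
  the factor \<open>r\<close>, which will tend to 0. The bound \<open>s \<le> 1\<close> makes the
  estimate of \<open>u + s V\<close> independent of \<open>s\<close>.\<close>

lemma (in semi_inner_space) nrm_square_step:
  assumes "u \<in> X" "V \<in> X" "w \<in> X" and s: "0 < s" "s \<le> 1" and diss: "ip u V \<le> - (nrm u)\<^sup>2"
  defines "r \<equiv> nrm (\<lambda>x. (w x - u x) / s - V x)"
  shows "(nrm w)\<^sup>2 \<le> (1 - 2 * s) * (nrm u)\<^sup>2 + s\<^sup>2 * (nrm V)\<^sup>2
    + 2 * s * r * (nrm u + nrm V) + s\<^sup>2 * r\<^sup>2"
proof -
  define p where "p = (\<lambda>x. 1 * u x + s * V x)"
  define q where "q = (\<lambda>x. (w x - u x) / s - V x)"
  have pX: "p \<in> X" unfolding p_def by (intro lin_closed assms)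
  have "(\<lambda>x. (1 / s) * (1 * w x + (- 1) * u x) + (- 1) * V x) \<in> X"
    by (intro lin_closed assms)
  then have qX: "q \<in> X" by (simp add: q_def)
  have "w = (\<lambda>x. 1 * p x + s * q x)"
    using s by (auto simp: p_def q_def fun_eq_iff field_simps)
  then have "nrm w \<le> nrm p + s * nrm q"
    using nrm_lin[OF pX qX, of 1 s] s by simp
  then have "(nrm w)\<^sup>2 \<le> (nrm p + s * nrm q)\<^sup>2"
    using nrm_nonneg[OF \<open>w \<in> X\<close>] by (rule power_mono)
  also have "\<dots> = (nrm p)\<^sup>2 + 2 * s * r * nrm p + s\<^sup>2 * r\<^sup>2"
    by (simp add: power2_sum r_def q_def power_mult_distrib)
  also have "(nrm p)\<^sup>2 = (nrm u)\<^sup>2 + 2 * s * ip u V + s\<^sup>2 * (nrm V)\<^sup>2"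
    using ip_square_lin[OF assms(1,2), of 1 s] assms(1,2) pX by (simp add: nrm_square p_def)
  also have "2 * s * ip u V \<le> 2 * s * (- (nrm u)\<^sup>2)"
    using s diss by (intro mult_left_mono) auto
  also have "2 * s * r * nrm p \<le> 2 * s * r * (nrm u + nrm V)"
  proof -
    have "nrm p \<le> nrm u + s * nrm V"
      using nrm_lin[OF assms(1,2), of 1 s] s by (simp add: p_def)
    also have "s * nrm V \<le> 1 * nrm V"
      using s nrm_nonneg[OF assms(2)] by (intro mult_right_mono) auto
    finally show ?thesis
      using s nrm_nonneg[OF qX] by (intro mult_left_mono) (auto simp: r_def q_def)
  qed
  finally show ?thesis by (simp add: algebra_simps)
qed

text \<open>\<open>exp (2 * s) * (1 - 2 * s)\<close> is stationary at 0: the exponential factor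
  compensates the first-order loss in \<open>nrm_square_step\<close> exactly, and after division by
  \<open>s\<close> only vanishing terms remain.\<close>

lemma step_quotient_tendsto_0:
  fixes a b v :: real and r :: "real \<Rightarrow> real"
  assumes "(r \<longlongrightarrow> 0) (at_right 0)"
  shows "((\<lambda>s. (exp (2 * s) * ((1 - 2 * s) * a + s\<^sup>2 * v + 2 * s * r s * b + s\<^sup>2 * (r s)\<^sup>2) - a) / s)
    \<longlongrightarrow> 0) (at_right 0)"
proof -
  have "((\<lambda>s::real. (exp (2 * s) * (1 - 2 * s) - 1) / s) \<longlongrightarrow> 0) (at_right 0)"
  proof -
    have "((\<lambda>s::real. exp (2 * s) * (1 - 2 * s)) has_real_derivative 0) (at 0)"
      by (auto intro!: derivative_eq_intros)
    then have "((\<lambda>s::real. (exp (2 * s) * (1 - 2 * s) - 1) / s) \<longlongrightarrow> 0) (at 0)"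
      by (simp add: DERIV_def)
    then show ?thesis by (rule filterlim_at_split[THEN iffD1, THEN conjunct2])
  qed
  then have "((\<lambda>s. (exp (2 * s) * (1 - 2 * s) - 1) / s * a
      + exp (2 * s) * (s * v + 2 * r s * b + s * (r s)\<^sup>2)) \<longlongrightarrow> 0 * a + exp (2 * 0) * (0 * v + 2 * 0 * b + 0 * 0\<^sup>2))
      (at_right 0)"
    by (intro tendsto_intros assms) auto
  then have "((\<lambda>s. (exp (2 * s) * (1 - 2 * s) - 1) / s * a
      + exp (2 * s) * (s * v + 2 * r s * b + s * (r s)\<^sup>2)) \<longlongrightarrow> 0) (at_right 0)"
    by simp
  moreover have "\<forall>\<^sub>F s in at_right 0. (exp (2 * s) * (1 - 2 * s) - 1) / s * a
      + exp (2 * s) * (s * v + 2 * r s * b + s * (r s)\<^sup>2)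
    = (exp (2 * s) * ((1 - 2 * s) * a + s\<^sup>2 * v + 2 * s * r s * b + s\<^sup>2 * (r s)\<^sup>2) - a) / s"
    using eventually_at_right_less[of "0::real"]
    by eventually_elim (simp add: field_simps power2_eq_square)
  ultimately show ?thesis by (rule Lim_transform_eventually)
qed

text \<open>\<open>S t\<close> commutes with \<open>S r\<close>, hence with the difference
  quotients, and its boundedness carries their limit along. An orbit that starts in the domain
  therefore has a right derivative at every time, and dissipativity applies at every time.\<close>

lemma generator_graph_invariant:
  fixes X :: "dist set"
  assumes sp: "semi_inner_space X ip"
    and sg: "C0_semigroup X (semi_inner_space.nrm ip) S"
    and TV: "(T, V) \<in> generator_graph X (semi_inner_space.nrm ip) S" and t: "0 \<le> t"
  shows "(S t T, S t V) \<in> generator_graph X (semi_inner_space.nrm ip) S"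
proof -
  interpret semi_inner_space X ip by (rule sp)
  note sgD = C0_semigroupD[OF sg]
  have X: "T \<in> X" "V \<in> X" and lim: "((\<lambda>r. nrm (\<lambda>\<phi>. (S r T \<phi> - T \<phi>) / r - V \<phi>)) \<longlongrightarrow> 0) (at_right 0)"
    using TV by (auto simp: generator_graph_def)
  obtain C where C: "\<And>U. U \<in> X \<Longrightarrow> nrm (S t U) \<le> C * nrm U"
    using sgD(3)[OF t] by blast
  have eq: "(\<lambda>\<phi>. (S r (S t T) \<phi> - S t T \<phi>) / r - S t V \<phi>) = S t (\<lambda>\<phi>. (S r T \<phi> - T \<phi>) / r - V \<phi>)"
    and inX: "(\<lambda>\<phi>. (S r T \<phi> - T \<phi>) / r - V \<phi>) \<in> X" if "0 < r" for r
  proof -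
    have SrX: "S r T \<in> X" using that X by (intro sgD(1)) auto
    have comm: "S r (S t T) = S t (S r T)"
      using sgD(5)[of r t T] sgD(5)[of t r T] that t X by (simp add: add.commute)
    have D: "(\<lambda>\<phi>. 1 / r * S r T \<phi> + (- 1 / r) * T \<phi>) \<in> X"
      by (intro lin_closed SrX X)
    have e: "(\<lambda>\<phi>. (S r T \<phi> - T \<phi>) / r - V \<phi>) =
        (\<lambda>\<phi>. 1 * (1 / r * S r T \<phi> + (- 1 / r) * T \<phi>) + (- 1) * V \<phi>)"
      by (simp add: fun_eq_iff diff_divide_distrib)
    show "(\<lambda>\<phi>. (S r T \<phi> - T \<phi>) / r - V \<phi>) \<in> X"
      unfolding e by (intro lin_closed D X)
    show "(\<lambda>\<phi>. (S r (S t T) \<phi> - S t T \<phi>) / r - S t V \<phi>) = S t (\<lambda>\<phi>. (S r T \<phi> - T \<phi>) / r - V \<phi>)"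
      unfolding e sgD(2)[OF t D X(2)] sgD(2)[OF t SrX X(1)] comm
      by (simp add: fun_eq_iff diff_divide_distrib)
  qed
  have "((\<lambda>r. nrm (\<lambda>\<phi>. (S r (S t T) \<phi> - S t T \<phi>) / r - S t V \<phi>)) \<longlongrightarrow> 0) (at_right 0)"
  proof (rule tendsto_sandwich[where f = "\<lambda>_. 0"])
    show "((\<lambda>r. C * nrm (\<lambda>\<phi>. (S r T \<phi> - T \<phi>) / r - V \<phi>)) \<longlongrightarrow> 0) (at_right 0)"
      using tendsto_mult_right_zero[OF lim] by simp
    show "\<forall>\<^sub>F r in at_right 0. nrm (\<lambda>\<phi>. (S r (S t T) \<phi> - S t T \<phi>) / r - S t V \<phi>)
        \<le> C * nrm (\<lambda>\<phi>. (S r T \<phi> - T \<phi>) / r - V \<phi>)"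
      using eventually_at_right_less[of "0::real"]
      by eventually_elim (simp add: eq C inX)
    show "\<forall>\<^sub>F r in at_right 0. 0 \<le> nrm (\<lambda>\<phi>. (S r (S t T) \<phi> - S t T \<phi>) / r - S t V \<phi>)"
      using eventually_at_right_less[of "0::real"]
      by eventually_elim (simp add: eq nrm_nonneg inX sgD(1) t)
  qed simp
  then show ?thesis using X t by (simp add: generator_graph_def sgD(1))
qed

theorem dissipative_semigroup_decay:
  fixes X :: "dist set"
  assumes sp: "semi_inner_space X ip"
    and sg: "C0_semigroup X (semi_inner_space.nrm ip) S"
    and diss: "\<And>T V. (T, V) \<in> generator_graph X (semi_inner_space.nrm ip) S \<Longrightarrow>
      ip T V \<le> - (semi_inner_space.nrm ip T)\<^sup>2"
    and dense: "\<And>T \<epsilon>. T \<in> X \<Longrightarrow> 0 < \<epsilon> \<Longrightarrow> \<exists>T' V. (T', V) \<in> generator_graph X (semi_inner_space.nrm ip) S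
      \<and> semi_inner_space.nrm ip (\<lambda>\<phi>. T \<phi> - T' \<phi>) < \<epsilon>"
    and T: "T \<in> X" and t: "0 \<le> t"
  shows "semi_inner_space.nrm ip (S t T) \<le> semi_inner_space.nrm ip T * exp (- t)"
proof -
  interpret semi_inner_space X ip by (rule sp)
  note sgD = C0_semigroupD[OF sg]
  have cont: "continuous_on {0..t} (\<lambda>s. nrm (S s T))" if "T \<in> X" for t T
    unfolding continuous_on_def
  proof
    fix s assume s: "s \<in> {0..t}"
    have "((\<lambda>r. nrm (S r T) - nrm (S s T)) \<longlongrightarrow> 0) (at s within {0..})"
    proof (rule Lim_null_comparison)
      show "((\<lambda>r. nrm (\<lambda>\<phi>. S r T \<phi> - S s T \<phi>)) \<longlongrightarrow> 0) (at s within {0..})"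
        using sgD(6)[OF that] s by simp
      show "\<forall>\<^sub>F r in at s within {0..}. norm (nrm (S r T) - nrm (S s T)) \<le> nrm (\<lambda>\<phi>. S r T \<phi> - S s T \<phi>)"
        using s that by (auto simp: eventually_at_filter intro!: always_eventually abs_nrm_diff sgD(1))
    qed
    then have "((\<lambda>r. nrm (S r T)) \<longlongrightarrow> nrm (S s T)) (at s within {0..})"
      by (simp add: LIM_zero_iff)
    then show "((\<lambda>r. nrm (S r T)) \<longlongrightarrow> nrm (S s T)) (at s within {0..t})"
      by (rule tendsto_within_subset) auto
  qed
  have domain: "nrm (S t T) \<le> nrm T * exp (- t)"
    if TV: "(T, V) \<in> generator_graph X nrm S" and t: "0 \<le> t" for T V t
  proof -
    have X: "T \<in> X" using TV by (simp add: generator_graph_def)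
    define F where "F s = exp (2 * s) * (nrm (S s T))\<^sup>2" for s
    have "F t \<le> F 0"
    proof (rule upper_right_Dini_nonincreasing[OF _ t])
      show "continuous_on {0..t} F"
        unfolding F_def by (intro continuous_intros cont X)
      fix s \<epsilon> :: real assume s: "0 \<le> s" "s < t" and e: "0 < \<epsilon>"
      let ?u = "S s T" and ?V = "S s V"
      define r where "r h = nrm (\<lambda>\<phi>. (S h ?u \<phi> - ?u \<phi>) / h - ?V \<phi>)" for h
      have uV: "(?u, ?V) \<in> generator_graph X nrm S"
        by (rule generator_graph_invariant[OF sp sg TV s(1)])
      then have r0: "(r \<longlongrightarrow> 0) (at_right 0)" and uX: "?u \<in> X" and VX: "?V \<in> X"
        unfolding r_def by (auto simp: generator_graph_def)
      \<comment> \<open>The tolerance is divided by \<open>exp (2 * s)\<close> because the resulting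
        inequality is multiplied by this factor to pass from time \<open>h\<close> to time
        \<open>s + h\<close>.\<close>
      have "\<forall>\<^sub>F h in at_right 0. (exp (2 * h) * ((1 - 2 * h) * (nrm ?u)\<^sup>2 + h\<^sup>2 * (nrm ?V)\<^sup>2
          + 2 * h * r h * (nrm ?u + nrm ?V) + h\<^sup>2 * (r h)\<^sup>2) - (nrm ?u)\<^sup>2) / h < \<epsilon> / exp (2 * s)"
        using e by (intro order_tendstoD(2)[OF step_quotient_tendsto_0[OF r0]]) simp
      moreover have "\<forall>\<^sub>F h in at_right 0. h < (1::real)"
        by (rule eventually_at_right_real[THEN eventually_mono, of 0 1]) auto
      ultimately show "\<forall>\<^sub>F h in at_right 0. F (s + h) \<le> F s + \<epsilon> * h"
        using eventually_at_right_less[of "0::real"]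
      proof eventually_elim
        case (elim h)
        have "(nrm (S h ?u))\<^sup>2 \<le> (1 - 2 * h) * (nrm ?u)\<^sup>2 + h\<^sup>2 * (nrm ?V)\<^sup>2
            + 2 * h * r h * (nrm ?u + nrm ?V) + h\<^sup>2 * (r h)\<^sup>2"
          unfolding r_def using elim
          by (intro nrm_square_step[OF uX VX sgD(1)[OF _ uX] _ _ diss[OF uV]]) auto
        then have "exp (2 * h) * (nrm (S h ?u))\<^sup>2 \<le> exp (2 * h) * ((1 - 2 * h) * (nrm ?u)\<^sup>2 + h\<^sup>2 * (nrm ?V)\<^sup>2
            + 2 * h * r h * (nrm ?u + nrm ?V) + h\<^sup>2 * (r h)\<^sup>2)" by simp
        also have "\<dots> \<le> (nrm ?u)\<^sup>2 + \<epsilon> / exp (2 * s) * h"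
          using elim by (simp add: pos_divide_less_eq)
        finally have "exp (2 * s) * (exp (2 * h) * (nrm (S h ?u))\<^sup>2)
            \<le> exp (2 * s) * ((nrm ?u)\<^sup>2 + \<epsilon> / exp (2 * s) * h)" by simp
        moreover have "S (s + h) T = S h ?u"
          using sgD(5)[of h s T] s elim X by (simp add: add.commute)
        ultimately show ?case
          by (simp add: F_def exp_add algebra_simps)
      qed
    qed
    then have "exp (- (2 * t)) * (exp (2 * t) * (nrm (S t T))\<^sup>2) \<le> exp (- (2 * t)) * (nrm T)\<^sup>2"
      using sgD(4)[OF X] by (simp add: F_def)
    moreover have "exp (- (2 * t)) = (exp (- t))\<^sup>2"
      using exp_double[of "- t"] by simp
    moreover have "exp (- (2 * t)) * (exp (2 * t) * (nrm (S t T))\<^sup>2) = (nrm (S t T))\<^sup>2"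
      by (simp flip: exp_add mult.assoc)
    ultimately have "(nrm (S t T))\<^sup>2 \<le> (nrm T * exp (- t))\<^sup>2"
      by (simp only: power_mult_distrib mult.commute)
    then show ?thesis
      by (rule power2_le_imp_le[OF _ mult_nonneg_nonneg[OF nrm_nonneg[OF X] exp_ge_zero]])
  qed
  obtain C where C: "\<And>U. U \<in> X \<Longrightarrow> nrm (S t U) \<le> C * nrm U"
    using sgD(3)[OF t] by blast
  show ?thesis
  proof (rule field_le_epsilon)
    fix e :: real assume e: "0 < e"
    \<comment> \<open>Two errors have to fit into \<open>e\<close>: at most \<open>d\<close> from
      the norm of \<open>T'\<close> and at most \<open>\<bar>C\<bar> * d\<close> from
      \<open>S t\<close> applied to \<open>T - T'\<close>.\<close>
    define d where "d = e / (\<bar>C\<bar> + 1)"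
    have d: "0 < d" using e by (simp add: d_def)
    obtain T' V where T': "(T', V) \<in> generator_graph X nrm S" "nrm (\<lambda>\<phi>. T \<phi> - T' \<phi>) < d"
      using dense[OF T d] by blast
    have X': "T' \<in> X" using T'(1) by (simp add: generator_graph_def)
    have "S t (\<lambda>\<phi>. 1 * T \<phi> + (- 1) * T' \<phi>) = (\<lambda>\<phi>. 1 * S t T \<phi> + (- 1) * S t T' \<phi>)"
      by (intro sgD(2) t T X')
    then have "nrm (S t T) \<le> nrm (S t T') + nrm (S t (\<lambda>\<phi>. T \<phi> - T' \<phi>))"
      using nrm_triangle_diff[OF sgD(1)[OF t T] sgD(1)[OF t X']] by simp
    also have "nrm (S t (\<lambda>\<phi>. T \<phi> - T' \<phi>)) \<le> C * nrm (\<lambda>\<phi>. T \<phi> - T' \<phi>)"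
      by (intro C diff_closed T X')
    also have "\<dots> \<le> \<bar>C\<bar> * d"
      using T'(2) nrm_nonneg[OF diff_closed[OF T X']] by (intro mult_mono) auto
    also have "nrm (S t T') \<le> nrm T' * exp (- t)"
      by (rule domain[OF T'(1) t])
    also have "\<dots> \<le> (nrm T + d) * exp (- t)"
      using nrm_triangle_diff[OF X' T] nrm_diff_commute[OF T X'] T'(2) by (intro mult_right_mono) auto
    also have "\<dots> \<le> nrm T * exp (- t) + d"
      using d t by (simp add: distrib_right)
    finally have "nrm (S t T) \<le> nrm T * exp (- t) + d * (\<bar>C\<bar> + 1)"
      by (simp add: algebra_simps)
    then show "nrm (S t T) \<le> nrm T * exp (- t) + e"
      by (simp add: d_def)
  qed
qed

section \<open>Test functions and vanishing distributional derivatives\<close>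

lemma DERIV_transform_nhds:
  fixes f h :: "real \<Rightarrow> real"
  assumes "(f has_real_derivative D) (at x)" "\<forall>\<^sub>F y in nhds x. f y = h y"
  shows "(h has_real_derivative D) (at x)"
  using assms(1) DERIV_cong_ev[OF refl assms(2) refl] by blast

section \<open>Calculus of smooth functions\<close>

definition smooth :: "(real \<Rightarrow> real) \<Rightarrow> bool" where
  "smooth f \<longleftrightarrow> (\<forall>n x. (deriv ^^ n) f differentiable (at x))"

text \<open>Counting the order allows induction for sums and products: the derivative of a product
  is a sum of products with one order less, which is no longer of the shape that a plain invariant
  would describe.\<close>

definition diff_upto :: "nat \<Rightarrow> (real \<Rightarrow> real) \<Rightarrow> bool" where
  "diff_upto n f \<longleftrightarrow> (\<forall>k<n. \<forall>x. (deriv ^^ k) f differentiable (at x))"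

lemma smooth_iff_diff_upto: "smooth f \<longleftrightarrow> (\<forall>n. diff_upto n f)"
  by (auto simp: smooth_def diff_upto_def)

lemma diff_upto_0 [simp]: "diff_upto 0 f"
  by (simp add: diff_upto_def)

lemma diff_upto_Suc: "diff_upto (Suc n) f \<longleftrightarrow> (\<forall>x. f differentiable (at x)) \<and> diff_upto n (deriv f)"
  unfolding diff_upto_def All_less_Suc2 by (simp add: funpow_swap1)

lemma diff_upto_mono: "diff_upto (Suc n) f \<Longrightarrow> diff_upto n f"
  by (simp add: diff_upto_def)

text \<open>A class of differentiable functions that is closed under \<open>deriv\<close> contains
  only smooth ones. This suits families given by a formula with parameters.\<close>

lemma smooth_coinduct:
  assumes "A f" and step: "\<And>f. A f \<Longrightarrow> (\<forall>x. f differentiable (at x)) \<and> A (deriv f)"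
  shows "smooth f"
proof -
  have "A f \<Longrightarrow> diff_upto n f" for n f
    by (induction n arbitrary: f) (auto simp: diff_upto_Suc dest: step)
  with assms(1) show ?thesis by (simp add: smooth_iff_diff_upto)
qed

lemma smooth_differentiable: "smooth f \<Longrightarrow> f differentiable (at x)"
  unfolding smooth_def by (metis funpow_0)

lemma smooth_DERIV: "smooth f \<Longrightarrow> (f has_real_derivative deriv f x) (at x)"
  by (simp add: DERIV_deriv_iff_real_differentiable smooth_differentiable)

lemma smooth_deriv: "smooth f \<Longrightarrow> smooth (deriv f)"
  unfolding smooth_iff_diff_upto using diff_upto_Suc by blast

lemma smooth_continuous_on: "smooth f \<Longrightarrow> continuous_on A f"
  by (rule DERIV_continuous_on[of _ _ "deriv f"])
    (auto intro: smooth_DERIV has_field_derivative_at_within)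

lemma smooth_const: "smooth (\<lambda>x. c)"
  by (rule smooth_coinduct[where A = "\<lambda>f. \<exists>c. f = (\<lambda>x. c)"]) auto

lemma smooth_ident: "smooth (\<lambda>x. x)"
proof (rule smooth_coinduct[where A = "\<lambda>f. f = (\<lambda>x. x) \<or> smooth f"])
  fix f :: "real \<Rightarrow> real" assume "f = (\<lambda>x. x) \<or> smooth f"
  moreover have "deriv (\<lambda>x::real. x) = (\<lambda>x. 1)" by (simp add: fun_eq_iff)
  ultimately show "(\<forall>x. f differentiable at x) \<and> (deriv f = (\<lambda>x. x) \<or> smooth (deriv f))"
    by (auto simp: smooth_const smooth_differentiable smooth_deriv)
qed simp

lemma diff_upto_add: "diff_upto n f \<Longrightarrow> diff_upto n h \<Longrightarrow> diff_upto n (\<lambda>x. f x + h x)"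
proof (induction n arbitrary: f h)
  case (Suc n)
  then have "deriv (\<lambda>x. f x + h x) = (\<lambda>x. deriv f x + deriv h x)"
    by (auto simp: diff_upto_Suc fun_eq_iff DERIV_deriv_iff_real_differentiable intro!: DERIV_imp_deriv DERIV_add)
  with Suc show ?case by (auto simp: diff_upto_Suc)
qed simp

lemma diff_upto_mult: "diff_upto n f \<Longrightarrow> diff_upto n h \<Longrightarrow> diff_upto n (\<lambda>x. f x * h x)"
proof (induction n arbitrary: f h)
  case (Suc n)
  then have *: "deriv (\<lambda>x. f x * h x) = (\<lambda>x. deriv f x * h x + deriv h x * f x)"
    by (auto simp: diff_upto_Suc fun_eq_iff DERIV_deriv_iff_real_differentiable intro!: DERIV_imp_deriv DERIV_mult)
  have "diff_upto n (deriv (\<lambda>x. f x * h x))"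
    unfolding * using Suc.prems[THEN diff_upto_mono] Suc.prems
    by (intro diff_upto_add Suc.IH) (simp_all add: diff_upto_Suc)
  with Suc show ?case by (auto simp: diff_upto_Suc)
qed simp

lemma smooth_add: "smooth f \<Longrightarrow> smooth h \<Longrightarrow> smooth (\<lambda>x. f x + h x)"
  by (simp add: smooth_iff_diff_upto diff_upto_add)

lemma smooth_mult: "smooth f \<Longrightarrow> smooth h \<Longrightarrow> smooth (\<lambda>x. f x * h x)"
  by (simp add: smooth_iff_diff_upto diff_upto_mult)

lemma smooth_affine: 
  assumes "smooth f"
  shows "smooth (\<lambda>x. f (a * x + b))"
\<comment> \<open>The factor \<open>c\<close> in the invariant collects the powers of
  \<open>a\<close> produced by the chain rule.\<close>
proof (rule smooth_coinduct[where A = "\<lambda>h. \<exists>c f. smooth f \<and> h = (\<lambda>x. c * f (a * x + b))"])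
  have "(\<lambda>x. f (a * x + b)) = (\<lambda>x. 1 * f (a * x + b))" by simp
  then show "\<exists>c f'. smooth f' \<and> (\<lambda>x. f (a * x + b)) = (\<lambda>x. c * f' (a * x + b))"
    using assms by blast
next
  fix h assume "\<exists>c f. smooth f \<and> h = (\<lambda>x. c * f (a * x + b))"
  then obtain c f where f: "smooth f" and h: "h = (\<lambda>x. c * f (a * x + b))" by blast
  have D: "(h has_real_derivative (c * a) * deriv f (a * x + b)) (at x)" for x
    unfolding h by (auto intro!: derivative_eq_intros DERIV_chain2[OF smooth_DERIV[OF f]])
  then have "deriv h = (\<lambda>x. (c * a) * deriv f (a * x + b))"
    by (auto intro!: DERIV_imp_deriv)
  then show "(\<forall>x. h differentiable at x) \<and> (\<exists>c f. smooth f \<and> deriv h = (\<lambda>x. c * f (a * x + b)))"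
    using D smooth_deriv[OF f] by (auto simp: real_differentiable_def)
qed

text \<open>The polynomial makes the family closed under differentiation: with
  \<open>t = 1 / x\<close> the derivative in \<open>x\<close> is \<open>- t^2\<close> times that in
  \<open>t\<close>, so \<open>p\<close> becomes \<open>t^2 * (p - p')\<close>. The value
  \<open>p = 1\<close> gives the usual flat function.\<close>

definition exp_recip :: "real poly \<Rightarrow> real \<Rightarrow> real" where
  "exp_recip p x = (if 0 < x then poly p (1 / x) * exp (- (1 / x)) else 0)"

text \<open>The power \<open>t ^ k\<close> is there for the induction, since \<open>pCons\<close>
  moves one factor \<open>t\<close> out of the polynomial.\<close>

lemma power_poly_times_exp_tendsto_0:
  "((\<lambda>t::real. t ^ k * (poly p t * exp (- t))) \<longlongrightarrow> 0) at_top"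
proof (induction p arbitrary: k)
  case (pCons a p)
  have "((\<lambda>t::real. a * (t ^ k / exp t) + t ^ Suc k * (poly p t * exp (- t))) \<longlongrightarrow> a * 0 + 0) at_top"
    by (intro tendsto_intros tendsto_power_div_exp_0 pCons)
  then show ?case by (simp add: exp_minus field_simps)
qed simp

lemma exp_recip_DERIV:
  "(exp_recip p has_real_derivative exp_recip ([:0, 0, 1:] * (p - pderiv p)) x) (at x)"
proof -
  consider "x < 0" | "x > 0" | "x = 0" by linarith
  then show ?thesis
  proof cases
    case 1
    have "((\<lambda>_. 0::real) has_real_derivative 0) (at x)" by simp
    moreover have "\<forall>\<^sub>F y in nhds x. (0::real) = exp_recip p y"
      using eventually_nhds_in_open[of "{..<0}" x] 1
      by (auto elim!: eventually_mono simp: exp_recip_def)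
    ultimately have "(exp_recip p has_real_derivative 0) (at x)"
      by (rule DERIV_transform_nhds)
    then show ?thesis using 1 by (simp add: exp_recip_def)
  next
    case 2
    have "((\<lambda>y. poly p (1 / y) * exp (- (1 / y))) has_real_derivative
        exp_recip ([:0, 0, 1:] * (p - pderiv p)) x) (at x)"
      using 2 by (auto intro!: derivative_eq_intros poly_DERIV DERIV_chain2[of "poly p"] 
          simp: exp_recip_def field_simps power2_eq_square)
    moreover have "\<forall>\<^sub>F y in nhds x. poly p (1 / y) * exp (- (1 / y)) = exp_recip p y"
      using eventually_nhds_in_open[of "{0<..}" x] 2
      by (auto elim!: eventually_mono simp: exp_recip_def)
    ultimately show ?thesis
      by (rule DERIV_transform_nhds)
  next
    case 3
    \<comment> \<open>Dividing by \<open>h\<close> adds one power of \<open>1 / h\<close>, which is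
      the case \<open>k = 1\<close> of the limit at infinity.\<close>
    have "((\<lambda>h. exp_recip p h / h) \<longlongrightarrow> 0) (at_right 0)"
    proof (rule Lim_transform_eventually)
      show "((\<lambda>h. (1 / h) ^ 1 * (poly p (1 / h) * exp (- (1 / h)))) \<longlongrightarrow> 0) (at_right 0)"
        using filterlim_compose[OF power_poly_times_exp_tendsto_0 filterlim_inverse_at_top_right, of 1 p]
        by (simp add: inverse_eq_divide)
      show "\<forall>\<^sub>F h in at_right 0. (1 / h) ^ 1 * (poly p (1 / h) * exp (- (1 / h))) = exp_recip p h / h"
        using eventually_at_right_less[of "0::real"] by eventually_elim (simp add: exp_recip_def)
    qed
    moreover have "((\<lambda>h. exp_recip p h / h) \<longlongrightarrow> 0) (at_left 0)"
      by (rule tendsto_eventually)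
        (auto simp: eventually_at_filter exp_recip_def)
    ultimately have "((\<lambda>h. exp_recip p h / h) \<longlongrightarrow> 0) (at 0)"
      by (simp add: filterlim_at_split)
    then show ?thesis using 3 by (simp add: DERIV_def exp_recip_def)
  qed
qed

lemma smooth_exp_recip: "smooth (exp_recip p)"
proof (rule smooth_coinduct[where A = "\<lambda>f. \<exists>p. f = exp_recip p"])
  fix f assume "\<exists>p. f = exp_recip p"
  then obtain p where f: "f = exp_recip p" by blast
  have "deriv f = exp_recip ([:0, 0, 1:] * (p - pderiv p))"
    unfolding f using DERIV_imp_deriv[OF exp_recip_DERIV] by (simp add: fun_eq_iff)
  then show "(\<forall>x. f differentiable at x) \<and> (\<exists>p. deriv f = exp_recip p)"
    unfolding f using exp_recip_DERIV real_differentiable_def by blast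
qed blast

section \<open>Test functions, their antiderivatives, and cutoffs\<close>

lemma test_fun_iff:
  "test_fun \<phi> \<longleftrightarrow> smooth \<phi> \<and> (\<exists>a b. 0 < a \<and> (\<forall>x. x \<notin> {a..b} \<longrightarrow> \<phi> x = 0))"
  by (simp add: test_fun_def smooth_def)

lemma test_fun_support:
  assumes "test_fun \<phi>"
  obtains a b where "0 < a" "a < b" "\<And>x. x \<notin> {a..b} \<Longrightarrow> \<phi> x = 0"
proof -
  obtain a b where "0 < a" "\<forall>x. x \<notin> {a..b} \<longrightarrow> \<phi> x = 0"
    using assms unfolding test_fun_iff by blast
  moreover from this have "\<phi> x = 0" if "x \<notin> {a..max b (a + 1)}" for x
    using that by (cases "x < a") auto
  ultimately show ?thesis by (intro that[of a "max b (a + 1)"]) auto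
qed

lemma deriv_eq_0_outside_support:
  fixes \<phi> :: "real \<Rightarrow> real"
  assumes supp: "\<And>x. x \<notin> {a..b} \<Longrightarrow> \<phi> x = 0" and "x \<notin> {a..b}"
  shows "deriv \<phi> x = 0"
proof -
  have "\<forall>\<^sub>F y in nhds x. y \<in> - {a..b}"
    using assms(2) by (intro eventually_nhds_in_open) auto
  then have "\<forall>\<^sub>F y in nhds x. \<phi> y = (\<lambda>_. 0) y"
    by eventually_elim (use supp in auto)
  then show ?thesis using deriv_cong_ev[OF _ refl] by fastforce
qed

lemma test_fun_deriv:
  assumes "test_fun \<phi>"
  shows "test_fun (deriv \<phi>)"
proof -
  obtain a b where ab: "0 < a" "a < b" "\<And>x. x \<notin> {a..b} \<Longrightarrow> \<phi> x = 0"
    using test_fun_support[OF assms] by blast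
  show ?thesis
    unfolding test_fun_iff
    using assms ab(1) deriv_eq_0_outside_support[of a b \<phi>, OF ab(3)]
    by (intro conjI exI[of _ a] exI[of _ b]) (auto simp: test_fun_iff smooth_deriv)
qed

lemma test_fun_mult_smooth: "smooth f \<Longrightarrow> test_fun \<phi> \<Longrightarrow> test_fun (\<lambda>x. f x * \<phi> x)"
  by (fastforce simp: test_fun_iff smooth_mult)

lemma test_fun_mult_y: "test_fun \<phi> \<Longrightarrow> test_fun (\<lambda>y. y * \<phi> y)"
  by (rule test_fun_mult_smooth[OF smooth_ident])

lemma test_fun_lin:
  assumes "test_fun \<phi>" "test_fun \<psi>"
  shows "test_fun (\<lambda>x. \<phi> x + c * \<psi> x)"
proof -
  obtain a b where ab: "0 < a" "\<forall>x. x \<notin> {a..b} \<longrightarrow> \<phi> x = 0"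
    using assms(1) unfolding test_fun_iff by blast
  obtain a' b' where ab': "0 < a'" "\<forall>x. x \<notin> {a'..b'} \<longrightarrow> \<psi> x = 0"
    using assms(2) unfolding test_fun_iff by blast
  have "smooth (\<lambda>x. \<phi> x + c * \<psi> x)"
    using assms by (intro smooth_add smooth_mult smooth_const) (auto simp: test_fun_iff)
  moreover have "\<phi> x + c * \<psi> x = 0" if "x \<notin> {min a a'..max b b'}" for x
  proof -
    have "x \<notin> {a..b}" "x \<notin> {a'..b'}" using that by auto
    then show ?thesis by (simp add: ab(2) ab'(2) del: atLeastAtMost_iff)
  qed
  ultimately show ?thesis
    using ab ab' unfolding test_fun_iff by (intro conjI exI[of _ "min a a'"] exI[of _ "max b b'"]) auto
qed

lemma test_fun_DERIV: "test_fun \<phi> \<Longrightarrow> (\<phi> has_real_derivative deriv \<phi> x) (at x)"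
  by (simp add: test_fun_iff smooth_DERIV)

lemma test_fun_continuous_on: "test_fun \<phi> \<Longrightarrow> continuous_on A \<phi>"
  by (simp add: test_fun_iff smooth_continuous_on)

lemma test_fun_borel [measurable_dest]: "test_fun \<phi> \<Longrightarrow> \<phi> \<in> borel_measurable borel"
  by (intro borel_measurable_continuous_onI test_fun_continuous_on)

lemma test_fun_bounded:
  assumes "test_fun \<phi>"
  obtains B where "0 \<le> B" "\<And>x. \<bar>\<phi> x\<bar> \<le> B"
proof -
  obtain a b where ab: "0 < a" "a < b" "\<And>x. x \<notin> {a..b} \<Longrightarrow> \<phi> x = 0"
    using test_fun_support[OF assms] by blast
  have "compact (\<phi> ` {a..b})"
    by (intro compact_continuous_image test_fun_continuous_on assms compact_Icc)
  then obtain B where B: "\<And>x. x \<in> {a..b} \<Longrightarrow> \<bar>\<phi> x\<bar> \<le> B"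
    using compact_imp_bounded by (force simp: bounded_iff)
  show ?thesis
  proof (rule that[of "\<bar>B\<bar>"])
    show "\<bar>\<phi> x\<bar> \<le> \<bar>B\<bar>" for x
      using B[of x] ab(3)[of x] by (cases "x \<in> {a..b}") auto
  qed simp
qed

lemma test_fun_integrable:
  assumes "test_fun \<phi>"
  shows "integrable lborel \<phi>"
proof -
  obtain a b where ab: "0 < a" "a < b" "\<And>x. x \<notin> {a..b} \<Longrightarrow> \<phi> x = 0"
    using test_fun_support[OF assms] by blast
  have "integrable lborel (\<lambda>x. indicator {a..b} x *\<^sub>R \<phi> x)"
    by (intro borel_integrable_compact compact_Icc test_fun_continuous_on assms)
  moreover have "(\<lambda>x. indicator {a..b} x *\<^sub>R \<phi> x) = \<phi>"
    using ab by (auto simp: fun_eq_iff indicator_def)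
  ultimately show ?thesis by simp
qed

text \<open>The primitive that starts at the left end of the support vanishes beyond the right end
  precisely because the mean is zero, so it has compact support in the open half-line. Smoothness
  follows because its derivative is smooth.\<close>

lemma test_fun_antideriv:
  assumes "test_fun \<psi>" and zero: "integral\<^sup>L lborel \<psi> = 0"
  obtains \<phi> where "test_fun \<phi>" "deriv \<phi> = \<psi>"
proof -
  obtain a b where ab: "0 < a" "a < b" "\<And>x. x \<notin> {a..b} \<Longrightarrow> \<psi> x = 0"
    using test_fun_support[OF assms(1)] by blast
  define F where "F x = (if a \<le> x then integral {a..x} \<psi> else 0)" for x
  have left: "F x = 0" if "x \<le> a" for x using that by (simp add: F_def)
  have "integral\<^sup>L lborel \<psi> = integral {a..b} \<psi>"
  proof -
    have "integral\<^sup>L lborel \<psi> = (LBINT x:{a..b}. \<psi> x)"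
      unfolding set_lebesgue_integral_def using ab(3)
      by (intro Bochner_Integration.integral_cong) (auto simp: indicator_def)
    also have "\<dots> = integral {a..b} \<psi>"
      by (intro set_borel_integral_eq_integral(2) borel_integrable_atLeastAtMost'
          test_fun_continuous_on assms)
    finally show ?thesis .
  qed
  then have int0: "integral {a..b} \<psi> = 0" using zero by simp
  have intble: "\<psi> integrable_on {c..d}" for c d
    by (intro integrable_continuous_interval test_fun_continuous_on assms)
  have right: "F x = 0" if "b \<le> x" for x
  proof -
    have "integral {a..x} \<psi> = integral {a..b} \<psi> + integral {b..x} \<psi>"
      using that ab by (intro Henstock_Kurzweil_Integration.integral_combine[symmetric] intble) auto
    moreover have "integral {b..x} \<psi> = 0"
    proof -
      have "(\<psi> has_integral 0) {b..x}"
        by (rule has_integral_spike[where S = "{b}" and f = "\<lambda>_. 0"]) (use ab in auto)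
      then show ?thesis by (rule integral_unique)
    qed
    ultimately show ?thesis using int0 that ab by (simp add: F_def)
  qed
  have D: "(F has_real_derivative \<psi> x) (at x)" for x
  proof (cases "x \<le> 0")
    case True
    have "\<forall>\<^sub>F y in nhds x. F y = 0"
      using eventually_nhds_in_open[of "{..<a}" x] True ab left
      by (auto elim!: eventually_mono)
    then have "(F has_real_derivative 0) (at x) \<longleftrightarrow> ((\<lambda>_. 0) has_real_derivative (0::real)) (at x)"
      by (intro DERIV_cong_ev) auto
    then show ?thesis using True ab by simp
  next
    case False
    \<comment> \<open>Any right end beyond \<open>x\<close> would do: the derivative of the integral
      is available within a closed interval, and \<open>x\<close> has to be an interior point of
      it.\<close>
    define c where "c = x + 1"
    have eq: "F y = integral {0..y} \<psi>" if "0 \<le> y" for y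
    proof (cases "a \<le> y")
      case True
      have "integral {0..y} \<psi> = integral {0..a} \<psi> + integral {a..y} \<psi>"
        using True ab by (intro Henstock_Kurzweil_Integration.integral_combine[symmetric] intble) auto
      moreover have "(\<psi> has_integral 0) {0..a}"
        by (rule has_integral_spike[where S = "{a}" and f = "\<lambda>_. 0"]) (use ab in auto)
      ultimately show ?thesis using True by (simp add: F_def integral_unique)
    next
      case False
      have "(\<psi> has_integral 0) {0..y}"
        by (rule has_integral_spike[where S = "{}" and f = "\<lambda>_. 0"]) (use False ab in auto)
      then show ?thesis using False by (simp add: F_def integral_unique)
    qed
    have "((\<lambda>y. integral {0..y} \<psi>) has_real_derivative \<psi> x) (at x within {0..c})"
      using False by (intro integral_has_real_derivative test_fun_continuous_on assms) (auto simp: c_def)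
    moreover have "at x within {0..c} = at x"
      using False by (intro at_within_interior) (auto simp: c_def)
    ultimately have "((\<lambda>y. integral {0..y} \<psi>) has_real_derivative \<psi> x) (at x)" by simp
    moreover have "\<forall>\<^sub>F y in nhds x. integral {0..y} \<psi> = F y"
      using eventually_nhds_in_open[of "{0<..}" x] False eq
      by (auto elim!: eventually_mono)
    ultimately show ?thesis
      by (rule DERIV_transform_nhds)
  qed
  then have dF: "deriv F = \<psi>" by (auto intro!: DERIV_imp_deriv)
  have "smooth F"
  proof (rule smooth_coinduct[where A = "\<lambda>f. f = F \<or> smooth f"])
    fix f assume "f = F \<or> smooth f"
    moreover have "\<forall>x. F differentiable at x" using D real_differentiable_def by blast
    moreover have "smooth \<psi>" using assms(1) by (simp add: test_fun_iff)
    ultimately show "(\<forall>x. f differentiable at x) \<and> (deriv f = F \<or> smooth (deriv f))"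
      using dF by (auto simp: smooth_differentiable smooth_deriv)
  qed simp
  then have "test_fun F"
    unfolding test_fun_iff using left right ab(1)
    by (intro conjI exI[of _ a] exI[of _ b]) (auto simp: not_le)
  then show ?thesis using dF that by blast
qed

text \<open>The subtracted 1 keeps the support inside \<open>[a + 1 / n, n]\<close>, so that \<open>a = 0\<close> is allowed.\<close>

definition cutoff :: "real \<Rightarrow> nat \<Rightarrow> real \<Rightarrow> real" where
  "cutoff a n y = exp_recip 1 (real n * (y - a) - 1) * exp_recip 1 (real n * (real n - y))"

lemma exp_recip_1_bounds: "0 \<le> exp_recip 1 x" "exp_recip 1 x \<le> 1"
  by (auto simp: exp_recip_def)

lemma cutoff_bounds: "0 \<le> cutoff a n y" "cutoff a n y \<le> 1"
  by (auto simp: cutoff_def exp_recip_1_bounds mult_le_one)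

lemma test_fun_cutoff:
  assumes "0 \<le> a" "0 < n"
  shows "test_fun (cutoff a n)"
proof -
  have "smooth (\<lambda>y. exp_recip 1 (real n * y + (- real n * a - 1)) * exp_recip 1 (- real n * y + real n * real n))"
    by (intro smooth_mult smooth_affine smooth_exp_recip)
  moreover have "cutoff a n = (\<lambda>y. exp_recip 1 (real n * y + (- real n * a - 1)) * exp_recip 1 (- real n * y + real n * real n))"
    by (simp add: cutoff_def fun_eq_iff algebra_simps)
  ultimately have "smooth (cutoff a n)" by simp
  moreover have "0 < a + 1 / n" using assms by (simp add: add_nonneg_pos)
  moreover have "cutoff a n x = 0" if "x \<notin> {a + 1 / n..real n}" for x
  proof -
  from that have "\<not> 0 < real n * (x - a) - 1 \<or> \<not> 0 < real n * (real n - x)"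
    using assms by (auto simp: field_simps zero_less_mult_iff)
  then show ?thesis
    by (auto simp: cutoff_def exp_recip_def)
  qed
  ultimately show ?thesis unfolding test_fun_iff by blast
qed

lemma exp_recip_1_tendsto:
  assumes "filterlim f at_top F"
  shows "((\<lambda>n. exp_recip 1 (f n)) \<longlongrightarrow> 1) F"
proof (rule Lim_transform_eventually)
  have "((\<lambda>n. exp (- inverse (f n))) \<longlongrightarrow> exp (- 0)) F"
    by (intro tendsto_intros tendsto_inverse_0_at_top assms)
  then show "((\<lambda>n. exp (- inverse (f n))) \<longlongrightarrow> 1) F" by simp
  have "\<forall>\<^sub>F n in F. 0 < f n"
    using assms by (simp add: filterlim_at_top_dense)
  then show "\<forall>\<^sub>F n in F. exp (- inverse (f n)) = exp_recip 1 (f n)"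
    by eventually_elim (simp add: exp_recip_def inverse_eq_divide)
qed

lemma cutoff_tendsto: "(\<lambda>n. cutoff a n y) \<longlonglongrightarrow> indicator {a<..} y"
proof (cases "a < y")
  case True
  have "filterlim (\<lambda>n. real n * (y - a) - 1) at_top sequentially"
    using True by real_asymp
  moreover have "filterlim (\<lambda>n. real n * (real n - y)) at_top sequentially"
    by real_asymp
  ultimately have "(\<lambda>n. cutoff a n y) \<longlonglongrightarrow> 1 * 1"
    unfolding cutoff_def by (intro tendsto_mult exp_recip_1_tendsto)
  then show ?thesis using True by simp
next
  case False
  have "cutoff a n y = 0" for n
  proof -
    have "real n * (y - a) \<le> 0" using False by (simp add: mult_nonneg_nonpos)
    then show ?thesis by (simp add: cutoff_def exp_recip_def)
  qed
  then show ?thesis using False by simp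
qed

text \<open>On \<open>[1, n - 1]\<close> both arguments of \<open>exp_recip 1\<close> are at least
  1, so each factor is at least \<open>exp (- 1)\<close>. The point is that the integrals grow
  without bound.\<close>

lemma integral_cutoff_lower:
  assumes "2 \<le> n"
  shows "exp (- 2) * (real n - 2) \<le> integral\<^sup>L lborel (cutoff 0 n)"
proof -
  have "exp (- 2) * indicator {1..real n - 1} y \<le> cutoff 0 n y" for y
  proof (cases "y \<in> {1..real n - 1}")
    case True
    have "1 \<le> real n * y - 1"
      using True assms mult_mono[of 2 "real n" 1 y] by simp
    moreover have "1 \<le> real n * (real n - y)"
      using True assms mult_mono[of 1 "real n" 1 "real n - y"] by simp
    moreover have "exp (- 1) \<le> exp_recip 1 x" if "1 \<le> x" for x
      using that by (simp add: exp_recip_def)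
    ultimately have "exp (- 1) * exp (- 1) \<le> cutoff 0 n y"
      unfolding cutoff_def by (intro mult_mono) (auto simp: exp_recip_1_bounds)
    then show ?thesis using True by (simp flip: exp_add)
  qed (simp add: cutoff_bounds)
  then have "(\<integral>y. exp (- 2) * indicator {1..real n - 1} y \<partial>lborel) \<le> integral\<^sup>L lborel (cutoff 0 n)"
    using assms by (intro integral_mono test_fun_integrable[OF test_fun_cutoff]) auto
  then show ?thesis using assms by simp
qed

section \<open>A vanishing distributional derivative on the half-line\<close>

text \<open>The positive and the negative part are densities of two finite measures that agree on
  all half-lines \<open>{a<..}\<close>. Such sets determine a Borel measure, so the densities agree
  almost everywhere; as at most one of them is nonzero at a point, both vanish.\<close>

lemma AE_eq_0_if_tail_integrals_0:
  fixes f :: "real \<Rightarrow> real"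
  assumes int: "integrable lborel f" and tail: "\<And>a. (LBINT x:{a<..}. f x) = 0"
  shows "AE x in lborel. f x = 0"
proof -
  have [measurable]: "f \<in> borel_measurable borel" using borel_measurable_integrable[OF int] by simp
  define p where "p x = max 0 (f x)" for x
  define q where "q x = max 0 (- f x)" for x
  have [measurable]: "p \<in> borel_measurable borel" "q \<in> borel_measurable borel"
    by (simp_all add: p_def[abs_def] q_def[abs_def])
  have pq: "integrable lborel p" "integrable lborel q"
    unfolding p_def[abs_def] q_def[abs_def] using int by auto
  have em: "emeasure (density lborel (\<lambda>x. ennreal (r x))) {a<..} = ennreal (LBINT x:{a<..}. r x)"
    if "integrable lborel r" "\<And>x. 0 \<le> r x" for r :: "real \<Rightarrow> real" and a
  proof -
    have [measurable]: "r \<in> borel_measurable borel" using borel_measurable_integrable[OF that(1)] by simp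
    have "emeasure (density lborel (\<lambda>x. ennreal (r x))) {a<..} = (\<integral>\<^sup>+x. ennreal (r x) * indicator {a<..} x \<partial>lborel)"
      by (rule emeasure_density) auto
    also have "\<dots> = (\<integral>\<^sup>+x. ennreal (indicator {a<..} x *\<^sub>R r x) \<partial>lborel)"
      by (intro nn_integral_cong) (auto simp: indicator_def)
    also have "\<dots> = ennreal (LBINT x:{a<..}. r x)"
      unfolding set_lebesgue_integral_def using that
      by (intro nn_integral_eq_integral integrable_mult_indicator) (simp_all add: that)
    finally show ?thesis .
  qed
  have "(LBINT x:{a<..}. p x) - (LBINT x:{a<..}. q x) = 0" for a
  proof -
    have "(LBINT x:{a<..}. p x) - (LBINT x:{a<..}. q x) = (LBINT x:{a<..}. p x - q x)"
      using pq by (intro set_integral_diff(2)[symmetric])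
        (unfold set_integrable_def, (intro integrable_mult_indicator, simp, simp)+)
    also have "(\<lambda>x. p x - q x) = f" by (auto simp: p_def q_def fun_eq_iff)
    finally show ?thesis using tail by simp
  qed
  then have eq: "(LBINT x:{a<..}. p x) = (LBINT x:{a<..}. q x)" for a by simp
  have "density lborel (\<lambda>x. ennreal (p x)) = density lborel (\<lambda>x. ennreal (q x))"
  proof (rule measure_eqI_lessThan)
    show "emeasure (density lborel (\<lambda>x. ennreal (p x))) {a<..} < \<infinity>" for a
      using em[OF pq(1)] by (simp add: p_def)
    show "emeasure (density lborel (\<lambda>x. ennreal (p x))) {a<..} = emeasure (density lborel (\<lambda>x. ennreal (q x))) {a<..}" for a
      using em[OF pq(1)] em[OF pq(2)] eq by (simp add: p_def q_def)
  qed simp_all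
  then have "AE x in lborel. ennreal (p x) = ennreal (q x)"
    by (subst (asm) sigma_finite_measure.density_unique_iff[OF lborel.sigma_finite_measure_axioms]) auto
  then show ?thesis
    by eventually_elim (auto simp: p_def q_def max_def split: if_splits)
qed

text \<open>The du Bois-Reymond argument, adapted to an unbounded interval. Tested against functions
  of mean zero, which are derivatives of test functions, \<open>H\<close> gives 0, so it acts on
  every test function as a constant \<open>c\<close>. Integrability up to infinity excludes
  \<open>c \<noteq> 0\<close>, and cutoffs that increase to a half-line then yield the tail
  integrals.\<close>

theorem AE_eq_0_if_distributional_derivative_0:
  assumes H: "set_integrable lborel {0<..} H"
    and weak: "\<And>\<phi>. test_fun \<phi> \<Longrightarrow> (LBINT y:{0<..}. H y * deriv \<phi> y) = 0"
  shows "AE y in lborel. 0 < y \<longrightarrow> H y = 0"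
proof -
  define f where "f y = indicator {0<..} y * H y" for y
  have f: "integrable lborel f"
    using H by (simp add: set_integrable_def f_def[abs_def])
  have [measurable]: "f \<in> borel_measurable borel" using borel_measurable_integrable[OF f] by simp
  have int: "integrable lborel (\<lambda>y. f y * \<psi> y)" if "test_fun \<psi>" for \<psi>
  proof -
    obtain B where B: "0 \<le> B" "\<And>x. \<bar>\<psi> x\<bar> \<le> B" using test_fun_bounded[OF \<open>test_fun \<psi>\<close>] by blast
    show ?thesis
    proof (rule Bochner_Integration.integrable_bound)
      show "integrable lborel (\<lambda>y. B * f y)" using f by simp
      show "(\<lambda>y. f y * \<psi> y) \<in> borel_measurable lborel" using that by measurable
      show "AE y in lborel. norm (f y * \<psi> y) \<le> norm (B * f y)"
        using B by (auto simp: abs_mult mult.commute[of B] intro!: mult_left_mono)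
    qed
  qed
  have weak': "(\<integral>y. f y * deriv \<phi> y \<partial>lborel) = 0" if "test_fun \<phi>" for \<phi>
    using weak[OF that] by (simp add: set_lebesgue_integral_def f_def mult.assoc)
  \<comment> \<open>A reference function with positive integral; 3 is the least index for which the
    lower bound \<open>exp (- 2) * (real n - 2)\<close> is positive.\<close>
  define \<eta> where "\<eta> = cutoff 0 3"
  have \<eta>: "test_fun \<eta>" by (simp add: \<eta>_def test_fun_cutoff)
  define Z where "Z = integral\<^sup>L lborel \<eta>"
  have "exp (- 2) * (real 3 - 2) \<le> Z"
    unfolding Z_def \<eta>_def by (rule integral_cutoff_lower) simp
  then have "0 < Z" by (rule less_le_trans[rotated]) simp
  define c where "c = (\<integral>y. f y * \<eta> y \<partial>lborel) / Z"
  have const: "(\<integral>y. f y * \<psi> y \<partial>lborel) = c * integral\<^sup>L lborel \<psi>" if \<psi>: "test_fun \<psi>" for \<psi>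
  proof -
    \<comment> \<open>The multiple of \<open>\<eta>\<close> that removes the mean of
      \<open>\<psi>\<close>.\<close>
    let ?k = "- (integral\<^sup>L lborel \<psi> / Z)"
    have t: "test_fun (\<lambda>y. \<psi> y + ?k * \<eta> y)" by (rule test_fun_lin[OF \<psi> \<eta>])
    have "integral\<^sup>L lborel (\<lambda>y. \<psi> y + ?k * \<eta> y) = 0"
      using test_fun_integrable[OF \<psi>] test_fun_integrable[OF \<eta>] \<open>0 < Z\<close> by (simp add: Z_def)
    then obtain \<phi> where "test_fun \<phi>" "deriv \<phi> = (\<lambda>y. \<psi> y + ?k * \<eta> y)"
      using test_fun_antideriv[OF t] by blast
    then have "(\<integral>y. f y * (\<psi> y + ?k * \<eta> y) \<partial>lborel) = 0" using weak' by metis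
    moreover have "(\<integral>y. f y * (\<psi> y + ?k * \<eta> y) \<partial>lborel) = (\<integral>y. f y * \<psi> y \<partial>lborel) + ?k * (\<integral>y. f y * \<eta> y \<partial>lborel)"
    proof -
      have "(\<lambda>y. f y * (\<psi> y + ?k * \<eta> y)) = (\<lambda>y. f y * \<psi> y + ?k * (f y * \<eta> y))"
        by (simp add: fun_eq_iff algebra_simps)
      then show ?thesis using int[OF \<psi>] int[OF \<eta>] by simp
    qed
    ultimately show ?thesis by (simp add: c_def)
  qed
  have "c = 0"
  proof (rule ccontr)
    assume "c \<noteq> 0"
    define B where "B = integral\<^sup>L lborel (\<lambda>y. \<bar>f y\<bar>)"
    have bound: "\<bar>c\<bar> * (exp (- 2) * (real n - 2)) \<le> B" if "2 \<le> n" for n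
    proof -
      have t: "test_fun (cutoff 0 n)" using that by (intro test_fun_cutoff) auto
      have "\<bar>c\<bar> * (exp (- 2) * (real n - 2)) \<le> \<bar>c\<bar> * integral\<^sup>L lborel (cutoff 0 n)"
        by (intro mult_left_mono integral_cutoff_lower that) auto
      also have "\<dots> = \<bar>\<integral>y. f y * cutoff 0 n y \<partial>lborel\<bar>"
        using const[OF t] Bochner_Integration.integral_nonneg[of lborel "cutoff 0 n"]
        by (simp add: abs_mult cutoff_bounds)
      also have "\<dots> \<le> (\<integral>y. \<bar>f y * cutoff 0 n y\<bar> \<partial>lborel)" by (rule integral_abs_bound)
      also have "\<dots> \<le> B"
        unfolding B_def
      proof (rule integral_mono)
        show "integrable lborel (\<lambda>y. \<bar>f y * cutoff 0 n y\<bar>)" "integrable lborel (\<lambda>y. \<bar>f y\<bar>)"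
          using int[OF t] f by (auto intro: integrable_abs)
      qed (auto simp: abs_mult cutoff_bounds intro!: mult_right_le_one_le)
      finally show ?thesis .
    qed
    \<comment> \<open>For this \<open>n\<close> the constant \<open>c\<close> tested against
      \<open>cutoff 0 n\<close> exceeds \<open>B\<close>, the integral of
      \<open>\<bar>f\<bar>\<close>, although the cutoff is at most 1.\<close>
    obtain n :: nat where n: "B / (\<bar>c\<bar> * exp (- 2)) + 2 < real n" using reals_Archimedean2 by blast
    have "0 \<le> B" by (simp add: B_def)
    then have "0 \<le> B / (\<bar>c\<bar> * exp (- 2))" by simp
    then have "2 \<le> n" using n by linarith
    moreover have "B < \<bar>c\<bar> * (exp (- 2) * (real n - 2))"
    proof -
      have "B / (\<bar>c\<bar> * exp (- 2)) < real n - 2" using n by linarith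
      then show ?thesis using \<open>c \<noteq> 0\<close> by (simp add: pos_divide_less_eq ac_simps)
    qed
    ultimately show False using bound[of n] by simp
  qed
  have tail: "(LBINT y:{a<..}. f y) = 0" if "0 \<le> a" for a
  proof -
    \<comment> \<open>\<open>Suc n\<close>, because \<open>cutoff a 0\<close> is not covered by
      \<open>test_fun_cutoff\<close>.\<close>
    have "(\<lambda>n. \<integral>y. f y * cutoff a (Suc n) y \<partial>lborel) \<longlonglongrightarrow> (\<integral>y. f y * indicator {a<..} y \<partial>lborel)"
    proof (rule integral_dominated_convergence[where w = "\<lambda>y. \<bar>f y\<bar>"])
      show "(\<lambda>y. f y * cutoff a (Suc n) y) \<in> borel_measurable lborel" for n
        using test_fun_cutoff[OF that, of "Suc n"] by measurable
      show "AE y in lborel. (\<lambda>n. f y * cutoff a (Suc n) y) \<longlonglongrightarrow> f y * indicator {a<..} y"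
        by (auto intro!: tendsto_intros LIMSEQ_Suc cutoff_tendsto)
      show "AE y in lborel. norm (f y * cutoff a (Suc n) y) \<le> \<bar>f y\<bar>" for n
        by (auto simp: abs_mult cutoff_bounds intro!: mult_right_le_one_le)
    qed (use f in auto)
    moreover have "(\<lambda>n. \<integral>y. f y * cutoff a (Suc n) y \<partial>lborel) = (\<lambda>n. 0)"
      using const[OF test_fun_cutoff[OF that]] \<open>c = 0\<close> by simp
    ultimately have "(\<integral>y. f y * indicator {a<..} y \<partial>lborel) = 0"
      by (simp add: LIMSEQ_const_iff)
    then show ?thesis by (simp add: set_lebesgue_integral_def mult.commute)
  qed
  have "AE y in lborel. f y = 0"
  proof (rule AE_eq_0_if_tail_integrals_0[OF f])
    fix a
    show "(LBINT y:{a<..}. f y) = 0"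
    proof (cases "0 \<le> a")
      case False
      then have "(LBINT y:{a<..}. f y) = (LBINT y:{0<..}. f y)"
        unfolding set_lebesgue_integral_def
        by (intro Bochner_Integration.integral_cong) (auto simp: f_def indicator_def)
      then show ?thesis using tail[of 0] by simp
    qed (rule tail)
  qed
  then show ?thesis by eventually_elim (auto simp: f_def)
qed

section \<open>The half-line, weighted square integrability, and the Schur test\<close>

text \<open>A measure of its own spares the indicator of the half-line in every integral and gives a
  product measure for Tonelli and Fubini; the translations below connect it with the set integrals
  of the definitions.\<close>

definition half_line :: "real measure" where
  "half_line = restrict_space lborel {0<..}"

lemma space_half_line [simp]: "space half_line = {0<..}"
  by (simp add: half_line_def space_restrict_space)

lemma sets_half_line [measurable_cong]: "sets half_line = sets (restrict_space borel {0<..})"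
  by (simp add: half_line_def sets_restrict_space)

lemma sigma_finite_half_line: "sigma_finite_measure half_line"
  unfolding half_line_def
  by (intro sigma_finite_measure_restrict_space lborel.sigma_finite_measure_axioms) simp

interpretation half_line: sigma_finite_measure half_line
  by (rule sigma_finite_half_line)

interpretation half_line_pair: pair_sigma_finite half_line half_line ..

lemma borel_imp_half_line: "f \<in> borel_measurable borel \<Longrightarrow> f \<in> borel_measurable half_line"
  unfolding half_line_def by (simp add: measurable_restrict_space1)

lemma id_measurable_half_line [measurable]: "(\<lambda>x. x) \<in> borel_measurable half_line"
  by (rule borel_imp_half_line) simp

lemma set_borel_measurable_half_line:
  fixes f :: "real \<Rightarrow> real"
  shows "set_borel_measurable lborel {0<..} f \<longleftrightarrow> f \<in> borel_measurable half_line"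
  unfolding set_borel_measurable_def half_line_def by (simp add: borel_measurable_restrict_space_iff)

lemma set_integrable_half_line:
  fixes f :: "real \<Rightarrow> real"
  shows "set_integrable lborel {0<..} f \<longleftrightarrow> integrable half_line f"
  unfolding set_integrable_def half_line_def by (simp add: integrable_restrict_space)

lemma set_integral_half_line:
  fixes f :: "real \<Rightarrow> real"
  shows "(LBINT y:{0<..}. f y) = integral\<^sup>L half_line f"
  unfolding set_lebesgue_integral_def half_line_def by (simp add: integral_restrict_space)

lemma nn_integral_half_line:
  "(\<integral>\<^sup>+y. f y \<partial>half_line) = (\<integral>\<^sup>+y. f y * indicator {0<..} y \<partial>lborel)"
  unfolding half_line_def by (simp add: nn_integral_restrict_space)

lemma AE_half_line: "(AE y in half_line. P y) \<longleftrightarrow> (AE y in lborel. 0 < y \<longrightarrow> P y)"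
  unfolding half_line_def by (simp add: AE_restrict_space_iff)

lemma AE_half_line_pos: "AE y in half_line. 0 < y"
  by (simp add: AE_half_line)

lemma set_integral_subset_half_line:
  fixes f :: "real \<Rightarrow> real"
  assumes "A \<subseteq> {0<..}"
  shows "(LBINT y:A. f y) = (\<integral>y. indicator A y * f y \<partial>half_line)"
    and "set_integrable lborel A f \<longleftrightarrow> integrable half_line (\<lambda>y. indicator A y * f y)"
proof -
  have "(\<lambda>y. indicator {0<..} y *\<^sub>R (indicator A y * f y)) = (\<lambda>y. indicator A y *\<^sub>R f y)"
    using assms by (auto simp: fun_eq_iff indicator_def)
  then show "(LBINT y:A. f y) = (\<integral>y. indicator A y * f y \<partial>half_line)"
    and "set_integrable lborel A f \<longleftrightarrow> integrable half_line (\<lambda>y. indicator A y * f y)"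
    by (simp_all add: set_lebesgue_integral_def set_integrable_def half_line_def
        integral_restrict_space integrable_restrict_space)
qed

lemma continuous_on_half_line_measurable:
  fixes f :: "real \<Rightarrow> real"
  assumes "continuous_on {0<..} f"
  shows "f \<in> borel_measurable half_line"
  using borel_measurable_continuous_on_restrict[OF assms]
  by (simp add: half_line_def measurable_def sets_restrict_space space_restrict_space)

section \<open>Functions that are square integrable with exponential weight\<close>

lemma L2_exp_iff:
  "f \<in> L2_exp \<mu> \<longleftrightarrow> f \<in> borel_measurable half_line \<and> integrable half_line (\<lambda>y. (f y)\<^sup>2 * exp (\<mu> * y))"
  by (simp add: L2_exp_def set_borel_measurable_half_line set_integrable_half_line)

lemma L2_exp_measurable: "f \<in> L2_exp \<mu> \<Longrightarrow> f \<in> borel_measurable half_line"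
  by (simp add: L2_exp_iff)

lemma exp_mult_measurable [measurable]: "(\<lambda>y. exp (\<mu> * y :: real)) \<in> borel_measurable half_line"
  by (rule borel_imp_half_line) simp

lemma L2_exp_mult_integrable:
  assumes "f \<in> L2_exp \<mu>" "h \<in> L2_exp \<mu>"
  shows "integrable half_line (\<lambda>y. f y * h y * exp (\<mu> * y))"
proof (rule Bochner_Integration.integrable_bound)
  have [measurable]: "f \<in> borel_measurable half_line" "h \<in> borel_measurable half_line"
    using assms by (auto simp: L2_exp_iff)
  show "integrable half_line (\<lambda>y. (f y)\<^sup>2 * exp (\<mu> * y) + (h y)\<^sup>2 * exp (\<mu> * y))"
    using assms by (simp add: L2_exp_iff)
  show "(\<lambda>y. f y * h y * exp (\<mu> * y)) \<in> borel_measurable half_line" by measurable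
  have "\<bar>a * b\<bar> \<le> a\<^sup>2 + b\<^sup>2" for a b :: real
  proof -
    have "2 * (\<bar>a\<bar> * \<bar>b\<bar>) \<le> a\<^sup>2 + b\<^sup>2"
      using sum_squares_bound[of "\<bar>a\<bar>" "\<bar>b\<bar>"] by simp
    moreover have "0 \<le> \<bar>a\<bar> * \<bar>b\<bar>" by simp
    ultimately show ?thesis unfolding abs_mult by linarith
  qed
  then show "AE y in half_line. norm (f y * h y * exp (\<mu> * y))
      \<le> norm ((f y)\<^sup>2 * exp (\<mu> * y) + (h y)\<^sup>2 * exp (\<mu> * y))"
    by (auto simp: abs_mult simp flip: distrib_right)
qed

lemma L2_exp_lin:
  assumes "f \<in> L2_exp \<mu>" "h \<in> L2_exp \<mu>"
  shows "(\<lambda>y. a * f y + b * h y) \<in> L2_exp \<mu>"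
proof -
  have [measurable]: "f \<in> borel_measurable half_line" "h \<in> borel_measurable half_line"
    using assms by (auto simp: L2_exp_iff)
  have "integrable half_line (\<lambda>y. a\<^sup>2 * ((f y)\<^sup>2 * exp (\<mu> * y)) + 2 * a * b * (f y * h y * exp (\<mu> * y))
      + b\<^sup>2 * ((h y)\<^sup>2 * exp (\<mu> * y)))"
    using assms L2_exp_mult_integrable[OF assms]
    by (intro Bochner_Integration.integrable_add integrable_mult_right) (simp_all add: L2_exp_iff)
  also have "(\<lambda>y. a\<^sup>2 * ((f y)\<^sup>2 * exp (\<mu> * y)) + 2 * a * b * (f y * h y * exp (\<mu> * y))
      + b\<^sup>2 * ((h y)\<^sup>2 * exp (\<mu> * y))) = (\<lambda>y. (a * f y + b * h y)\<^sup>2 * exp (\<mu> * y))"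
    by (simp add: fun_eq_iff power2_eq_square algebra_simps)
  finally show ?thesis by (simp add: L2_exp_iff)
qed

lemma L2_exp_add: "f \<in> L2_exp \<mu> \<Longrightarrow> h \<in> L2_exp \<mu> \<Longrightarrow> (\<lambda>y. f y + h y) \<in> L2_exp \<mu>"
  using L2_exp_lin[of f \<mu> h 1 1] by simp

lemma L2_exp_scale: "f \<in> L2_exp \<mu> \<Longrightarrow> (\<lambda>y. a * f y) \<in> L2_exp \<mu>"
  using L2_exp_lin[of f \<mu> f a 0] by simp

lemma L2_exp_dominated:
  assumes "f \<in> L2_exp \<mu>" "h \<in> borel_measurable half_line" "\<And>y. 0 < y \<Longrightarrow> \<bar>h y\<bar> \<le> \<bar>f y\<bar>"
  shows "h \<in> L2_exp \<mu>"
  unfolding L2_exp_iff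
proof
  show "integrable half_line (\<lambda>y. (h y)\<^sup>2 * exp (\<mu> * y))"
  proof (rule Bochner_Integration.integrable_bound)
    show "integrable half_line (\<lambda>y. (f y)\<^sup>2 * exp (\<mu> * y))" using assms by (simp add: L2_exp_iff)
    show "AE y in half_line. norm ((h y)\<^sup>2 * exp (\<mu> * y)) \<le> norm ((f y)\<^sup>2 * exp (\<mu> * y))"
      using AE_half_line_pos by eventually_elim (use assms(3) in \<open>auto intro!: mult_right_mono simp: abs_le_square_iff\<close>)
  qed (use assms(2) in measurable)
qed (rule assms(2))

definition ip_exp :: "real \<Rightarrow> (real \<Rightarrow> real) \<Rightarrow> (real \<Rightarrow> real) \<Rightarrow> real" where
  "ip_exp \<mu> f h = (\<integral>y. f y * h y * exp (\<mu> * y) \<partial>half_line)"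

lemma semi_inner_space_L2_exp: "semi_inner_space (L2_exp \<mu>) (ip_exp \<mu>)"
proof
  fix f h k a b assume fhk: "f \<in> L2_exp \<mu>" "h \<in> L2_exp \<mu>" "k \<in> L2_exp \<mu>"
  have "(\<lambda>y. (a * f y + b * h y) * k y * exp (\<mu> * y))
      = (\<lambda>y. a * (f y * k y * exp (\<mu> * y)) + b * (h y * k y * exp (\<mu> * y)))"
    by (simp add: fun_eq_iff algebra_simps)
  then show "ip_exp \<mu> (\<lambda>y. a * f y + b * h y) k = a * ip_exp \<mu> f k + b * ip_exp \<mu> h k"
    using L2_exp_mult_integrable[OF fhk(1,3)] L2_exp_mult_integrable[OF fhk(2,3)]
    by (simp add: ip_exp_def)
next
  fix f h show "ip_exp \<mu> f h = ip_exp \<mu> h f"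
    unfolding ip_exp_def by (intro Bochner_Integration.integral_cong) auto
qed (simp_all add: L2_exp_lin ip_exp_def)

lemma exp_neg_integrable_half_line:
  assumes "0 < (c::real)"
  shows "integrable half_line (\<lambda>y. exp (- (c * y)))" "(\<integral>y. exp (- (c * y)) \<partial>half_line) = 1 / c"
    and "(\<integral>\<^sup>+y. ennreal (exp (- (c * y))) \<partial>half_line) = ennreal (1 / c)"
proof -
  have "((\<lambda>y. exp (- (c * y))) has_real_derivative - c * exp (- (c * y))) (at y)" for y
    by (auto intro!: derivative_eq_intros)
  have "(\<integral>\<^sup>+y. ennreal (exp (- (c * y))) * indicator {0..} y \<partial>lborel) = ennreal (0 - (- (1 / c) * exp (- (c * 0))))"
  proof (rule nn_integral_FTC_atLeast)
    show "((\<lambda>y. - (1 / c) * exp (- (c * y))) has_real_derivative exp (- (c * y))) (at y)" for y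
      using assms by (auto intro!: derivative_eq_intros)
    have "filterlim (\<lambda>y. c * y) at_top at_top"
      using assms by (simp add: filterlim_tendsto_pos_mult_at_top[OF tendsto_const] filterlim_ident)
    then have "((\<lambda>y. exp (- (c * y))) \<longlongrightarrow> 0) at_top"
      by (intro filterlim_compose[OF exp_at_bot]) (simp add: filterlim_uminus_at_bot)
    then show "((\<lambda>y. - (1 / c) * exp (- (c * y))) \<longlongrightarrow> 0) at_top"
      using tendsto_mult_right_zero by blast
  qed auto
  moreover have "(\<integral>\<^sup>+y. ennreal (exp (- (c * y))) \<partial>half_line) = (\<integral>\<^sup>+y. ennreal (exp (- (c * y))) * indicator {0..} y \<partial>lborel)"
    unfolding nn_integral_half_line
    by (intro nn_integral_cong_AE, use AE_lborel_singleton[of 0] in eventually_elim) (auto simp: indicator_def)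
  ultimately show *: "(\<integral>\<^sup>+y. ennreal (exp (- (c * y))) \<partial>half_line) = ennreal (1 / c)" by simp
  have [measurable]: "(\<lambda>y. exp (- (c * y))) \<in> borel_measurable half_line"
    by (rule borel_imp_half_line) simp
  show "integrable half_line (\<lambda>y. exp (- (c * y)))"
    using * by (intro integrableI_nonneg) auto
  show "(\<integral>y. exp (- (c * y)) \<partial>half_line) = 1 / c"
    using * assms by (simp add: integral_eq_nn_integral)
qed

lemma exp_neg_L2_exp:
  assumes "\<mu> < 2 * c"
  shows "(\<lambda>y. exp (- (c * y))) \<in> L2_exp \<mu>"
proof -
  have "(\<lambda>y. (exp (- (c * y)))\<^sup>2 * exp (\<mu> * y)) = (\<lambda>y. exp (- ((2 * c - \<mu>) * y)))"
    by (simp add: fun_eq_iff power2_eq_square algebra_simps flip: exp_add)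
  then show ?thesis
    using exp_neg_integrable_half_line(1)[of "2 * c - \<mu>"] assms
    by (simp add: L2_exp_iff borel_imp_half_line)
qed

text \<open>The function \<open>exp (- (\<mu> * y))\<close> lies in the space, and pairing with it
  cancels the weight. In the same way it represents the integral as a linear functional, a fact used
  again for density.\<close>

lemma L2_exp_integrable:
  assumes "f \<in> L2_exp \<mu>" "0 < \<mu>"
  shows "integrable half_line f"
proof -
  have "integrable half_line (\<lambda>y. f y * exp (- (\<mu> * y)) * exp (\<mu> * y))"
    using assms by (intro L2_exp_mult_integrable exp_neg_L2_exp) auto
  then show ?thesis by (simp add: mult.assoc flip: exp_add)
qed

section \<open>Schur test and Fubini over a triangle\<close>

lemma ennreal_sqrt_power2: "0 \<le> t \<Longrightarrow> (ennreal (sqrt t))\<^sup>2 = ennreal t"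
  by (simp add: ennreal_power)

text \<open>With \<open>k * f\<close> split into \<open>sqrt (k * p)\<close> and
  \<open>sqrt (k * f^2 / p)\<close>, Cauchy-Schwarz in \<open>x\<close> and the row bound produce
  the factor \<open>A * q y\<close>; after an exchange of integrals the column bound absorbs
  \<open>q\<close> and cancels \<open>p\<close>. The integrals are extended nonnegative ones, so the
  estimate proves finiteness of the left-hand side, which is how it is used.\<close>

lemma Schur_test:
  fixes k :: "real \<Rightarrow> real \<Rightarrow> real" and p q f :: "real \<Rightarrow> real"
  assumes [measurable]: "case_prod k \<in> borel_measurable (half_line \<Otimes>\<^sub>M half_line)"
      "p \<in> borel_measurable half_line" "q \<in> borel_measurable half_line" "f \<in> borel_measurable half_line"
    and k: "\<And>y x. 0 \<le> k y x" and p: "\<And>x. 0 < x \<Longrightarrow> 0 < p x" and q: "\<And>x. 0 < x \<Longrightarrow> 0 < q x"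
    and f: "\<And>x. 0 \<le> f x" and AB: "0 \<le> A" "0 \<le> B"
    and A: "\<And>y. 0 < y \<Longrightarrow> (\<integral>\<^sup>+x. ennreal (k y x * p x) \<partial>half_line) \<le> ennreal (A * q y)"
    and B: "\<And>x. 0 < x \<Longrightarrow> (\<integral>\<^sup>+y. ennreal (k y x * q y) \<partial>half_line) \<le> ennreal (B * p x)"
  shows "(\<integral>\<^sup>+y. (\<integral>\<^sup>+x. ennreal (k y x * f x) \<partial>half_line)\<^sup>2 \<partial>half_line)
    \<le> ennreal (A * B) * (\<integral>\<^sup>+x. ennreal ((f x)\<^sup>2) \<partial>half_line)"
proof -
  have p0: "0 \<le> p x" and q0: "0 \<le> q x" if "0 < x" for x
    using p[OF that] q[OF that] by simp_all
  have m: "(\<lambda>x. k y x) \<in> borel_measurable half_line" if "0 < y" for y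
    using measurable_Pair2[OF assms(1), of y] that by simp
  have m': "(\<lambda>y. k y x) \<in> borel_measurable half_line" if "0 < x" for x
    using measurable_Pair1[OF assms(1), of x] that by simp
  have row: "(\<integral>\<^sup>+x. ennreal (k y x * f x) \<partial>half_line)\<^sup>2
      \<le> (\<integral>\<^sup>+x. ennreal (A * q y * (k y x * (f x)\<^sup>2 / p x)) \<partial>half_line)" if y: "0 < y" for y
  proof -
    note [measurable] = m[OF y]
    define a b where "a x = ennreal (sqrt (k y x * p x))" and "b x = ennreal (sqrt (k y x * (f x)\<^sup>2 / p x))" for x
    have ab: "(\<integral>\<^sup>+x. ennreal (k y x * f x) \<partial>half_line) = (\<integral>\<^sup>+x. a x * b x \<partial>half_line)"
    proof (rule nn_integral_cong, unfold space_half_line greaterThan_iff)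
      fix x :: real assume "0 < x"
      then have "k y x * p x * (k y x * (f x)\<^sup>2 / p x) = (k y x * f x)\<^sup>2"
        using p[of x] by (simp add: power2_eq_square)
      then have "sqrt (k y x * p x) * sqrt (k y x * (f x)\<^sup>2 / p x) = sqrt ((k y x * f x)\<^sup>2)"
        by (simp only: real_sqrt_mult[symmetric])
      then show "ennreal (k y x * f x) = a x * b x"
        using k f ennreal_mult''[of "sqrt (k y x * (f x)\<^sup>2 / p x)" "sqrt (k y x * p x)"] p0[OF \<open>0 < x\<close>]
        by (simp add: a_def b_def)
    qed
    have a2: "(\<integral>\<^sup>+x. (a x)\<^sup>2 \<partial>half_line) = (\<integral>\<^sup>+x. ennreal (k y x * p x) \<partial>half_line)"
      by (rule nn_integral_cong) (simp add: a_def ennreal_sqrt_power2 k p0)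
    have b2: "(\<integral>\<^sup>+x. (b x)\<^sup>2 \<partial>half_line) = (\<integral>\<^sup>+x. ennreal (k y x * (f x)\<^sup>2 / p x) \<partial>half_line)"
      by (rule nn_integral_cong) (simp add: b_def ennreal_sqrt_power2 k p0)
    have "(\<integral>\<^sup>+x. ennreal (k y x * f x) \<partial>half_line)\<^sup>2
        \<le> (\<integral>\<^sup>+x. ennreal (k y x * p x) \<partial>half_line) * (\<integral>\<^sup>+x. ennreal (k y x * (f x)\<^sup>2 / p x) \<partial>half_line)"
      unfolding ab a2[symmetric] b2[symmetric]
      by (rule Cauchy_Schwarz_nn_integral) (unfold a_def b_def, measurable)
    also have "\<dots> \<le> ennreal (A * q y) * (\<integral>\<^sup>+x. ennreal (k y x * (f x)\<^sup>2 / p x) \<partial>half_line)"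
      by (intro mult_right_mono A y) simp
    also have "\<dots> = (\<integral>\<^sup>+x. ennreal (A * q y) * ennreal (k y x * (f x)\<^sup>2 / p x) \<partial>half_line)"
      by (rule nn_integral_cmult[symmetric]) measurable
    also have "\<dots> = (\<integral>\<^sup>+x. ennreal (A * q y * (k y x * (f x)\<^sup>2 / p x)) \<partial>half_line)"
      by (rule nn_integral_cong, unfold space_half_line greaterThan_iff)
        (intro ennreal_mult'[symmetric] mult_nonneg_nonneg AB q0 y; assumption)
    finally show ?thesis .
  qed
  have "(\<integral>\<^sup>+y. (\<integral>\<^sup>+x. ennreal (k y x * f x) \<partial>half_line)\<^sup>2 \<partial>half_line)
      \<le> (\<integral>\<^sup>+y. (\<integral>\<^sup>+x. ennreal (A * q y * (k y x * (f x)\<^sup>2 / p x)) \<partial>half_line) \<partial>half_line)"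
    by (rule nn_integral_mono, rule row) simp
  also have "\<dots> = (\<integral>\<^sup>+x. (\<integral>\<^sup>+y. ennreal (A * q y * (k y x * (f x)\<^sup>2 / p x)) \<partial>half_line) \<partial>half_line)"
    by (rule half_line_pair.Fubini') measurable
  also have "\<dots> \<le> (\<integral>\<^sup>+x. ennreal (A * B) * ennreal ((f x)\<^sup>2) \<partial>half_line)"
  proof (rule nn_integral_mono, unfold space_half_line greaterThan_iff)
    fix x :: real assume x: "0 < x"
    note [measurable] = m'[OF x]
    have "(\<integral>\<^sup>+y. ennreal (A * q y * (k y x * (f x)\<^sup>2 / p x)) \<partial>half_line)
        = (\<integral>\<^sup>+y. ennreal (A * (f x)\<^sup>2 / p x) * ennreal (k y x * q y) \<partial>half_line)"
    proof (rule nn_integral_cong, unfold space_half_line greaterThan_iff)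
      fix y :: real assume "0 < y"
      have "A * q y * (k y x * (f x)\<^sup>2 / p x) = (A * (f x)\<^sup>2 / p x) * (k y x * q y)" by simp
      then show "ennreal (A * q y * (k y x * (f x)\<^sup>2 / p x)) = ennreal (A * (f x)\<^sup>2 / p x) * ennreal (k y x * q y)"
        by (simp only: ennreal_mult''[OF mult_nonneg_nonneg[OF k q0[OF \<open>0 < y\<close>]]])
    qed
    also have "\<dots> = ennreal (A * (f x)\<^sup>2 / p x) * (\<integral>\<^sup>+y. ennreal (k y x * q y) \<partial>half_line)"
      by (rule nn_integral_cmult) measurable
    also have "\<dots> \<le> ennreal (A * (f x)\<^sup>2 / p x) * ennreal (B * p x)"
      by (intro mult_left_mono B x) simp
    also have "\<dots> = ennreal (A * B) * ennreal ((f x)\<^sup>2)"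
      using p[OF x] ennreal_mult''[OF mult_nonneg_nonneg[OF AB(2) p0[OF x]], of "A * (f x)\<^sup>2 / p x"]
        ennreal_mult''[of "(f x)\<^sup>2" "A * B"] by (simp add: ac_simps)
    finally show "(\<integral>\<^sup>+y. ennreal (A * q y * (k y x * (f x)\<^sup>2 / p x)) \<partial>half_line) \<le> ennreal (A * B) * ennreal ((f x)\<^sup>2)" .
  qed
  also have "\<dots> = ennreal (A * B) * (\<integral>\<^sup>+x. ennreal ((f x)\<^sup>2) \<partial>half_line)"
    by (rule nn_integral_cmult) measurable
  finally show ?thesis .
qed

text \<open>This takes the place of integration by parts when \<open>f\<close> is only measurable.
  Over \<open>0 < y < x\<close>, one order of integration pairs \<open>w\<close> with the tail
  integral of \<open>f\<close>, the other pairs \<open>f\<close> with the primitive of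
  \<open>w\<close> that vanishes at 0. The last assumption is absolute integrability over the
  triangle.\<close>

lemma triangle_Fubini:
  fixes f w :: "real \<Rightarrow> real"
  assumes [measurable]: "f \<in> borel_measurable half_line" "w \<in> borel_measurable half_line"
    and w: "\<And>x. 0 < x \<Longrightarrow> integrable half_line (\<lambda>y. indicator {..<x} y * w y)"
    and fw: "integrable half_line (\<lambda>x. \<bar>f x\<bar> * (\<integral>y. indicator {..<x} y * \<bar>w y\<bar> \<partial>half_line))"
  shows "(\<integral>y. w y * (\<integral>x. indicator {y<..} x * f x \<partial>half_line) \<partial>half_line)
    = (\<integral>x. f x * (\<integral>y. indicator {..<x} y * w y \<partial>half_line) \<partial>half_line)"
    and "integrable half_line (\<lambda>y. w y * (\<integral>x. indicator {y<..} x * f x \<partial>half_line))"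
    and "integrable half_line (\<lambda>x. f x * (\<integral>y. indicator {..<x} y * w y \<partial>half_line))"
proof -
  define F where "F x y = indicator {..<x} y * (f x * w y)" for x y
  have ind: "indicator {..<x} y = (if y < x then 1 else 0 :: real)" for x y by simp
  have [measurable]: "case_prod F \<in> borel_measurable (half_line \<Otimes>\<^sub>M half_line)"
    unfolding F_def ind by measurable
  have int: "integrable (half_line \<Otimes>\<^sub>M half_line) (case_prod F)"
  proof (rule half_line_pair.Fubini_integrable)
    have "(\<lambda>x. \<integral>y. norm (case_prod F (x, y)) \<partial>half_line) = (\<lambda>x. \<bar>f x\<bar> * (\<integral>y. indicator {..<x} y * \<bar>w y\<bar> \<partial>half_line))"
      by (auto simp: fun_eq_iff F_def abs_mult mult.left_commute simp flip: integral_mult_right_zero)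
    then show "integrable half_line (\<lambda>x. \<integral>y. norm (case_prod F (x, y)) \<partial>half_line)" using fw by simp
    show "AE x in half_line. integrable half_line (\<lambda>y. case_prod F (x, y))"
      using AE_half_line_pos
    proof eventually_elim
      case (elim x)
      have "(\<lambda>y. case_prod F (x, y)) = (\<lambda>y. f x * (indicator {..<x} y * w y))"
        by (auto simp: F_def)
      then show ?case using w[OF elim] by simp
    qed
  qed measurable
  have e1: "(\<lambda>x. \<integral>y. F x y \<partial>half_line) = (\<lambda>x. f x * (\<integral>y. indicator {..<x} y * w y \<partial>half_line))"
    by (auto simp: fun_eq_iff F_def mult.left_commute simp flip: integral_mult_right_zero)
  have e2: "(\<lambda>y. \<integral>x. F x y \<partial>half_line) = (\<lambda>y. w y * (\<integral>x. indicator {y<..} x * f x \<partial>half_line))"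
    by (auto simp: fun_eq_iff F_def indicator_def mult.commute simp flip: integral_mult_right_zero
        intro!: Bochner_Integration.integral_cong)
  show "(\<integral>y. w y * (\<integral>x. indicator {y<..} x * f x \<partial>half_line) \<partial>half_line)
    = (\<integral>x. f x * (\<integral>y. indicator {..<x} y * w y \<partial>half_line) \<partial>half_line)"
    using half_line_pair.Fubini_integral[OF int] unfolding e1 e2 .
  show "integrable half_line (\<lambda>y. w y * (\<integral>x. indicator {y<..} x * f x \<partial>half_line))"
    using half_line_pair.integrable_snd[OF int] unfolding e2 .
  show "integrable half_line (\<lambda>x. f x * (\<integral>y. indicator {..<x} y * w y \<partial>half_line))"
    using half_line_pair.integrable_fst[OF int] unfolding e1 .
qed

section \<open>Tail integrals and Hardy's inequality\<close>

lemma AE_half_line_neq: "AE x in half_line. x \<noteq> c"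
  unfolding AE_half_line using AE_lborel_singleton[of c] by eventually_elim simp

lemma indicator_Iio_integral_measurable [measurable]:
  fixes w :: "real \<Rightarrow> real"
  assumes [measurable]: "w \<in> borel_measurable half_line"
  shows "(\<lambda>x. \<integral>y. indicator {..<x} y * w y \<partial>half_line) \<in> borel_measurable half_line"
proof -
  have "(\<lambda>x. \<integral>y. indicator {..<x} y * w y \<partial>half_line) = (\<lambda>x. \<integral>y. (if y < x then w y else 0) \<partial>half_line)"
    by (intro ext Bochner_Integration.integral_cong) auto
  also have "\<dots> \<in> borel_measurable half_line" by measurable
  finally show ?thesis .
qed

lemma integrable_half_line_indicator:
  fixes u :: "real \<Rightarrow> real"
  assumes "integrable half_line u" "A \<in> sets borel"
  shows "integrable half_line (\<lambda>t. indicator A t * u t)"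
proof -
  have "A \<inter> {0<..} \<in> sets half_line"
    using assms(2) by (auto simp: half_line_def sets_restrict_space)
  from integrable_mult_indicator[OF this assms(1)]
  show ?thesis
    by (rule Bochner_Integration.integrable_cong[THEN iffD1, rotated -1]) (auto simp: indicator_def)
qed

lemma integral_half_line_split:
  fixes u :: "real \<Rightarrow> real"
  assumes u: "integrable half_line u"
  shows "integral\<^sup>L half_line u = (\<integral>t. indicator {..<x} t * u t \<partial>half_line) + (\<integral>t. indicator {x<..} t * u t \<partial>half_line)"
proof -
  have "integral\<^sup>L half_line u = (\<integral>t. indicator {..<x} t * u t + indicator {x<..} t * u t \<partial>half_line)"
    using AE_half_line_neq[of x] u
    by (intro integral_cong_AE borel_measurable_add borel_measurable_integrable integrable_half_line_indicator)
      (auto simp: indicator_def elim!: eventually_mono)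
  then show ?thesis
    using integrable_half_line_indicator[OF u] by simp
qed

lemma integrable_half_line_Iio:
  fixes w :: "real \<Rightarrow> real"
  shows "integrable half_line (\<lambda>y. indicator {..<x} y * w y) \<longleftrightarrow> set_integrable lborel {0<..<x} w"
    and "(\<integral>y. indicator {..<x} y * w y \<partial>half_line) = (LBINT y:{0<..<x}. w y)"
proof -
  have e: "indicator {0<..} y *\<^sub>R (indicator {..<x} y * w y) = indicator {0<..<x} y *\<^sub>R w y" for y
    by (auto simp: indicator_def)
  show "integrable half_line (\<lambda>y. indicator {..<x} y * w y) \<longleftrightarrow> set_integrable lborel {0<..<x} w"
    "(\<integral>y. indicator {..<x} y * w y \<partial>half_line) = (LBINT y:{0<..<x}. w y)"
    by (simp_all only: set_integrable_half_line[symmetric] set_integral_half_line[symmetric]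
        set_integrable_def set_lebesgue_integral_def e)
qed

lemma FTC_half_line_Iio:
  fixes F w :: "real \<Rightarrow> real"
  assumes x: "0 < x" and F: "\<And>y. 0 \<le> y \<Longrightarrow> y \<le> x \<Longrightarrow> (F has_real_derivative w y) (at y)"
    and w: "continuous_on {0..x} w"
  shows "integrable half_line (\<lambda>y. indicator {..<x} y * w y)"
    and "(\<integral>y. indicator {..<x} y * w y \<partial>half_line) = F x - F 0"
proof -
  have int: "set_integrable lborel {0..x} w"
    by (rule borel_integrable_atLeastAtMost'[OF w])
  then have int': "set_integrable lborel {0<..<x} w"
    by (rule set_integrable_subset) auto
  then show "integrable half_line (\<lambda>y. indicator {..<x} y * w y)"
    by (simp add: integrable_half_line_Iio)
  have "(LBINT y:{0<..<x}. w y) = (LBINT y:{0..x}. w y)"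
  proof (rule set_integral_cong_set)
    show "set_borel_measurable lborel {0<..<x} w" "set_borel_measurable lborel {0..x} w"
      using int int' by (auto simp: set_integrable_def set_borel_measurable_def)
    show "AE y in lborel. y \<in> {0..x} \<longleftrightarrow> y \<in> {0<..<x}"
      using AE_lborel_singleton[of 0] AE_lborel_singleton[of x] by eventually_elim auto
  qed
  also have "\<dots> = F x - F 0"
    unfolding set_lebesgue_integral_def using x w F by (intro integral_FTC_atLeastAtMost)
      (auto simp: has_real_derivative_iff_has_vector_derivative[symmetric] intro: has_field_derivative_at_within)
  finally show "(\<integral>y. indicator {..<x} y * w y \<partial>half_line) = F x - F 0"
    by (simp add: integrable_half_line_Iio)
qed

text \<open>The row integral in the Schur test for the Hardy kernel; \<open>- 2 / sqrt x\<close> is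
  a primitive.\<close>

lemma nn_integral_tail_power:
  assumes y: "0 < y"
  shows "(\<integral>\<^sup>+x. ennreal (if y < x then 1 / (x * sqrt x) else 0) \<partial>half_line) = ennreal (2 / sqrt y)"
proof -
  have "(\<integral>\<^sup>+x. ennreal (if y < x then 1 / (x * sqrt x) else 0) \<partial>half_line)
      = (\<integral>\<^sup>+x. ennreal (1 / (x * sqrt x)) * indicator {y..} x \<partial>lborel)"
    unfolding nn_integral_half_line
    by (intro nn_integral_cong_AE, use AE_lborel_singleton[of y] in eventually_elim) (use y in auto)
  also have "\<dots> = ennreal (0 - (- 2 / sqrt y))"
  proof (rule nn_integral_FTC_atLeast)
    fix x assume "y \<le> x"
    with y have x: "0 < x" by simp
    have "sqrt x * sqrt x = x" using x by simp
    then show "((\<lambda>x. - 2 / sqrt x) has_real_derivative 1 / (x * sqrt x)) (at x)"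
      using x by (auto intro!: derivative_eq_intros simp: field_simps)
    show "0 \<le> 1 / (x * sqrt x)" using x by simp
  next
    show "((\<lambda>x. - 2 / sqrt x) \<longlongrightarrow> 0) at_top"
      by (intro real_tendsto_divide_at_top[OF tendsto_const] sqrt_at_top)
  qed measurable
  finally show ?thesis by simp
qed

text \<open>The column integral in the same Schur test. The integrand is
  \<open>(1 / sqrt y + \<mu> * sqrt y) * exp (\<mu> * y)\<close>, while
  \<open>2 * sqrt y * exp (\<mu> * y)\<close> has the derivative with \<open>2 * \<mu>\<close> in
  place of \<open>\<mu>\<close>. The singularity at 0 calls for the improper form of the fundamental
  theorem, hence the extended real end points.\<close>

lemma nn_integral_weight_over_sqrt:
  assumes x: "0 < x" and mu: "0 < \<mu>"
  shows "(\<integral>\<^sup>+y. ennreal (if y < x then (1 + \<mu> * y) * exp (\<mu> * y) / sqrt y else 0) \<partial>half_line)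
    \<le> ennreal (2 * sqrt x * exp (\<mu> * x))"
proof -
  let ?F = "\<lambda>y. 2 * sqrt y * exp (\<mu> * y)"
  let ?f = "\<lambda>y. (1 / sqrt y + 2 * \<mu> * sqrt y) * exp (\<mu> * y)"
  have DF: "(?F has_real_derivative ?f y) (at y)" and contf: "isCont ?f y" if "(0::ereal) < ereal y" for y
  proof -
    from that have y: "0 < y" by simp
    show "(?F has_real_derivative ?f y) (at y)"
      using y by (auto intro!: derivative_eq_intros simp: field_simps)
    show "isCont ?f y" using y by (intro continuous_intros) auto
  qed
  have "((\<lambda>y. ?F y) \<longlongrightarrow> ?F 0) (at_right 0)"
    by (intro tendsto_intros)
  then have limF0: "((?F \<circ> real_of_ereal) \<longlongrightarrow> ?F 0) (at_right 0)"
    unfolding zero_ereal_def ereal_tendsto_simps by simp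
  have "((\<lambda>y. ?F y) \<longlongrightarrow> ?F x) (at_left x)"
    by (intro tendsto_intros)
  then have limFx: "((?F \<circ> real_of_ereal) \<longlongrightarrow> ?F x) (at_left (ereal x))"
    unfolding ereal_tendsto_simps by simp
  have fpos: "AE y in lborel. (0::ereal) < ereal y \<longrightarrow> ereal y < ereal x \<longrightarrow> 0 \<le> ?f y"
    using mu by simp
  have x': "(0::ereal) < ereal x" using x by simp
  note ftc = interval_integral_FTC_nonneg[OF x' DF contf fpos limF0 limFx]
  have ein: "einterval 0 (ereal x) = {0<..<x}" by (auto simp: einterval_def zero_ereal_def)
  have "(\<integral>\<^sup>+y. ennreal (if y < x then (1 + \<mu> * y) * exp (\<mu> * y) / sqrt y else 0) \<partial>half_line)
      \<le> (\<integral>\<^sup>+y. ennreal (indicator {0<..<x} y *\<^sub>R ?f y) \<partial>lborel)"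
    unfolding nn_integral_half_line
  proof (rule nn_integral_mono)
    fix y
    show "ennreal (if y < x then (1 + \<mu> * y) * exp (\<mu> * y) / sqrt y else 0) * indicator {0<..} y
        \<le> ennreal (indicator {0<..<x} y *\<^sub>R ?f y)"
    proof (cases "0 < y \<and> y < x")
      case True
      then have "sqrt y * sqrt y = y" by simp
      then have "(1 + \<mu> * y) / sqrt y = 1 / sqrt y + \<mu> * sqrt y"
        using True by (simp add: field_simps)
      also have "\<dots> \<le> 1 / sqrt y + 2 * \<mu> * sqrt y"
        using mu True by simp
      finally have "(1 + \<mu> * y) / sqrt y * exp (\<mu> * y) \<le> ?f y"
        by (intro mult_right_mono) auto
      then show ?thesis using True by (auto intro!: ennreal_leI)
    qed (auto simp: indicator_def)
  qed
  also have "\<dots> = ennreal (LBINT y:{0<..<x}. ?f y)"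
    unfolding set_lebesgue_integral_def using ftc(1) mu
    by (intro nn_integral_eq_integral) (auto simp: set_integrable_def ein indicator_def)
  also have "(LBINT y:{0<..<x}. ?f y) = ?F x"
    using ftc(2) x by (simp add: interval_lebesgue_integral_def ein zero_ereal_def)
  finally show ?thesis .
qed

text \<open>Membership in \<open>X_zero\<close> without the moment condition: the density proof
  handles tail integrals before their mean is corrected.\<close>

locale weighted_tail =
  fixes \<mu> :: real and h :: "real \<Rightarrow> real"
  assumes mu: "0 < \<mu>" and h_measurable [measurable]: "h \<in> borel_measurable half_line"
    and yh: "(\<lambda>y. y * h y) \<in> L2_exp \<mu>"
begin

abbreviation "H \<equiv> tail_integral h"

lemma H_eq: "0 \<le> y \<Longrightarrow> H y = (\<integral>x. indicator {y<..} x * h x \<partial>half_line)"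
  unfolding tail_integral_def by (rule set_integral_subset_half_line) auto

text \<open>\<open>h\<close> is the pairing of \<open>x * h x\<close> with
  \<open>exp (- (\<mu> * x)) / x\<close>, which is in the weighted space away from 0. At 0 nothing
  is claimed: \<open>h\<close> may be as singular as \<open>y * h y\<close> in \<open>L2_exp\<close>
  permits.\<close>

lemma h_integrable:
  assumes a: "0 < a"
  shows "integrable half_line (\<lambda>x. indicator {a<..} x * h x)"
proof -
  define k where "k x = (if a < x then exp (- (\<mu> * x)) / x else 0)" for x
  have "(\<lambda>x. (1 / a) * exp (- (\<mu> * x))) \<in> L2_exp \<mu>"
    by (intro L2_exp_scale exp_neg_L2_exp) (use mu in simp)
  moreover have "k \<in> borel_measurable half_line"
    unfolding k_def by (rule borel_imp_half_line) measurable
  ultimately have "k \<in> L2_exp \<mu>"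
    by (rule L2_exp_dominated) (use a in \<open>auto simp: k_def field_simps\<close>)
  from L2_exp_mult_integrable[OF yh this]
  show ?thesis
  proof (rule Bochner_Integration.integrable_cong[THEN iffD1, rotated -1])
    fix x assume "x \<in> space half_line"
    then show "x * h x * k x * exp (\<mu> * x) = indicator {a<..} x * h x"
      using a by (simp add: k_def exp_minus)
  qed simp
qed

lemma H_continuous_on: "continuous_on {0<..} H"
  unfolding continuous_on_sequentially
proof (intro allI ballI impI, elim conjE)
  fix X :: "nat \<Rightarrow> real" and y :: real assume y: "y \<in> {0<..}" and X: "\<forall>n. X n \<in> {0<..}" "X \<longlonglongrightarrow> y"
  \<comment> \<open>Staying above \<open>y / 2\<close> supplies an integrable majorant; the first
    \<open>N\<close> terms are skipped for this reason.\<close>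
  have "\<forall>\<^sub>F n in sequentially. y / 2 < X n"
    using y by (intro order_tendstoD(1)[OF X(2)]) simp
  then obtain N where N: "\<And>n. n \<ge> N \<Longrightarrow> y / 2 < X n" by (auto simp: eventually_sequentially)
  have "(\<lambda>n. \<integral>x. indicator {X (n + N)<..} x * h x \<partial>half_line) \<longlonglongrightarrow> (\<integral>x. indicator {y<..} x * h x \<partial>half_line)"
  proof (rule integral_dominated_convergence[where w = "\<lambda>x. norm (indicator {y / 2<..} x * h x)"])
    have ind: "indicator {a<..} x = (if a < x then 1 else 0 :: real)" for a x by simp
    show "(\<lambda>x. indicator {y<..} x * h x) \<in> borel_measurable half_line"
      "(\<lambda>x. indicator {X (n + N)<..} x * h x) \<in> borel_measurable half_line" for n
      unfolding ind by measurable
    show "integrable half_line (\<lambda>x. norm (indicator {y / 2<..} x * h x))"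
      using y by (intro integrable_norm h_integrable) simp
    show "AE x in half_line. (\<lambda>n. indicator {X (n + N)<..} x * h x) \<longlonglongrightarrow> indicator {y<..} x * h x"
      using AE_half_line_neq[of y]
    proof eventually_elim
      case (elim x)
      have lim: "(\<lambda>n. X (n + N)) \<longlonglongrightarrow> y" using X(2) by (rule LIMSEQ_ignore_initial_segment)
      have "\<forall>\<^sub>F n in sequentially. indicator {X (n + N)<..} x = (indicator {y<..} x :: real)"
      proof (cases "x < y")
        case True
        from order_tendstoD(1)[OF lim True] show ?thesis
          by eventually_elim (use True in auto)
      next
        case False
        with elim have "y < x" by simp
        from order_tendstoD(2)[OF lim this] show ?thesis
          by eventually_elim (use \<open>y < x\<close> in auto)
      qed
      then have "(\<lambda>n. indicator {X (n + N)<..} x :: real) \<longlonglongrightarrow> indicator {y<..} x"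
        by (rule tendsto_eventually)
      then show ?case by (intro tendsto_intros)
    qed
    show "AE x in half_line. norm (indicator {X (n + N)<..} x * h x) \<le> norm (indicator {y / 2<..} x * h x)" for n
      using N[of "n + N"] by (auto simp: indicator_def)
  qed
  then have "(\<lambda>n. H (X (n + N))) \<longlonglongrightarrow> H y"
    using X(1) y by (simp add: H_eq less_imp_le)
  then show "(H \<circ> X) \<longlonglongrightarrow> H y"
    unfolding comp_def by (rule LIMSEQ_offset)
qed

lemma H_measurable [measurable]: "H \<in> borel_measurable half_line"
  by (rule continuous_on_half_line_measurable[OF H_continuous_on])

text \<open>The square roots of the weights are moved into the kernel \<open>k\<close>, which then
  acts on \<open>f x = \<bar>x * h x\<bar> * exp (\<mu> / 2 * x)\<close>. The Schur test functions
  are the classical \<open>1 / sqrt x\<close> of Hardy's inequality times the same square roots, and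
  both bounds are 2. The weight on the left gains the factor \<open>1 + \<mu> * y\<close>, which the
  energy estimate requires.\<close>

lemma Hardy:
  "integrable half_line (\<lambda>y. (H y)\<^sup>2 * ((1 + \<mu> * y) * exp (\<mu> * y)))"
proof -
  define k where "k y x = (if 0 < y \<and> y < x then sqrt (1 + \<mu> * y) * exp (\<mu> / 2 * y) / (x * exp (\<mu> / 2 * x)) else 0)" for y x
  define p where "p x = (if 0 < x then exp (\<mu> / 2 * x) / sqrt x else 0)" for x
  define q where "q y = sqrt (1 + \<mu> * y) * exp (\<mu> / 2 * y) / sqrt y" for y
  define f where "f x = \<bar>x * h x\<bar> * exp (\<mu> / 2 * x)" for x
  have exp2: "exp (\<mu> / 2 * y) * exp (\<mu> / 2 * y) = exp (\<mu> * y)" for y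
    by (simp flip: exp_add)
  have [measurable]: "f \<in> borel_measurable half_line" "p \<in> borel_measurable half_line" "q \<in> borel_measurable half_line"
    unfolding f_def p_def q_def by measurable
  have k_meas: "case_prod k \<in> borel_measurable (half_line \<Otimes>\<^sub>M half_line)"
    unfolding k_def by measurable
  have "(\<integral>\<^sup>+y. (\<integral>\<^sup>+x. ennreal (k y x * f x) \<partial>half_line)\<^sup>2 \<partial>half_line)
    \<le> ennreal (2 * 2) * (\<integral>\<^sup>+x. ennreal ((f x)\<^sup>2) \<partial>half_line)"
  proof (rule Schur_test[where p = p and q = q])
    fix y :: real assume y: "0 < y"
    let ?c = "sqrt (1 + \<mu> * y) * exp (\<mu> / 2 * y)"
    have "(\<integral>\<^sup>+x. ennreal (k y x * p x) \<partial>half_line)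
        = (\<integral>\<^sup>+x. ennreal ?c * ennreal (if y < x then 1 / (x * sqrt x) else 0) \<partial>half_line)"
    proof (rule nn_integral_cong, unfold space_half_line greaterThan_iff)
      fix x :: real assume "0 < x"
      then have "k y x * p x = ?c * (if y < x then 1 / (x * sqrt x) else 0)"
        using y by (simp add: k_def p_def)
      then show "ennreal (k y x * p x) = ennreal ?c * ennreal (if y < x then 1 / (x * sqrt x) else 0)"
        using \<open>0 < x\<close> ennreal_mult''[of "if y < x then 1 / (x * sqrt x) else 0" ?c] by simp
    qed
    also have "\<dots> = ennreal ?c * ennreal (2 / sqrt y)"
      by (subst nn_integral_cmult) (use y in \<open>auto simp: nn_integral_tail_power intro!: borel_imp_half_line\<close>)
    also have "\<dots> = ennreal (2 * q y)"
      using y by (subst ennreal_mult''[symmetric]) (auto simp: q_def mult_ac)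
    finally show "(\<integral>\<^sup>+x. ennreal (k y x * p x) \<partial>half_line) \<le> ennreal (2 * q y)" by simp
    show "0 < p y" "0 < q y" using y mu by (auto simp: p_def q_def intro!: divide_pos_pos mult_pos_pos add_pos_pos)
  next
    fix x :: real assume x: "0 < x"
    let ?c = "1 / (x * exp (\<mu> / 2 * x))"
    have "(\<integral>\<^sup>+y. ennreal (k y x * q y) \<partial>half_line)
        = (\<integral>\<^sup>+y. ennreal ?c * ennreal (if y < x then (1 + \<mu> * y) * exp (\<mu> * y) / sqrt y else 0) \<partial>half_line)"
    proof (rule nn_integral_cong, unfold space_half_line greaterThan_iff)
      fix y :: real assume y: "0 < y"
      have "sqrt (1 + \<mu> * y) * sqrt (1 + \<mu> * y) = 1 + \<mu> * y" using y mu by simp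
      then have "(sqrt (1 + \<mu> * y) * exp (\<mu> / 2 * y)) * (sqrt (1 + \<mu> * y) * exp (\<mu> / 2 * y)) = (1 + \<mu> * y) * exp (\<mu> * y)"
        using exp2[of y] by (metis mult.assoc mult.left_commute)
      then have "k y x * q y = ?c * (if y < x then (1 + \<mu> * y) * exp (\<mu> * y) / sqrt y else 0)"
        using y by (simp add: k_def q_def)
      then show "ennreal (k y x * q y) = ennreal ?c * ennreal (if y < x then (1 + \<mu> * y) * exp (\<mu> * y) / sqrt y else 0)"
        using x ennreal_mult'[of ?c "if y < x then (1 + \<mu> * y) * exp (\<mu> * y) / sqrt y else 0"] by simp
    qed
    also have "\<dots> = ennreal ?c * (\<integral>\<^sup>+y. ennreal (if y < x then (1 + \<mu> * y) * exp (\<mu> * y) / sqrt y else 0) \<partial>half_line)"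
      by (rule nn_integral_cmult) (auto intro!: borel_imp_half_line)
    also have "\<dots> \<le> ennreal ?c * ennreal (2 * sqrt x * exp (\<mu> * x))"
      by (intro mult_left_mono nn_integral_weight_over_sqrt x mu) simp
    also have "\<dots> = ennreal (?c * (2 * sqrt x * exp (\<mu> * x)))"
      using x by (intro ennreal_mult'[symmetric]) simp
    also have "?c * (2 * sqrt x * exp (\<mu> * x)) = 2 * p x"
    proof -
      have "sqrt x * sqrt x = x" using x by simp
      then show ?thesis using x exp2[of x] by (simp add: p_def field_simps)
    qed
    finally show "(\<integral>\<^sup>+y. ennreal (k y x * q y) \<partial>half_line) \<le> ennreal (2 * p x)" .
  qed (use mu in \<open>auto simp: k_def f_def k_meas\<close>)
  moreover have "(\<integral>\<^sup>+x. ennreal ((f x)\<^sup>2) \<partial>half_line) < \<infinity>"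
  proof -
    have "(f x)\<^sup>2 = (x * h x)\<^sup>2 * exp (\<mu> * x)" for x
      unfolding f_def power_mult_distrib power2_abs exp2[symmetric] by (simp only: power2_eq_square)
    then show ?thesis using yh by (simp add: L2_exp_iff integrable_iff_bounded)
  qed
  then have "ennreal (2 * 2) * (\<integral>\<^sup>+x. ennreal ((f x)\<^sup>2) \<partial>half_line) < \<infinity>"
    by (simp add: ennreal_mult_less_top)
  ultimately have fin: "(\<integral>\<^sup>+y. (\<integral>\<^sup>+x. ennreal (k y x * f x) \<partial>half_line)\<^sup>2 \<partial>half_line) < \<infinity>"
    by (rule le_less_trans)
  have "(\<integral>\<^sup>+y. ennreal ((H y)\<^sup>2 * ((1 + \<mu> * y) * exp (\<mu> * y))) \<partial>half_line)
      \<le> (\<integral>\<^sup>+y. (\<integral>\<^sup>+x. ennreal (k y x * f x) \<partial>half_line)\<^sup>2 \<partial>half_line)"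
  proof (rule nn_integral_mono, unfold space_half_line greaterThan_iff)
    fix y :: real assume y: "0 < y"
    let ?c = "sqrt (1 + \<mu> * y) * exp (\<mu> / 2 * y)"
    have c: "0 \<le> ?c" using y mu by simp
    have c2: "?c\<^sup>2 = (1 + \<mu> * y) * exp (\<mu> * y)"
      unfolding power_mult_distrib exp2[symmetric] using y mu by (simp add: power2_eq_square)
    have int: "integrable half_line (\<lambda>x. ?c * (indicator {y<..} x * h x))"
      by (intro integrable_mult_right h_integrable y)
    have "ennreal (?c * \<bar>H y\<bar>) = ennreal \<bar>\<integral>x. ?c * (indicator {y<..} x * h x) \<partial>half_line\<bar>"
      using mu y unfolding integral_mult_right_zero abs_mult H_eq[OF less_imp_le[OF y]] by simp
    also have "\<dots> \<le> (\<integral>\<^sup>+x. ennreal (norm (?c * (indicator {y<..} x * h x))) \<partial>half_line)"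
      using integral_norm_bound_ennreal[OF int] by simp
    also have "\<dots> = (\<integral>\<^sup>+x. ennreal (k y x * f x) \<partial>half_line)"
      using y mu by (intro nn_integral_cong arg_cong[where f = ennreal]) (auto simp: k_def f_def abs_mult)
    finally have "(ennreal (?c * \<bar>H y\<bar>))\<^sup>2 \<le> (\<integral>\<^sup>+x. ennreal (k y x * f x) \<partial>half_line)\<^sup>2"
      by (intro power_mono_ennreal)
    moreover have "(?c * \<bar>H y\<bar>)\<^sup>2 = (H y)\<^sup>2 * ((1 + \<mu> * y) * exp (\<mu> * y))"
      unfolding power_mult_distrib[of ?c] c2 power2_abs by (rule mult.commute)
    moreover have "(ennreal (?c * \<bar>H y\<bar>))\<^sup>2 = ennreal ((?c * \<bar>H y\<bar>)\<^sup>2)"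
      by (intro ennreal_power mult_nonneg_nonneg c abs_ge_zero)
    ultimately show "ennreal ((H y)\<^sup>2 * ((1 + \<mu> * y) * exp (\<mu> * y))) \<le> (\<integral>\<^sup>+x. ennreal (k y x * f x) \<partial>half_line)\<^sup>2"
      by (simp only:)
  qed
  from le_less_trans[OF this fin]
  have "(\<integral>\<^sup>+y. ennreal ((H y)\<^sup>2 * ((1 + \<mu> * y) * exp (\<mu> * y))) \<partial>half_line) < \<infinity>" .
  moreover have "AE y in half_line. 0 \<le> (H y)\<^sup>2 * ((1 + \<mu> * y) * exp (\<mu> * y))"
    using AE_half_line_pos by eventually_elim (use mu in simp)
  ultimately show ?thesis
    by (intro integrableI_nonneg) measurable
qed

lemma H_L2_exp: "H \<in> L2_exp \<mu>"
  unfolding L2_exp_iff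
proof
  show "integrable half_line (\<lambda>y. (H y)\<^sup>2 * exp (\<mu> * y))"
  proof (rule Bochner_Integration.integrable_bound[OF Hardy])
    show "AE y in half_line. norm ((H y)\<^sup>2 * exp (\<mu> * y)) \<le> norm ((H y)\<^sup>2 * ((1 + \<mu> * y) * exp (\<mu> * y)))"
      using AE_half_line_pos
    proof eventually_elim
      case (elim y)
      then have "1 * exp (\<mu> * y) \<le> (1 + \<mu> * y) * exp (\<mu> * y)"
        using mu by (intro mult_right_mono) auto
      then have "(H y)\<^sup>2 * exp (\<mu> * y) \<le> (H y)\<^sup>2 * ((1 + \<mu> * y) * exp (\<mu> * y))"
        by (intro mult_left_mono) auto
      then show ?case using elim mu by simp
    qed
  qed measurable
qed measurable

text \<open>Fubini with \<open>w = 1\<close>. It turns the moment condition in \<open>X_zero\<close>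
  into the vanishing mean of \<open>H\<close>.\<close>

lemma integral_H: "(\<integral>y. H y \<partial>half_line) = (\<integral>y. y * h y \<partial>half_line)"
proof -
  have I: "integrable half_line (\<lambda>y. indicator {..<x} y * (1::real))" "(\<integral>y. indicator {..<x} y * (1::real) \<partial>half_line) = x"
    if "0 < x" for x
    using FTC_half_line_Iio[OF that, of "\<lambda>y. y" "\<lambda>_. 1"] by auto
  have xh: "integrable half_line (\<lambda>y. y * h y)" by (rule L2_exp_integrable[OF yh mu])
  have "(\<integral>y. 1 * (\<integral>x. indicator {y<..} x * h x \<partial>half_line) \<partial>half_line)
      = (\<integral>x. h x * (\<integral>y. indicator {..<x} y * 1 \<partial>half_line) \<partial>half_line)"
  proof (rule triangle_Fubini(1))
    have "integrable half_line (\<lambda>x. \<bar>x * h x\<bar>)" using xh by simp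
    then show "integrable half_line (\<lambda>x. \<bar>h x\<bar> * (\<integral>y. indicator {..<x} y * \<bar>1::real\<bar> \<partial>half_line))"
      by (rule Bochner_Integration.integrable_cong[THEN iffD1, rotated -1]) (use I(2) in \<open>auto simp: abs_mult\<close>)
  qed (use I(1) in auto)
  also have "(\<integral>x. h x * (\<integral>y. indicator {..<x} y * 1 \<partial>half_line) \<partial>half_line) = (\<integral>y. y * h y \<partial>half_line)"
    by (rule Bochner_Integration.integral_cong) (use I(2) in auto)
  also have "(\<integral>y. 1 * (\<integral>x. indicator {y<..} x * h x \<partial>half_line) \<partial>half_line) = (\<integral>y. H y \<partial>half_line)"
    by (rule Bochner_Integration.integral_cong) (auto simp: H_eq)
  finally show ?thesis .
qed

text \<open>Fubini with \<open>w = deriv \<phi>\<close>, whose primitive vanishing at 0 is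
  \<open>\<phi>\<close>. In the sense of distributions this says that \<open>h\<close> is the
  negative derivative of \<open>H\<close>.\<close>

lemma integral_H_deriv_test_fun:
  assumes \<phi>: "test_fun \<phi>"
  shows "(\<integral>y. H y * deriv \<phi> y \<partial>half_line) = (\<integral>y. h y * \<phi> y \<partial>half_line)"
    and "integrable half_line (\<lambda>y. H y * deriv \<phi> y)" "integrable half_line (\<lambda>y. h y * \<phi> y)"
proof -
  obtain a b where ab: "0 < a" "a < b" "\<And>x. x \<notin> {a..b} \<Longrightarrow> \<phi> x = 0"
    using test_fun_support[OF \<phi>] by blast
  obtain a' b' where ab': "0 < a'" "a' < b'" "\<And>x. x \<notin> {a'..b'} \<Longrightarrow> deriv \<phi> x = 0"
    using test_fun_support[OF test_fun_deriv[OF \<phi>]] by blast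
  have d\<phi>: "integrable half_line (deriv \<phi>)"
    unfolding set_integrable_half_line[symmetric] set_integrable_def
    by (intro integrable_mult_indicator test_fun_integrable test_fun_deriv \<phi>) simp
  note [measurable] = borel_measurable_integrable[OF d\<phi>]
  have I: "integrable half_line (\<lambda>y. indicator {..<x} y * deriv \<phi> y)" "(\<integral>y. indicator {..<x} y * deriv \<phi> y \<partial>half_line) = \<phi> x"
    if "0 < x" for x
    using FTC_half_line_Iio[OF that, of \<phi> "deriv \<phi>"] ab test_fun_DERIV[OF \<phi>]
      test_fun_continuous_on[OF test_fun_deriv[OF \<phi>]] by auto
  have m: "(\<lambda>x. \<integral>y. indicator {..<x} y * \<bar>deriv \<phi> y\<bar> \<partial>half_line) \<in> borel_measurable half_line"
    by (rule indicator_Iio_integral_measurable) measurable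
  have 1: "integrable half_line (\<lambda>x. \<bar>h x\<bar> * (\<integral>y. indicator {..<x} y * \<bar>deriv \<phi> y\<bar> \<partial>half_line))"
  proof (rule Bochner_Integration.integrable_bound)
    let ?C = "\<integral>y. \<bar>deriv \<phi> y\<bar> \<partial>half_line"
    \<comment> \<open>Below \<open>a'\<close> the function \<open>deriv \<phi>\<close> vanishes, so
      the inner integral is 0 for \<open>x \<le> a' / 2\<close> and the majorant avoids the possible
      singularity of \<open>h\<close> at 0.\<close>
    show "integrable half_line (\<lambda>x. ?C * (indicator {a' / 2<..} x * h x))"
      using ab' by (intro integrable_mult_right h_integrable) simp
    show "AE x in half_line. norm (\<bar>h x\<bar> * (\<integral>y. indicator {..<x} y * \<bar>deriv \<phi> y\<bar> \<partial>half_line))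
        \<le> norm (?C * (indicator {a' / 2<..} x * h x))"
      using AE_half_line_pos
    proof eventually_elim
      case (elim x)
      show ?case
      proof (cases "a' / 2 < x")
        case True
        have ix: "integrable half_line (\<lambda>y. indicator {..<x} y * \<bar>deriv \<phi> y\<bar>)"
          using integrable_abs[OF I(1)[OF elim]] by (simp add: abs_mult)
        have "(\<integral>y. indicator {..<x} y * \<bar>deriv \<phi> y\<bar> \<partial>half_line) \<le> ?C"
          using ix integrable_abs[OF d\<phi>] by (intro integral_mono) (auto simp: indicator_def)
        moreover have "0 \<le> (\<integral>y. indicator {..<x} y * \<bar>deriv \<phi> y\<bar> \<partial>half_line)"
          by (intro Bochner_Integration.integral_nonneg) auto
        ultimately show ?thesis
          using True mult_left_mono[of "\<integral>y. indicator {..<x} y * \<bar>deriv \<phi> y\<bar> \<partial>half_line" ?C "\<bar>h x\<bar>"]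
          by (simp add: abs_mult mult.commute[of ?C])
      next
        case False
        then have "(\<integral>y. indicator {..<x} y * \<bar>deriv \<phi> y\<bar> \<partial>half_line) = (\<integral>y. 0 \<partial>half_line)"
          using ab' by (intro Bochner_Integration.integral_cong) (auto simp: indicator_def)
        then show ?thesis by simp
      qed
    qed
  qed (use m in measurable)
  note T = triangle_Fubini[OF h_measurable borel_measurable_integrable[OF d\<phi>] I(1) 1]
  have e1: "(\<integral>y. deriv \<phi> y * (\<integral>x. indicator {y<..} x * h x \<partial>half_line) \<partial>half_line) = (\<integral>y. H y * deriv \<phi> y \<partial>half_line)"
    by (rule Bochner_Integration.integral_cong) (simp_all add: H_eq)
  have e2: "(\<integral>x. h x * (\<integral>y. indicator {..<x} y * deriv \<phi> y \<partial>half_line) \<partial>half_line) = (\<integral>y. h y * \<phi> y \<partial>half_line)"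
    by (rule Bochner_Integration.integral_cong) (simp_all add: I(2))
  show "(\<integral>y. H y * deriv \<phi> y \<partial>half_line) = (\<integral>y. h y * \<phi> y \<partial>half_line)"
    unfolding e1[symmetric] e2[symmetric] by (rule T(1))
  show "integrable half_line (\<lambda>y. H y * deriv \<phi> y)"
    by (rule iffD1[OF Bochner_Integration.integrable_cong[OF refl] T(2)]) (simp_all add: H_eq)
  show "integrable half_line (\<lambda>y. h y * \<phi> y)"
    by (rule iffD1[OF Bochner_Integration.integrable_cong[OF refl] T(3)]) (simp_all add: I(2))
qed

text \<open>The integral of \<open>h t * h x\<close> over \<open>y < t < x\<close> is computed in
  both orders. One gives the integral of \<open>h * H\<close> above \<open>y\<close>, the other
  \<open>(H y)^2\<close> minus the same integral.\<close>

lemma H_square: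
  assumes y: "0 < y"
  shows "(H y)\<^sup>2 = 2 * (\<integral>x. indicator {y<..} x * (h x * H x) \<partial>half_line)"
proof -
  define f where "f x = indicator {y<..} x * h x" for x
  have f: "integrable half_line f" unfolding f_def[abs_def] by (rule h_integrable[OF y])
  note [measurable] = borel_measurable_integrable[OF f]
  have I: "(\<integral>t. indicator {..<x} t * f t \<partial>half_line) = H y - H x" if x: "y < x" for x
  proof -
    have "(\<integral>t. indicator {..<x} t * f t \<partial>half_line) = (\<integral>t. indicator {y<..} t * h t - indicator {x<..} t * h t \<partial>half_line)"
      using AE_half_line_neq[of x] integrable_half_line_indicator[OF f, of "{..<x}"] h_integrable[of x] h_integrable[OF y] x y
      by (intro integral_cong_AE) (auto simp: f_def indicator_def elim!: eventually_mono)
    then show ?thesis using h_integrable[of x] h_integrable[OF y] x y by (simp add: H_eq)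
  qed
  have "integrable half_line (\<lambda>x. \<bar>f x\<bar> * (\<integral>t. indicator {..<x} t * \<bar>f t\<bar> \<partial>half_line))"
  proof (rule Bochner_Integration.integrable_bound)
    let ?C = "\<integral>t. \<bar>f t\<bar> \<partial>half_line"
    show "integrable half_line (\<lambda>x. ?C * f x)" using f by simp
    show "(\<lambda>x. \<bar>f x\<bar> * (\<integral>t. indicator {..<x} t * \<bar>f t\<bar> \<partial>half_line)) \<in> borel_measurable half_line"
      by measurable
    have "(\<integral>t. indicator {..<x} t * \<bar>f t\<bar> \<partial>half_line) \<le> ?C" "0 \<le> (\<integral>t. indicator {..<x} t * \<bar>f t\<bar> \<partial>half_line)" for x
      using integrable_half_line_indicator[of "\<lambda>t. \<bar>f t\<bar>" "{..<x}"] f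
      by (auto intro!: integral_mono Bochner_Integration.integral_nonneg simp: indicator_def)
    then show "AE x in half_line. norm (\<bar>f x\<bar> * (\<integral>t. indicator {..<x} t * \<bar>f t\<bar> \<partial>half_line)) \<le> norm (?C * f x)"
      by (auto simp: abs_mult mult.commute intro!: mult_left_mono)
  qed
  note T = triangle_Fubini[OF borel_measurable_integrable[OF f] borel_measurable_integrable[OF f] integrable_half_line_indicator[OF f] this]
  have "f t * (\<integral>x. indicator {t<..} x * f x \<partial>half_line) = indicator {y<..} t * (h t * H t)" if "0 < t" for t
  proof (cases "y < t")
    case True
    have "(\<integral>x. indicator {t<..} x * f x \<partial>half_line) = H t"
      using True that unfolding H_eq[OF less_imp_le[OF that]]
      by (intro Bochner_Integration.integral_cong) (auto simp: f_def indicator_def)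
    then show ?thesis using True by (simp add: f_def)
  qed (simp add: f_def)
  then have e1: "(\<integral>t. f t * (\<integral>x. indicator {t<..} x * f x \<partial>half_line) \<partial>half_line)
      = (\<integral>t. indicator {y<..} t * (h t * H t) \<partial>half_line)"
    and i1: "integrable half_line (\<lambda>t. indicator {y<..} t * (h t * H t))"
    by (auto intro!: Bochner_Integration.integral_cong T(2)[THEN Bochner_Integration.integrable_cong[THEN iffD1, rotated -1]])
  have e2: "(\<integral>x. f x * (\<integral>t. indicator {..<x} t * f t \<partial>half_line) \<partial>half_line)
      = (\<integral>x. H y * f x - indicator {y<..} x * (h x * H x) \<partial>half_line)"
  proof (rule Bochner_Integration.integral_cong)
    fix x show "f x * (\<integral>t. indicator {..<x} t * f t \<partial>half_line) = H y * f x - indicator {y<..} x * (h x * H x)"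
    proof (cases "y < x")
      case True
      then have "f x = h x" by (simp add: f_def)
      then show ?thesis using True unfolding I[OF True] by (simp add: algebra_simps)
    qed (simp add: f_def)
  qed simp
  have "(\<integral>x. H y * f x - indicator {y<..} x * (h x * H x) \<partial>half_line)
      = H y * (\<integral>x. f x \<partial>half_line) - (\<integral>x. indicator {y<..} x * (h x * H x) \<partial>half_line)"
    using f i1 by simp
  moreover have "(\<integral>x. f x \<partial>half_line) = H y" using y by (simp add: H_eq f_def)
  ultimately show ?thesis using T(1) e1 e2 by (simp add: power2_eq_square)
qed

text \<open>\<open>(1 + \<mu> * y) * exp (\<mu> * y)\<close> is the derivative of
  \<open>y * exp (\<mu> * y)\<close>. Fubini with this \<open>w\<close> and with
  \<open>h * H\<close> in the role of \<open>f\<close>, combined with \<open>H_square\<close>, is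
  the integration by parts; no boundary terms appear.\<close>

lemma energy_identity:
  "(\<integral>y. (H y)\<^sup>2 * ((1 + \<mu> * y) * exp (\<mu> * y)) \<partial>half_line) = 2 * (\<integral>y. y * h y * H y * exp (\<mu> * y) \<partial>half_line)"
proof -
  let ?w = "\<lambda>y. (1 + \<mu> * y) * exp (\<mu> * y)"
  have wc: "continuous_on A ?w" for A by (intro continuous_intros)
  have wm: "?w \<in> borel_measurable half_line"
    by (intro borel_imp_half_line borel_measurable_continuous_onI wc)
  have D: "((\<lambda>y. y * exp (\<mu> * y)) has_real_derivative ?w y) (at y)" for y
    by (auto intro!: derivative_eq_intros simp: algebra_simps)
  have I: "integrable half_line (\<lambda>y. indicator {..<x} y * ?w y)" "(\<integral>y. indicator {..<x} y * ?w y \<partial>half_line) = x * exp (\<mu> * x)"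
    if "0 < x" for x
    using FTC_half_line_Iio[OF that D wc] by auto
  have I': "(\<integral>y. indicator {..<x} y * \<bar>?w y\<bar> \<partial>half_line) = x * exp (\<mu> * x)" if "0 < x" for x
    unfolding I(2)[OF that, symmetric] using mu
    by (intro Bochner_Integration.integral_cong) auto
  have hH: "integrable half_line (\<lambda>y. y * h y * H y * exp (\<mu> * y))"
    by (rule L2_exp_mult_integrable[OF yh H_L2_exp])
  have "integrable half_line (\<lambda>x. \<bar>h x * H x\<bar> * (\<integral>y. indicator {..<x} y * \<bar>?w y\<bar> \<partial>half_line))"
    using integrable_abs[OF hH]
    by (rule Bochner_Integration.integrable_cong[THEN iffD1, rotated -1]) (simp_all only: I' space_half_line greaterThan_iff, auto simp: abs_mult)
  from triangle_Fubini(1)[OF _ wm I(1) this]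
  have "(\<integral>y. ?w y * (\<integral>x. indicator {y<..} x * (h x * H x) \<partial>half_line) \<partial>half_line)
    = (\<integral>x. (h x * H x) * (\<integral>y. indicator {..<x} y * ?w y \<partial>half_line) \<partial>half_line)" by simp
  also have "\<dots> = (\<integral>y. y * h y * H y * exp (\<mu> * y) \<partial>half_line)"
    by (rule Bochner_Integration.integral_cong) (auto simp: I(2))
  also have "(\<integral>y. ?w y * (\<integral>x. indicator {y<..} x * (h x * H x) \<partial>half_line) \<partial>half_line)
      = (\<integral>y. (1 / 2) * ((H y)\<^sup>2 * ?w y) \<partial>half_line)"
    by (rule Bochner_Integration.integral_cong) (auto simp: H_square)
  finally show ?thesis by simp
qed

end

section \<open>The convolution inequality\<close>

lemma Cauchy_Schwarz_half_line:
  fixes u v :: "real \<Rightarrow> real"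
  assumes "u \<in> borel_measurable half_line" "v \<in> borel_measurable half_line"
    and "integrable half_line (\<lambda>x. (u x)\<^sup>2)" "integrable half_line (\<lambda>x. (v x)\<^sup>2)"
  shows "(\<integral>x. u x * v x \<partial>half_line)\<^sup>2 \<le> (\<integral>x. (u x)\<^sup>2 \<partial>half_line) * (\<integral>x. (v x)\<^sup>2 \<partial>half_line)"
proof -
  interpret semi_inner_space "L2_exp 0" "ip_exp 0" by (rule semi_inner_space_L2_exp)
  have uv: "u \<in> L2_exp 0" "v \<in> L2_exp 0" using assms by (simp_all add: L2_exp_iff)
  have "\<bar>ip_exp 0 u v\<bar>\<^sup>2 \<le> (nrm u * nrm v)\<^sup>2"
    by (intro power_mono ip_Cauchy_Schwarz uv) simp
  then show ?thesis
    by (simp add: power_mult_distrib nrm_square uv) (simp add: ip_exp_def power2_eq_square)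
qed

text \<open>\<open>k\<close> need not be bounded near 0, so the integral is cut at
  \<open>y / 2\<close>; the part below is constant in \<open>x\<close>, and the fundamental theorem
  applies to the rest.\<close>

lemma DERIV_indefinite_integral_half_line:
  assumes k: "continuous_on {0<..} k" and int: "\<And>x. 0 < x \<Longrightarrow> integrable half_line (\<lambda>t. indicator {..<x} t * k t)"
    and y: "0 < y"
  shows "((\<lambda>x. \<integral>t. indicator {..<x} t * k t \<partial>half_line) has_real_derivative k y) (at y)"
proof -
  let ?c = "y / 2" and ?d = "2 * y"
  let ?J = "\<lambda>x. \<integral>t. indicator {..<x} t * k t \<partial>half_line"
  have kc: "continuous_on {?c..?d} k" using y by (intro continuous_on_subset[OF k]) auto
  have J: "?J x = ?J ?c + integral {?c..x} k" if x: "?c \<le> x" for x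
  proof -
    have kcx: "continuous_on {?c..x} k" using y by (intro continuous_on_subset[OF k]) auto
    have i1: "set_integrable lborel {0<..<?c} k" and i3: "set_integrable lborel {0<..<x} k"
      using int[of ?c] int[of x] x y by (auto simp: integrable_half_line_Iio)
    have i2: "set_integrable lborel {?c..x} k" by (rule borel_integrable_atLeastAtMost'[OF kcx])
    then have i2': "set_integrable lborel {?c..<x} k" by (rule set_integrable_subset) auto
    have un: "{0<..<x} = {0<..<?c} \<union> {?c..<x}" using x y by auto
    have "(LBINT t:{0<..<x}. k t) = (LBINT t:{0<..<?c}. k t) + (LBINT t:{?c..<x}. k t)"
      unfolding un by (rule set_integral_Un[OF _ i1 i2']) auto
    moreover have "(LBINT t:{?c..<x}. k t) = (LBINT t:{?c..x}. k t)"
    proof (rule set_integral_cong_set)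
      show "set_borel_measurable lborel {?c..<x} k" "set_borel_measurable lborel {?c..x} k"
        using i2 i2' by (auto simp: set_integrable_def set_borel_measurable_def)
      show "AE t in lborel. t \<in> {?c..x} \<longleftrightarrow> t \<in> {?c..<x}"
        using AE_lborel_singleton[of x] by eventually_elim auto
    qed
    moreover have "(LBINT t:{?c..x}. k t) = integral {?c..x} k"
      by (rule set_borel_integral_eq_integral(2)[OF i2])
    ultimately show ?thesis by (simp add: integrable_half_line_Iio)
  qed
  have "((\<lambda>x. integral {?c..x} k) has_real_derivative k y) (at y within {?c..?d})"
    using y by (intro integral_has_real_derivative kc) auto
  moreover have "at y within {?c..?d} = at y" using y by (intro at_within_interior) auto
  ultimately have "((\<lambda>x. ?J ?c + integral {?c..x} k) has_real_derivative k y) (at y)"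
    by (auto intro!: derivative_eq_intros)
  then show ?thesis
  proof (rule DERIV_transform_nhds)
    have "\<forall>\<^sub>F x in nhds y. x \<in> {?c<..}" using y by (intro eventually_nhds_in_open) auto
    then show "\<forall>\<^sub>F x in nhds y. ?J ?c + integral {?c..x} k = ?J x"
      by eventually_elim (rule J[symmetric], simp)
  qed
qed

lemma exp_neg_tail_integral:
  fixes c y :: real
  assumes c: "0 < c" and y: "0 < y"
  shows "(\<integral>x. indicator {y<..} x * exp (- (c * x)) \<partial>half_line) = exp (- (c * y)) / c"
proof -
  have "(\<integral>x. indicator {..<y} x * exp (- (c * x)) \<partial>half_line) = - (1 / c) * exp (- (c * y)) - (- (1 / c) * exp (- (c * 0)))"
    using c by (intro FTC_half_line_Iio(2)[OF y]) (auto intro!: derivative_eq_intros continuous_intros)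
  then show ?thesis
    using integral_half_line_split[OF exp_neg_integrable_half_line(1)[OF c], of y] exp_neg_integrable_half_line(2)[OF c]
    by simp
qed

context weighted_tail
begin

section \<open>The convolution term and its integrability\<close>

definition W :: "real \<Rightarrow> real" where
  "W y = (\<integral>x. indicator {..<y} x * (H x * exp (\<mu> * x)) \<partial>half_line)"

text \<open>The convolution of \<open>H\<close> with \<open>exp (- (\<mu> * y))\<close>, so that
  \<open>H * g\<close> is \<open>2 * \<mu> * V\<close>.\<close>

definition V :: "real \<Rightarrow> real" where
  "V y = exp (- (\<mu> * y)) * W y"

definition M :: "real \<Rightarrow> real" where
  "M y = (\<integral>x. indicator {..<y} x * H x \<partial>half_line)"

lemma H_integrable: "integrable half_line H"
  by (rule L2_exp_integrable[OF H_L2_exp mu])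

lemma H_square_integrable: "integrable half_line (\<lambda>x. (H x)\<^sup>2 * exp (\<mu> * x))"
  using H_L2_exp by (simp add: L2_exp_iff)

lemma W_integrable: "0 < y \<Longrightarrow> integrable half_line (\<lambda>x. indicator {..<y} x * (H x * exp (\<mu> * x)))"
proof (rule Bochner_Integration.integrable_bound)
  assume y: "0 < y"
  show "integrable half_line (\<lambda>x. exp (\<mu> * y) * H x)" using H_integrable by simp
  have ind: "indicator {..<y} x = (if x < y then 1 else 0 :: real)" for x by simp
  show "(\<lambda>x. indicator {..<y} x * (H x * exp (\<mu> * x))) \<in> borel_measurable half_line"
    unfolding ind by measurable
  show "AE x in half_line. norm (indicator {..<y} x * (H x * exp (\<mu> * x))) \<le> norm (exp (\<mu> * y) * H x)"
  proof (rule AE_I2)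
    fix x
    have "\<bar>H x\<bar> * exp (\<mu> * x) \<le> \<bar>H x\<bar> * exp (\<mu> * y)" if "x < y"
      using mu that by (intro mult_left_mono) auto
    then show "norm (indicator {..<y} x * (H x * exp (\<mu> * x))) \<le> norm (exp (\<mu> * y) * H x)"
      by (cases "x < y") (auto simp: abs_mult mult.commute)
  qed
qed

lemma DERIV_M: "0 < y \<Longrightarrow> (M has_real_derivative H y) (at y)"
  unfolding M_def[abs_def]
  by (rule DERIV_indefinite_integral_half_line[OF H_continuous_on])
    (auto intro: integrable_half_line_indicator H_integrable)

lemma DERIV_W: "0 < y \<Longrightarrow> (W has_real_derivative H y * exp (\<mu> * y)) (at y)"
  unfolding W_def[abs_def]
  by (rule DERIV_indefinite_integral_half_line)
    (auto intro!: W_integrable continuous_intros H_continuous_on)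

lemma W_continuous_on: "continuous_on {0<..} W"
  by (rule DERIV_continuous_on[where D = "\<lambda>y. H y * exp (\<mu> * y)"])
    (auto intro: DERIV_W has_field_derivative_at_within)

lemma M_continuous_on: "continuous_on {0<..} M"
  by (rule DERIV_continuous_on[where D = H]) (auto intro: DERIV_M has_field_derivative_at_within)

lemma V_continuous_on: "continuous_on {0<..} V"
  unfolding V_def[abs_def] by (intro continuous_intros W_continuous_on)

lemma W_measurable [measurable]: "W \<in> borel_measurable half_line"
  by (rule continuous_on_half_line_measurable[OF W_continuous_on])

lemma V_measurable [measurable]: "V \<in> borel_measurable half_line"
  by (rule continuous_on_half_line_measurable[OF V_continuous_on])

text \<open>After multiplication by the square root of the weight, \<open>V\<close> is the image of
  \<open>H x * exp (\<mu> / 2 * x)\<close> under the kernel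
  \<open>exp (- \<mu> / 2 * (y - x))\<close> on \<open>x < y\<close>. Half of the decay survives,
  rows and columns integrate to at most \<open>2 / \<mu>\<close>, and constant functions serve in
  the Schur test.\<close>

lemma V_L2_exp: "V \<in> L2_exp \<mu>"
  unfolding L2_exp_iff
proof
  define k where "k y x = (if x < y then exp (\<mu> / 2 * x) * exp (- (\<mu> / 2 * y)) else 0)" for y x
  define f where "f x = \<bar>H x\<bar> * exp (\<mu> / 2 * x)" for x
  have exp2: "exp (\<mu> / 2 * y) * exp (\<mu> / 2 * y) = exp (\<mu> * y)" for y
    by (simp flip: exp_add)
  have [measurable]: "f \<in> borel_measurable half_line" unfolding f_def by measurable
  have k_meas: "case_prod k \<in> borel_measurable (half_line \<Otimes>\<^sub>M half_line)"
    unfolding k_def by measurable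
  have "(\<integral>\<^sup>+y. (\<integral>\<^sup>+x. ennreal (k y x * f x) \<partial>half_line)\<^sup>2 \<partial>half_line)
    \<le> ennreal (2 / \<mu> * (2 / \<mu>)) * (\<integral>\<^sup>+x. ennreal ((f x)\<^sup>2) \<partial>half_line)"
  proof (rule Schur_test[where p = "\<lambda>_. 1" and q = "\<lambda>_. 1"])
    fix y :: real assume y: "0 < y"
    let ?w = "\<lambda>x. exp (\<mu> / 2 * x) * exp (- (\<mu> / 2 * y))"
    have I: "integrable half_line (\<lambda>x. indicator {..<y} x * ?w x)"
      "(\<integral>x. indicator {..<y} x * ?w x \<partial>half_line) = 2 / \<mu> * ?w y - 2 / \<mu> * ?w 0"
      using mu by (intro FTC_half_line_Iio[OF y, of "\<lambda>x. 2 / \<mu> * ?w x"];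
          auto intro!: derivative_eq_intros continuous_intros)+
    have "(\<integral>\<^sup>+x. ennreal (k y x * 1) \<partial>half_line) = (\<integral>\<^sup>+x. ennreal (indicator {..<y} x * ?w x) \<partial>half_line)"
      by (intro nn_integral_cong) (auto simp: k_def)
    also have "\<dots> = ennreal (2 / \<mu> * ?w y - 2 / \<mu> * ?w 0)"
      using I by (subst nn_integral_eq_integral) auto
    also have "\<dots> \<le> ennreal (2 / \<mu> * 1)"
    proof (rule ennreal_leI)
      have w1: "?w y = 1" by (simp flip: exp_add)
      have w0: "0 \<le> 2 / \<mu> * ?w 0" using mu by simp
      have "b - c \<le> b" if "0 \<le> c" for b c :: real using that by simp
      from this[OF w0] show "2 / \<mu> * ?w y - 2 / \<mu> * ?w 0 \<le> 2 / \<mu> * 1" unfolding w1 .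
    qed
    finally show "(\<integral>\<^sup>+x. ennreal (k y x * 1) \<partial>half_line) \<le> ennreal (2 / \<mu> * 1)" .
  next
    fix x :: real assume x: "0 < x"
    have c: "0 < \<mu> / 2" using mu by simp
    have "(\<integral>\<^sup>+y. ennreal (k y x * 1) \<partial>half_line)
        = (\<integral>\<^sup>+y. ennreal (exp (\<mu> / 2 * x) * (indicator {x<..} y * exp (- (\<mu> / 2 * y)))) \<partial>half_line)"
      by (intro nn_integral_cong) (auto simp: k_def)
    also have "\<dots> = ennreal (exp (\<mu> / 2 * x) * (\<integral>y. indicator {x<..} y * exp (- (\<mu> / 2 * y)) \<partial>half_line))"
      by (subst nn_integral_eq_integral)
        (auto intro!: integrable_mult_right integrable_half_line_indicator exp_neg_integrable_half_line(1)[OF c] simp del: times_divide_eq_left)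
    also have "\<dots> = ennreal (2 / \<mu> * 1)"
    proof -
      have "exp (\<mu> / 2 * x) * exp (- (\<mu> / 2 * x)) = 1" by (simp flip: exp_add)
      moreover have "a * (b / (\<mu> / 2)) = (a * b) * (2 / \<mu> * 1)" for a b by simp
      ultimately show ?thesis unfolding exp_neg_tail_integral[OF c x] by (simp only: mult_1_left)
    qed
    finally show "(\<integral>\<^sup>+y. ennreal (k y x * 1) \<partial>half_line) \<le> ennreal (2 / \<mu> * 1)" by simp
  qed (use mu in \<open>auto simp: k_def f_def k_meas\<close>)
  moreover have "(\<integral>\<^sup>+x. ennreal ((f x)\<^sup>2) \<partial>half_line) < \<infinity>"
  proof -
    have "(f x)\<^sup>2 = (H x)\<^sup>2 * exp (\<mu> * x)" for x
      unfolding f_def power_mult_distrib power2_abs exp2[symmetric] by (simp only: power2_eq_square)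
    then show ?thesis using H_square_integrable by (simp add: integrable_iff_bounded)
  qed
  then have "ennreal (2 / \<mu> * (2 / \<mu>)) * (\<integral>\<^sup>+x. ennreal ((f x)\<^sup>2) \<partial>half_line) < \<infinity>"
    by (simp add: ennreal_mult_less_top)
  ultimately have fin: "(\<integral>\<^sup>+y. (\<integral>\<^sup>+x. ennreal (k y x * f x) \<partial>half_line)\<^sup>2 \<partial>half_line) < \<infinity>"
    by (rule le_less_trans)
  have "(\<integral>\<^sup>+y. ennreal ((V y)\<^sup>2 * exp (\<mu> * y)) \<partial>half_line)
      \<le> (\<integral>\<^sup>+y. (\<integral>\<^sup>+x. ennreal (k y x * f x) \<partial>half_line)\<^sup>2 \<partial>half_line)"
  proof (rule nn_integral_mono, unfold space_half_line greaterThan_iff)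
    fix y :: real assume y: "0 < y"
    let ?c = "exp (- (\<mu> / 2 * y))"
    have int: "integrable half_line (\<lambda>x. ?c * (indicator {..<y} x * (H x * exp (\<mu> * x))))"
      by (intro integrable_mult_right W_integrable y)
    have "ennreal (?c * \<bar>W y\<bar>) = ennreal \<bar>\<integral>x. ?c * (indicator {..<y} x * (H x * exp (\<mu> * x))) \<partial>half_line\<bar>"
      unfolding integral_mult_right_zero abs_mult W_def by simp
    also have "\<dots> \<le> (\<integral>\<^sup>+x. ennreal (norm (?c * (indicator {..<y} x * (H x * exp (\<mu> * x))))) \<partial>half_line)"
      using integral_norm_bound_ennreal[OF int] by simp
    also have "\<dots> = (\<integral>\<^sup>+x. ennreal (k y x * f x) \<partial>half_line)"
      by (intro nn_integral_cong arg_cong[where f = ennreal]) (simp add: k_def f_def abs_mult exp2[symmetric])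
    finally have "(ennreal (?c * \<bar>W y\<bar>))\<^sup>2 \<le> (\<integral>\<^sup>+x. ennreal (k y x * f x) \<partial>half_line)\<^sup>2"
      by (intro power_mono_ennreal)
    moreover have "(?c * \<bar>W y\<bar>)\<^sup>2 = (V y)\<^sup>2 * exp (\<mu> * y)"
    proof -
      have "?c * ?c = exp (- (\<mu> * y)) * exp (- (\<mu> * y)) * exp (\<mu> * y)"
        by (simp flip: exp_add)
      then have "?c\<^sup>2 = (exp (- (\<mu> * y)))\<^sup>2 * exp (\<mu> * y)" by (simp only: power2_eq_square)
      then show ?thesis unfolding V_def power_mult_distrib power2_abs by simp
    qed
    moreover have "(ennreal (?c * \<bar>W y\<bar>))\<^sup>2 = ennreal ((?c * \<bar>W y\<bar>)\<^sup>2)"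
      by (intro ennreal_power mult_nonneg_nonneg abs_ge_zero exp_ge_zero)
    ultimately show "ennreal ((V y)\<^sup>2 * exp (\<mu> * y)) \<le> (\<integral>\<^sup>+x. ennreal (k y x * f x) \<partial>half_line)\<^sup>2"
      by (simp only:)
  qed
  from le_less_trans[OF this fin]
  show "integrable half_line (\<lambda>y. (V y)\<^sup>2 * exp (\<mu> * y))"
    by (intro integrableI_nonneg) auto
qed measurable

lemma HW_integrable: "integrable half_line (\<lambda>y. H y * W y)"
proof -
  have "integrable half_line (\<lambda>y. H y * V y * exp (\<mu> * y))"
    by (rule L2_exp_mult_integrable[OF H_L2_exp V_L2_exp])
  also have "(\<lambda>y. H y * V y * exp (\<mu> * y)) = (\<lambda>y. H y * W y)"
    by (simp add: V_def fun_eq_iff exp_minus)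
  finally show ?thesis .
qed

section \<open>Growth bounds at 0 and at infinity\<close>

definition energy_density :: "real \<Rightarrow> real" where
  "energy_density y = (H y)\<^sup>2 * ((1 + \<mu> * y) * exp (\<mu> * y))"

lemma energy_density_integrable: "integrable half_line energy_density"
  unfolding energy_density_def[abs_def] by (rule Hardy)

lemma energy_density_nonneg: "0 < y \<Longrightarrow> 0 \<le> energy_density y"
  using mu by (simp add: energy_density_def)

lemma H_square_le_energy: "0 < y \<Longrightarrow> (H y)\<^sup>2 * exp (\<mu> * y) \<le> energy_density y" "0 < y \<Longrightarrow> (H y)\<^sup>2 \<le> energy_density y"
proof -
  assume y: "0 < y"
  have "1 * exp (\<mu> * y) \<le> (1 + \<mu> * y) * exp (\<mu> * y)"
    using mu y by (intro mult_right_mono) auto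
  then show 1: "(H y)\<^sup>2 * exp (\<mu> * y) \<le> energy_density y"
    unfolding energy_density_def by (intro mult_left_mono) auto
  have "(H y)\<^sup>2 * 1 \<le> (H y)\<^sup>2 * exp (\<mu> * y)"
    using mu y by (intro mult_left_mono) auto
  with 1 show "(H y)\<^sup>2 \<le> energy_density y" by simp
qed

definition energy_below :: "real \<Rightarrow> real" where "energy_below y = (\<integral>x. indicator {..<y} x * energy_density x \<partial>half_line)"
definition energy_above :: "real \<Rightarrow> real" where "energy_above y = (\<integral>x. indicator {y<..} x * energy_density x \<partial>half_line)"
definition total_energy :: "real" where "total_energy = integral\<^sup>L half_line energy_density"

lemma energy_nonneg: "0 \<le> energy_below y" "0 \<le> energy_above y" "0 \<le> total_energy"
  unfolding energy_below_def energy_above_def total_energy_def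
  by (rule integral_nonneg_AE, use AE_half_line_pos in eventually_elim, simp add: energy_density_nonneg)+

text \<open>Cauchy-Schwarz on \<open>(0, y)\<close>. The coefficient \<open>1 / y\<close> in the
  boundary term is borderline for this bound; the factor \<open>energy_below y\<close>, and not the
  total energy, makes the product tend to 0.\<close>

lemma M_square_le_near_0:
  assumes y: "0 < y"
  shows "(M y)\<^sup>2 \<le> energy_below y * y"
proof -
  have I1: "integrable half_line (\<lambda>x. indicator {..<y} x * (1::real))" "(\<integral>x. indicator {..<y} x * (1::real) \<partial>half_line) = y"
    using FTC_half_line_Iio[OF y, of "\<lambda>x. x" "\<lambda>_. 1"] by auto
  have ind2: "(indicator A x :: real)\<^sup>2 = indicator A x" for A and x :: real by (simp add: indicator_def)
  have i: "integrable half_line (\<lambda>x. (indicator {..<y} x * H x)\<^sup>2)"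
  proof (rule Bochner_Integration.integrable_bound[OF energy_density_integrable])
    show "(\<lambda>x. (indicator {..<y} x * H x)\<^sup>2) \<in> borel_measurable half_line"
      using borel_measurable_integrable[OF integrable_half_line_indicator[OF H_integrable, of "{..<y}"]] by simp
    show "AE x in half_line. norm ((indicator {..<y} x * H x)\<^sup>2) \<le> norm (energy_density x)"
      using AE_half_line_pos
      by eventually_elim (use H_square_le_energy energy_density_nonneg in \<open>auto simp: power_mult_distrib indicator_def\<close>)
  qed
  have "(M y)\<^sup>2 = (\<integral>x. (indicator {..<y} x * H x) * indicator {..<y} x \<partial>half_line)\<^sup>2"
    unfolding M_def by (intro arg_cong[where f = "\<lambda>t. t\<^sup>2"] Bochner_Integration.integral_cong) (auto simp: indicator_def)
  also have "\<dots> \<le> (\<integral>x. (indicator {..<y} x * H x)\<^sup>2 \<partial>half_line) * (\<integral>x. (indicator {..<y} x)\<^sup>2 \<partial>half_line)"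
    using i I1 borel_measurable_integrable[OF integrable_half_line_indicator[OF H_integrable, of "{..<y}"]]
    by (intro Cauchy_Schwarz_half_line) (auto simp: ind2)
  also have "(\<integral>x. (indicator {..<y} x)\<^sup>2 \<partial>half_line) = y" using I1 by (simp add: ind2)
  also have "(\<integral>x. (indicator {..<y} x * H x)\<^sup>2 \<partial>half_line) * y \<le> energy_below y * y"
    unfolding energy_below_def
  proof (intro mult_right_mono integral_mono_AE i integrable_half_line_indicator energy_density_integrable)
    show "AE x in half_line. (indicator {..<y} x * H x)\<^sup>2 \<le> indicator {..<y} x * energy_density x"
      using AE_half_line_pos by eventually_elim (use H_square_le_energy in \<open>auto simp: indicator_def\<close>)
  qed (use y in auto)
  finally show ?thesis .
qed

text \<open>Mean zero turns \<open>M y\<close> into minus the tail integral of \<open>H\<close>, to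
  which Cauchy-Schwarz is applied with the full weight \<open>w\<close>. Its factor
  \<open>1 + \<mu> * y\<close> reappears in the denominator and offsets the coefficient of order
  \<open>y\<close> in the boundary term.\<close>

lemma M_square_le_near_infinity:
  assumes y: "0 < y" and mean: "integral\<^sup>L half_line H = 0"
  shows "(M y)\<^sup>2 \<le> energy_above y * (exp (- (\<mu> * y)) / (\<mu> * (1 + \<mu> * y)))"
proof -
  define w where "w x = (1 + \<mu> * x) * exp (\<mu> * x)" for x
  have w_pos: "0 < w x" if "0 < x" for x using that mu by (simp add: w_def add_pos_pos)
  have [measurable]: "w \<in> borel_measurable half_line" unfolding w_def by measurable
  have ind: "indicator {y<..} x = (if y < x then 1 else 0 :: real)" for x by simp
  let ?u = "\<lambda>x. (if y < x then H x * sqrt (w x) else 0)" and ?z = "\<lambda>x. (if y < x then 1 / sqrt (w x) else 0)"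
  have u2: "(?u x)\<^sup>2 = indicator {y<..} x * energy_density x" if "0 < x" for x
    using that w_pos[OF that] by (auto simp: power_mult_distrib energy_density_def w_def)
  have z2: "(?z x)\<^sup>2 \<le> indicator {y<..} x * exp (- (\<mu> * x)) / (1 + \<mu> * y)" if "0 < x" for x
  proof (cases "y < x")
    case True
    have "(?z x)\<^sup>2 = exp (- (\<mu> * x)) / (1 + \<mu> * x)"
      using True w_pos[OF that] by (simp add: power_divide) (simp add: w_def exp_minus field_simps)
    also have "\<dots> \<le> exp (- (\<mu> * x)) / (1 + \<mu> * y)"
      using True y mu by (intro divide_left_mono mult_pos_pos add_pos_pos) auto
    finally show ?thesis using True by simp
  qed simp
  have iu: "integrable half_line (\<lambda>x. (?u x)\<^sup>2)"
    by (rule iffD1[OF Bochner_Integration.integrable_cong[OF refl] integrable_half_line_indicator[OF energy_density_integrable, of "{y<..}"]])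
      (use u2 in auto)
  have ie: "integrable half_line (\<lambda>x. indicator {y<..} x * exp (- (\<mu> * x)) / (1 + \<mu> * y))"
    by (intro integrable_divide integrable_half_line_indicator exp_neg_integrable_half_line(1) mu) simp
  have iz: "integrable half_line (\<lambda>x. (?z x)\<^sup>2)"
  proof (rule Bochner_Integration.integrable_bound[OF ie])
    show "AE x in half_line. norm ((?z x)\<^sup>2) \<le> norm (indicator {y<..} x * exp (- (\<mu> * x)) / (1 + \<mu> * y))"
      using AE_half_line_pos
    proof eventually_elim
      case (elim x)
      have "norm ((?z x)\<^sup>2) = (?z x)\<^sup>2" by simp
      also have "\<dots> \<le> indicator {y<..} x * exp (- (\<mu> * x)) / (1 + \<mu> * y)" by (rule z2[OF elim])
      also have "\<dots> \<le> norm (indicator {y<..} x * exp (- (\<mu> * x)) / (1 + \<mu> * y))"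
        unfolding real_norm_def by (rule abs_ge_self)
      finally show ?case .
    qed
  qed measurable
  have "(M y)\<^sup>2 = (\<integral>x. indicator {y<..} x * H x \<partial>half_line)\<^sup>2"
    using integral_half_line_split[OF H_integrable, of y] mean by (simp add: M_def add_eq_0_iff)
  also have "(\<integral>x. indicator {y<..} x * H x \<partial>half_line) = (\<integral>x. ?u x * ?z x \<partial>half_line)"
    by (intro Bochner_Integration.integral_cong refl) (use w_pos y in \<open>auto simp: less_imp_neq[symmetric] dest: order_less_trans\<close>)
  also have "(\<integral>x. ?u x * ?z x \<partial>half_line)\<^sup>2 \<le> (\<integral>x. (?u x)\<^sup>2 \<partial>half_line) * (\<integral>x. (?z x)\<^sup>2 \<partial>half_line)"
    by (intro Cauchy_Schwarz_half_line iu iz) measurable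
  also have "(\<integral>x. (?u x)\<^sup>2 \<partial>half_line) = energy_above y"
    unfolding energy_above_def by (intro Bochner_Integration.integral_cong refl) (use u2 in auto)
  also have "energy_above y * (\<integral>x. (?z x)\<^sup>2 \<partial>half_line) \<le> energy_above y * (\<integral>x. indicator {y<..} x * exp (- (\<mu> * x)) / (1 + \<mu> * y) \<partial>half_line)"
    by (intro mult_left_mono integral_mono_AE iz ie energy_nonneg, use AE_half_line_pos in eventually_elim) (use z2 in auto)
  also have "(\<integral>x. indicator {y<..} x * exp (- (\<mu> * x)) / (1 + \<mu> * y) \<partial>half_line) = exp (- (\<mu> * y)) / (\<mu> * (1 + \<mu> * y))"
    using exp_neg_tail_integral[OF mu y] by simp
  finally show ?thesis .
qed

text \<open>The factor \<open>exp (\<mu> * x)\<close> is shared equally between \<open>H\<close> and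
  the constant 1 before Cauchy-Schwarz, since \<open>H\<close> is controlled by half of the exponent
  only.\<close>

lemma W_square_le:
  assumes y: "0 < y"
  shows "(W y)\<^sup>2 \<le> total_energy * ((exp (\<mu> * y) - 1) / \<mu>)"
proof -
  have exp2: "(exp (\<mu> / 2 * x))\<^sup>2 = exp (\<mu> * x)" for x
    using exp_double[of "\<mu> / 2 * x"] by simp
  let ?z = "\<lambda>x. indicator {..<y} x * exp (\<mu> / 2 * x)" and ?u = "\<lambda>x. H x * exp (\<mu> / 2 * x)"
  have z2: "(?z x)\<^sup>2 = indicator {..<y} x * exp (\<mu> * x)" for x
    unfolding power_mult_distrib exp2 by (simp add: indicator_def)
  have u2: "(?u x)\<^sup>2 = (H x)\<^sup>2 * exp (\<mu> * x)" for x
    unfolding power_mult_distrib exp2 ..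
  have I: "integrable half_line (\<lambda>x. indicator {..<y} x * exp (\<mu> * x))"
    "(\<integral>x. indicator {..<y} x * exp (\<mu> * x) \<partial>half_line) = exp (\<mu> * y) / \<mu> - exp (\<mu> * 0) / \<mu>"
    using mu by (intro FTC_half_line_Iio[OF y, of "\<lambda>x. exp (\<mu> * x) / \<mu>"];
        auto intro!: derivative_eq_intros continuous_intros)+
  have ind: "indicator {..<y} x = (if x < y then 1 else 0 :: real)" for x by simp
  have zm: "?z \<in> borel_measurable half_line" unfolding ind by measurable
  have Wy: "W y = (\<integral>x. ?u x * ?z x \<partial>half_line)"
    unfolding W_def by (intro Bochner_Integration.integral_cong refl)
      (simp add: exp2[symmetric] power2_eq_square indicator_def)
  have iuz: "integrable half_line (\<lambda>x. (?u x)\<^sup>2)" "integrable half_line (\<lambda>x. (?z x)\<^sup>2)"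
    using H_square_integrable I(1) by (simp_all only: u2 z2)
  have um: "?u \<in> borel_measurable half_line" by measurable
  have "(W y)\<^sup>2 \<le> (\<integral>x. (?u x)\<^sup>2 \<partial>half_line) * (\<integral>x. (?z x)\<^sup>2 \<partial>half_line)"
    unfolding Wy by (rule Cauchy_Schwarz_half_line[OF um zm iuz])
  also have "\<dots> = (\<integral>x. (H x)\<^sup>2 * exp (\<mu> * x) \<partial>half_line) * ((exp (\<mu> * y) - 1) / \<mu>)"
    unfolding u2 z2 I(2) by (simp add: diff_divide_distrib)
  also have "\<dots> \<le> total_energy * ((exp (\<mu> * y) - 1) / \<mu>)"
  proof (intro mult_right_mono)
    show "(\<integral>x. (H x)\<^sup>2 * exp (\<mu> * x) \<partial>half_line) \<le> total_energy"
      unfolding total_energy_def by (intro integral_mono_AE H_square_integrable energy_density_integrable, use AE_half_line_pos in eventually_elim) (rule H_square_le_energy)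
    show "0 \<le> (exp (\<mu> * y) - 1) / \<mu>" using mu y by simp
  qed
  finally show ?thesis .
qed

lemma energy_below_tendsto: "(\<lambda>n. energy_below (1 / real (Suc n))) \<longlonglongrightarrow> 0"
proof -
  have "(\<lambda>n. \<integral>x. indicator {..<1 / real (Suc n)} x * energy_density x \<partial>half_line) \<longlonglongrightarrow> (\<integral>x. 0 \<partial>half_line)"
  proof (rule integral_dominated_convergence[where w = "\<lambda>x. \<bar>energy_density x\<bar>"])
    show "AE x in half_line. (\<lambda>n. indicator {..<1 / real (Suc n)} x * energy_density x) \<longlonglongrightarrow> 0"
      using AE_half_line_pos
    proof eventually_elim
      case (elim x)
      have "\<forall>\<^sub>F n in sequentially. 1 / real (Suc n) < x"
        using LIMSEQ_inverse_real_of_nat elim by (auto simp: inverse_eq_divide intro: order_tendstoD)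
      then have "\<forall>\<^sub>F n in sequentially. indicator {..<1 / real (Suc n)} x * energy_density x = 0"
        by eventually_elim auto
      then show ?case by (rule tendsto_eventually)
    qed
    show "AE x in half_line. norm (indicator {..<1 / real (Suc n)} x * energy_density x) \<le> \<bar>energy_density x\<bar>" for n
      by (auto simp: indicator_def)
  qed (use energy_density_integrable in \<open>auto intro!: borel_measurable_integrable[OF integrable_half_line_indicator] \<close>)
  then show ?thesis by (simp add: energy_below_def)
qed

lemma energy_above_tendsto: "(\<lambda>n. energy_above (real (Suc n))) \<longlonglongrightarrow> 0"
proof -
  have "(\<lambda>n. \<integral>x. indicator {real (Suc n)<..} x * energy_density x \<partial>half_line) \<longlonglongrightarrow> (\<integral>x. 0 \<partial>half_line)"
  proof (rule integral_dominated_convergence[where w = "\<lambda>x. \<bar>energy_density x\<bar>"])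
    show "AE x in half_line. (\<lambda>n. indicator {real (Suc n)<..} x * energy_density x) \<longlonglongrightarrow> 0"
    proof (rule AE_I2)
      fix x :: real
      obtain N :: nat where "x < real N" using reals_Archimedean2 by blast
      then have "\<forall>\<^sub>F n in sequentially. indicator {real (Suc n)<..} x * energy_density x = 0"
        unfolding eventually_sequentially by (intro exI[of _ N]) auto
      then show "(\<lambda>n. indicator {real (Suc n)<..} x * energy_density x) \<longlonglongrightarrow> 0" by (rule tendsto_eventually)
    qed
    show "AE x in half_line. norm (indicator {real (Suc n)<..} x * energy_density x) \<le> \<bar>energy_density x\<bar>" for n
      by (auto simp: indicator_def)
  qed (use energy_density_integrable in \<open>auto intro!: borel_measurable_integrable[OF integrable_half_line_indicator]\<close>)
  then show ?thesis by (simp add: energy_above_def)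
qed

text \<open>The square below is completed along the extremal \<open>M y = y * exp (- (\<mu> * y))\<close>; the rest is the
  derivative of this function.\<close>

definition E :: "real \<Rightarrow> real" where
  "E y = (2 * \<mu> - \<mu>\<^sup>2 * y + 1 / y) * (M y)\<^sup>2 * exp (\<mu> * y) - 4 * \<mu> * (M y * W y)"

text \<open>The cross term of the square is \<open>(M^2)'\<close> times
  \<open>(\<mu>^2 * y - 1 / y) * exp (\<mu> * y)\<close>; this fixes the coefficients
  \<open>- \<mu>^2 * y\<close> and \<open>1 / y\<close> in \<open>E\<close>. The coefficient
  \<open>2 * \<mu>\<close> absorbs \<open>M * H * exp (\<mu> * y)\<close>, which arises from
  differentiating \<open>M * W\<close>. The multiples of \<open>M^2\<close> left over then agree on
  both sides.\<close>

lemma DERIV_E: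
  assumes y: "0 < y"
  shows "(E has_real_derivative energy_density y - 4 * \<mu> * (H y * W y)
    - (1 + \<mu> * y) * exp (\<mu> * y) * (H y + \<mu> * M y - M y / y)\<^sup>2) (at y)"
proof -
  have "(E has_real_derivative
      ((- \<mu>\<^sup>2 - 1 / y\<^sup>2) * (M y)\<^sup>2 + (2 * \<mu> - \<mu>\<^sup>2 * y + 1 / y) * (2 * M y * H y)) * exp (\<mu> * y)
      + (2 * \<mu> - \<mu>\<^sup>2 * y + 1 / y) * (M y)\<^sup>2 * (\<mu> * exp (\<mu> * y))
      - 4 * \<mu> * (H y * W y + M y * (H y * exp (\<mu> * y)))) (at y)"
    unfolding E_def[abs_def] using y
    by (auto intro!: derivative_eq_intros DERIV_M DERIV_W simp: power2_eq_square field_simps)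
  moreover have "((- \<mu>\<^sup>2 - 1 / y\<^sup>2) * (M y)\<^sup>2 + (2 * \<mu> - \<mu>\<^sup>2 * y + 1 / y) * (2 * M y * H y)) * exp (\<mu> * y)
      + (2 * \<mu> - \<mu>\<^sup>2 * y + 1 / y) * (M y)\<^sup>2 * (\<mu> * exp (\<mu> * y))
      - 4 * \<mu> * (H y * W y + M y * (H y * exp (\<mu> * y)))
    = energy_density y - 4 * \<mu> * (H y * W y) - (1 + \<mu> * y) * exp (\<mu> * y) * (H y + \<mu> * M y - M y / y)\<^sup>2"
    using y unfolding energy_density_def by (simp add: field_simps power2_eq_square)
  ultimately show ?thesis by simp
qed

text \<open>The mixed term is written as a root of squares so that the bounds for \<open>M^2\<close>
  and \<open>W^2\<close> can be inserted by monotonicity.\<close>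

lemma E_bound: 
  assumes y: "0 < y"
  shows "\<bar>E y\<bar> \<le> (2 * \<mu> + \<mu>\<^sup>2 * y + 1 / y) * (M y)\<^sup>2 * exp (\<mu> * y) + 4 * \<mu> * sqrt ((M y)\<^sup>2 * (W y)\<^sup>2)"
proof -
  have "\<bar>2 * \<mu> - \<mu>\<^sup>2 * y + 1 / y\<bar> \<le> 2 * \<mu> + \<mu>\<^sup>2 * y + 1 / y"
    using y mu by (simp add: abs_le_iff)
  then have "\<bar>2 * \<mu> - \<mu>\<^sup>2 * y + 1 / y\<bar> * ((M y)\<^sup>2 * exp (\<mu> * y)) \<le> (2 * \<mu> + \<mu>\<^sup>2 * y + 1 / y) * ((M y)\<^sup>2 * exp (\<mu> * y))"
    by (intro mult_right_mono) auto
  moreover have "\<bar>E y\<bar> \<le> \<bar>2 * \<mu> - \<mu>\<^sup>2 * y + 1 / y\<bar> * ((M y)\<^sup>2 * exp (\<mu> * y)) + 4 * \<mu> * \<bar>M y * W y\<bar>"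
    unfolding E_def using mu by (intro order_trans[OF abs_triangle_ineq4]) (simp add: abs_mult mult.assoc)
  moreover have "sqrt ((M y)\<^sup>2 * (W y)\<^sup>2) = \<bar>M y * W y\<bar>"
    by (simp flip: power_mult_distrib)
  ultimately show ?thesis by (simp add: mult.assoc)
qed

lemma E_tendsto_0: "(\<lambda>n. E (1 / real (Suc n))) \<longlonglongrightarrow> 0"
proof (rule Lim_null_comparison)
  let ?y = "\<lambda>n. 1 / real (Suc n)"
  have y0: "?y \<longlonglongrightarrow> 0" using LIMSEQ_inverse_real_of_nat by (simp add: inverse_eq_divide)
  show "(\<lambda>n. (2 * \<mu> * ?y n + \<mu>\<^sup>2 * (?y n)\<^sup>2 + 1) * energy_below (?y n) * exp (\<mu> * ?y n)
      + 4 * \<mu> * sqrt (energy_below (?y n) * ?y n * (total_energy * ((exp (\<mu> * ?y n) - 1) / \<mu>)))) \<longlonglongrightarrow> 0"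
  proof -
    have "(\<lambda>n. (2 * \<mu> * ?y n + \<mu>\<^sup>2 * (?y n)\<^sup>2 + 1) * energy_below (?y n) * exp (\<mu> * ?y n)
      + 4 * \<mu> * sqrt (energy_below (?y n) * ?y n * (total_energy * ((exp (\<mu> * ?y n) - 1) / \<mu>))))
      \<longlonglongrightarrow> (2 * \<mu> * 0 + \<mu>\<^sup>2 * 0\<^sup>2 + 1) * 0 * exp (\<mu> * 0) + 4 * \<mu> * sqrt (0 * 0 * (total_energy * ((exp (\<mu> * 0) - 1) / \<mu>)))"
      using mu by (intro tendsto_intros y0 energy_below_tendsto) auto
    then show ?thesis by simp
  qed
  show "\<forall>\<^sub>F n in sequentially. norm (E (?y n)) \<le> (2 * \<mu> * ?y n + \<mu>\<^sup>2 * (?y n)\<^sup>2 + 1) * energy_below (?y n) * exp (\<mu> * ?y n)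
      + 4 * \<mu> * sqrt (energy_below (?y n) * ?y n * (total_energy * ((exp (\<mu> * ?y n) - 1) / \<mu>)))"
  proof (intro always_eventually allI)
    fix n
    define y where "y = ?y n"
    have y: "0 < y" by (simp add: y_def)
    have "\<bar>E y\<bar> \<le> (2 * \<mu> + \<mu>\<^sup>2 * y + 1 / y) * (M y)\<^sup>2 * exp (\<mu> * y) + 4 * \<mu> * sqrt ((M y)\<^sup>2 * (W y)\<^sup>2)"
      by (rule E_bound[OF y])
    also have "\<dots> \<le> (2 * \<mu> + \<mu>\<^sup>2 * y + 1 / y) * (energy_below y * y) * exp (\<mu> * y)
        + 4 * \<mu> * sqrt (energy_below y * y * (total_energy * ((exp (\<mu> * y) - 1) / \<mu>)))"
      using y mu energy_nonneg
      by (intro add_mono mult_right_mono mult_left_mono real_sqrt_le_mono mult_mono M_square_le_near_0 W_square_le) auto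
    \<comment> \<open>The factor \<open>y\<close> in the bound for \<open>M^2\<close> removes the
      singular coefficient \<open>1 / y\<close>.\<close>
    also have "(2 * \<mu> + \<mu>\<^sup>2 * y + 1 / y) * (energy_below y * y) = (2 * \<mu> * y + \<mu>\<^sup>2 * y\<^sup>2 + 1) * energy_below y"
      using y by (simp add: field_simps power2_eq_square)
    finally show "norm (E (?y n)) \<le> (2 * \<mu> * ?y n + \<mu>\<^sup>2 * (?y n)\<^sup>2 + 1) * energy_below (?y n) * exp (\<mu> * ?y n)
      + 4 * \<mu> * sqrt (energy_below (?y n) * ?y n * (total_energy * ((exp (\<mu> * ?y n) - 1) / \<mu>)))"
      unfolding y_def real_norm_def .
  qed
qed

lemma E_tendsto_infinity:
  assumes mean: "integral\<^sup>L half_line H = 0"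
  shows "(\<lambda>n. E (real (Suc n))) \<longlonglongrightarrow> 0"
proof (rule Lim_null_comparison)
  \<comment> \<open>For \<open>y \<ge> 1\<close> the coefficient of \<open>M^2\<close> is at most
    \<open>(2 * \<mu> + \<mu>^2 + 1) * y\<close>, and
    \<open>y \<le> (1 + \<mu> * y) * (1 + 1 / \<mu>)\<close>; dividing by
    \<open>\<mu> * (1 + \<mu> * y)\<close> from the bound for \<open>M^2\<close> leaves this
    constant.\<close>
  let ?C = "(2 * \<mu> + \<mu>\<^sup>2 + 1) / \<mu> * (1 + 1 / \<mu>)"
  show "(\<lambda>n. ?C * energy_above (real (Suc n)) + 4 * \<mu> * sqrt (energy_above (real (Suc n)) * (total_energy / \<mu>\<^sup>2))) \<longlonglongrightarrow> 0"
  proof -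
    have "(\<lambda>n. ?C * energy_above (real (Suc n)) + 4 * \<mu> * sqrt (energy_above (real (Suc n)) * (total_energy / \<mu>\<^sup>2)))
        \<longlonglongrightarrow> ?C * 0 + 4 * \<mu> * sqrt (0 * (total_energy / \<mu>\<^sup>2))"
      by (intro tendsto_intros energy_above_tendsto)
    then show ?thesis by simp
  qed
  show "\<forall>\<^sub>F n in sequentially. norm (E (real (Suc n))) \<le> ?C * energy_above (real (Suc n)) + 4 * \<mu> * sqrt (energy_above (real (Suc n)) * (total_energy / \<mu>\<^sup>2))"
  proof (intro always_eventually allI)
    fix n
    define y where "y = real (Suc n)"
    have y: "0 < y" "1 \<le> y" by (simp_all add: y_def)
    let ?e = "exp (- (\<mu> * y)) / (\<mu> * (1 + \<mu> * y))"
    have e: "?e * exp (\<mu> * y) = 1 / (\<mu> * (1 + \<mu> * y))"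
      by (simp add: exp_minus)
    have pos: "0 < 1 + \<mu> * y" using y mu by (simp add: add_pos_pos)
    have "\<bar>E y\<bar> \<le> (2 * \<mu> + \<mu>\<^sup>2 * y + 1 / y) * (M y)\<^sup>2 * exp (\<mu> * y) + 4 * \<mu> * sqrt ((M y)\<^sup>2 * (W y)\<^sup>2)"
      by (rule E_bound[OF y(1)])
    also have "(2 * \<mu> + \<mu>\<^sup>2 * y + 1 / y) * (M y)\<^sup>2 * exp (\<mu> * y) \<le> ?C * energy_above y"
    proof -
      have "2 * \<mu> + \<mu>\<^sup>2 * y + 1 / y \<le> 2 * \<mu> * y + \<mu>\<^sup>2 * y + 1 * y"
      proof (intro add_mono)
        show "1 / y \<le> 1 * y" using y mult_mono[of 1 y 1 y] by (simp add: divide_le_eq)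
        show "2 * \<mu> \<le> 2 * \<mu> * y" using y mu by simp
      qed simp
      also have "\<dots> = (2 * \<mu> + \<mu>\<^sup>2 + 1) * y" by (simp add: algebra_simps)
      also have "\<dots> \<le> (2 * \<mu> + \<mu>\<^sup>2 + 1) * ((1 + \<mu> * y) * (1 + 1 / \<mu>))"
      proof (intro mult_left_mono)
        have "(1 + \<mu> * y) * (1 + 1 / \<mu>) = y + (1 + \<mu> * y + 1 / \<mu>)" using mu by (simp add: field_simps)
        then show "y \<le> (1 + \<mu> * y) * (1 + 1 / \<mu>)" using mu y by simp
      qed (use mu in simp)
      finally have a: "2 * \<mu> + \<mu>\<^sup>2 * y + 1 / y \<le> (2 * \<mu> + \<mu>\<^sup>2 + 1) * ((1 + \<mu> * y) * (1 + 1 / \<mu>))" .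
      have "(M y)\<^sup>2 * exp (\<mu> * y) \<le> energy_above y * ?e * exp (\<mu> * y)"
        by (intro mult_right_mono M_square_le_near_infinity y mean) simp
      also have "\<dots> = energy_above y / (\<mu> * (1 + \<mu> * y))"
        unfolding mult.assoc e by simp
      finally have b: "(M y)\<^sup>2 * exp (\<mu> * y) \<le> energy_above y / (\<mu> * (1 + \<mu> * y))" .
      have "(2 * \<mu> + \<mu>\<^sup>2 * y + 1 / y) * ((M y)\<^sup>2 * exp (\<mu> * y))
          \<le> (2 * \<mu> + \<mu>\<^sup>2 + 1) * ((1 + \<mu> * y) * (1 + 1 / \<mu>)) * (energy_above y / (\<mu> * (1 + \<mu> * y)))"
        using y mu by (intro mult_mono a b) auto
      also have "\<dots> = ?C * energy_above y"
      proof -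
        have "A * (D * B) * (u / (\<mu> * D)) = A / \<mu> * B * u" if "D \<noteq> 0" for A B D u
          using that by simp
        from this[of "1 + \<mu> * y"] show ?thesis using pos by simp
      qed
      finally show ?thesis by (simp add: mult.assoc)
    qed
    also have "(M y)\<^sup>2 * (W y)\<^sup>2 \<le> energy_above y * (total_energy / \<mu>\<^sup>2)"
    proof -
      have "(W y)\<^sup>2 \<le> total_energy * (exp (\<mu> * y) / \<mu>)"
        using mu energy_nonneg by (intro order_trans[OF W_square_le[OF y(1)]] mult_left_mono divide_right_mono) auto
      then have "(M y)\<^sup>2 * (W y)\<^sup>2 \<le> energy_above y * ?e * (total_energy * (exp (\<mu> * y) / \<mu>))"
        using pos mu energy_nonneg by (intro mult_mono M_square_le_near_infinity y mean) auto
      \<comment> \<open>The decay \<open>exp (- (\<mu> * y))\<close> of \<open>M^2\<close> just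
        balances the growth \<open>exp (\<mu> * y)\<close> of \<open>W^2\<close>; convergence to 0
        comes from \<open>energy_above\<close>.\<close>
      also have "\<dots> = energy_above y * (total_energy / \<mu>\<^sup>2) * (1 / (1 + \<mu> * y))"
      proof -
        have "energy_above y * ?e * (total_energy * (exp (\<mu> * y) / \<mu>)) = energy_above y * (total_energy / \<mu>) * (?e * exp (\<mu> * y))" by (simp add: mult_ac)
        then show ?thesis unfolding e by (simp add: power2_eq_square)
      qed
      also have "\<dots> \<le> energy_above y * (total_energy / \<mu>\<^sup>2) * 1"
        using pos mu y energy_nonneg by (intro mult_left_mono) (auto simp: divide_le_eq)
      finally show ?thesis by simp
    qed
    finally show "norm (E (real (Suc n))) \<le> ?C * energy_above (real (Suc n)) + 4 * \<mu> * sqrt (energy_above (real (Suc n)) * (total_energy / \<mu>\<^sup>2))"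
      using mu unfolding y_def real_norm_def by simp
  qed
qed

theorem convolution_energy_inequality:
  assumes mean: "integral\<^sup>L half_line H = 0"
  shows "4 * \<mu> * (\<integral>y. H y * W y \<partial>half_line) \<le> (\<integral>y. (H y)\<^sup>2 * ((1 + \<mu> * y) * exp (\<mu> * y)) \<partial>half_line)"
proof -
  define f where "f y = energy_density y - 4 * \<mu> * (H y * W y)" for y
  have f: "integrable half_line f"
    unfolding f_def[abs_def] using energy_density_integrable HW_integrable by simp
  let ?a = "\<lambda>n. 1 / real (Suc n)" and ?b = "\<lambda>n. real (Suc n)"
  have "E (?b n) - E (?a n) \<le> (\<integral>y. indicator {?a n..?b n} y * f y \<partial>half_line)" for n
  proof -
    let ?D = "\<lambda>y. f y - (1 + \<mu> * y) * exp (\<mu> * y) * (H y + \<mu> * M y - M y / y)\<^sup>2"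
    have a: "0 < ?a n" and ab: "?a n \<le> ?b n" by (simp_all add: divide_le_eq order_trans[of 1 "1 + real n"] mult_mono[of 1 _ 1, simplified])
    have "{s..t} \<subseteq> {0<..}" if "0 < s" for s t :: real using that by auto
    from this[OF a] have sub: "{?a n..?b n} \<subseteq> {0<..}" .
    have contf: "continuous_on {0<..} f"
      unfolding f_def[abs_def] energy_density_def[abs_def]
      by (intro continuous_intros H_continuous_on W_continuous_on)
    have contD: "continuous_on {?a n..?b n} ?D"
      by (rule continuous_on_subset[OF _ sub])
        (auto intro!: continuous_intros contf H_continuous_on M_continuous_on)
    have "E (?b n) - E (?a n) = (\<integral>y. indicator {?a n..?b n} y *\<^sub>R ?D y \<partial>lborel)"
      using a by (intro integral_FTC_atLeastAtMost[symmetric] ab contD)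
        (auto simp: f_def has_real_derivative_iff_has_vector_derivative[symmetric]
          intro!: has_field_derivative_at_within[OF DERIV_E[OF less_le_trans[OF a]]])
    also have "\<dots> = (\<integral>y. indicator {?a n..?b n} y * ?D y \<partial>half_line)"
      using set_integral_subset_half_line(1)[OF sub, of ?D] by (simp add: set_lebesgue_integral_def)
    also have "\<dots> \<le> (\<integral>y. indicator {?a n..?b n} y * f y \<partial>half_line)"
    proof (rule integral_mono_AE)
      show "integrable half_line (\<lambda>y. indicator {?a n..?b n} y * ?D y)"
        using borel_integrable_atLeastAtMost'[OF contD] by (simp only: set_integral_subset_half_line(2)[OF sub])
      show "integrable half_line (\<lambda>y. indicator {?a n..?b n} y * f y)"
        by (intro integrable_half_line_indicator f) simp
      show "AE y in half_line. indicator {?a n..?b n} y * ?D y \<le> indicator {?a n..?b n} y * f y"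
        using AE_half_line_pos by eventually_elim (use mu in \<open>auto intro!: mult_left_mono\<close>)
    qed
    finally show ?thesis .
  qed
  moreover have "(\<lambda>n. E (?b n) - E (?a n)) \<longlonglongrightarrow> 0 - 0"
    by (intro tendsto_diff E_tendsto_0 E_tendsto_infinity mean)
  moreover have "(\<lambda>n. \<integral>y. indicator {?a n..?b n} y * f y \<partial>half_line) \<longlonglongrightarrow> integral\<^sup>L half_line f"
  proof (rule integral_dominated_convergence[where w = "\<lambda>y. \<bar>f y\<bar>"])
    show "AE y in half_line. (\<lambda>n. indicator {?a n..?b n} y * f y) \<longlonglongrightarrow> f y"
      using AE_half_line_pos
    proof eventually_elim
      case (elim y)
      obtain N :: nat where N: "y < real N" using reals_Archimedean2 by blast
      have "\<forall>\<^sub>F n in sequentially. ?a n < y"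
        using LIMSEQ_inverse_real_of_nat elim by (auto simp: inverse_eq_divide intro: order_tendstoD)
      moreover have "\<forall>\<^sub>F n in sequentially. y < ?b n"
        unfolding eventually_sequentially using N by (intro exI[of _ N]) auto
      ultimately have "\<forall>\<^sub>F n in sequentially. indicator {?a n..?b n} y * f y = f y"
        by eventually_elim auto
      then show ?case by (rule tendsto_eventually)
    qed
    show "AE y in half_line. norm (indicator {?a n..?b n} y * f y) \<le> \<bar>f y\<bar>" for n
      by (auto simp: indicator_def)
  qed (use f in \<open>auto intro!: borel_measurable_integrable[OF integrable_half_line_indicator]\<close>)
  ultimately have "0 - 0 \<le> integral\<^sup>L half_line f"
    by (intro LIMSEQ_le) auto
  then show ?thesis
    using energy_density_integrable HW_integrable by (simp add: f_def[abs_def] energy_density_def[abs_def])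
qed

end

section \<open>The spaces of distributions and the operator\<close>

text \<open>The sign is that of \<open>primitive\<close>: the tail integral of \<open>h\<close>, and
  not its negative, represents \<open>h\<close>. Computations with elements of the space are made on
  such representatives.\<close>

definition neg_deriv :: "(real \<Rightarrow> real) \<Rightarrow> dist" where
  "neg_deriv F = (\<lambda>\<phi>. - dist_deriv (dist_of F) \<phi>)"

lemma dist_of_half_line: "dist_of F \<phi> = (if test_fun \<phi> then (\<integral>y. F y * \<phi> y \<partial>half_line) else 0)"
  by (simp add: dist_of_def set_integral_half_line)

lemma neg_deriv_eq: "neg_deriv F \<phi> = (if test_fun \<phi> then (\<integral>y. F y * deriv \<phi> y \<partial>half_line) else 0)"
  by (simp add: neg_deriv_def dist_deriv_def dist_of_half_line test_fun_deriv)

lemma integrable_mult_test_fun: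
  assumes F: "integrable half_line F" and \<phi>: "test_fun \<phi>"
  shows "integrable half_line (\<lambda>y. F y * \<phi> y)"
proof -
  obtain B where B: "0 \<le> B" "\<And>x. \<bar>\<phi> x\<bar> \<le> B" using test_fun_bounded[OF \<phi>] by blast
  have [measurable]: "F \<in> borel_measurable half_line" by (rule borel_measurable_integrable[OF F])
  have [measurable]: "\<phi> \<in> borel_measurable half_line" by (rule borel_imp_half_line[OF test_fun_borel[OF \<phi>]])
  show ?thesis
  proof (rule Bochner_Integration.integrable_bound)
    show "integrable half_line (\<lambda>y. B * F y)" using F by simp
    show "AE y in half_line. norm (F y * \<phi> y) \<le> norm (B * F y)"
      using B by (auto simp: abs_mult mult.commute[of B] intro!: mult_left_mono)
  qed measurable
qed

lemma neg_deriv_lin: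
  assumes F: "integrable half_line F" and G: "integrable half_line G"
  shows "neg_deriv (\<lambda>y. a * F y + b * G y) = (\<lambda>\<phi>. a * neg_deriv F \<phi> + b * neg_deriv G \<phi>)"
proof
  fix \<phi>
  show "neg_deriv (\<lambda>y. a * F y + b * G y) \<phi> = a * neg_deriv F \<phi> + b * neg_deriv G \<phi>"
  proof (cases "test_fun \<phi>")
    case True
    have "(\<lambda>y. (a * F y + b * G y) * deriv \<phi> y) = (\<lambda>y. a * (F y * deriv \<phi> y) + b * (G y * deriv \<phi> y))"
      by (simp add: fun_eq_iff algebra_simps)
    then show ?thesis
      using True integrable_mult_test_fun[OF F test_fun_deriv[OF True]] integrable_mult_test_fun[OF G test_fun_deriv[OF True]]
      by (simp add: neg_deriv_eq)
  qed (simp add: neg_deriv_eq)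
qed

lemma neg_deriv_inject_AE:
  assumes F: "integrable half_line F" and G: "integrable half_line G" and eq: "neg_deriv F = neg_deriv G"
  shows "AE y in half_line. F y = G y"
proof -
  have "AE y in lborel. 0 < y \<longrightarrow> 1 * F y + (- 1) * G y = 0"
  proof (rule AE_eq_0_if_distributional_derivative_0)
    show "set_integrable lborel {0<..} (\<lambda>y. 1 * F y + (- 1) * G y)"
      using F G by (simp add: set_integrable_half_line)
    fix \<phi> assume \<phi>: "test_fun \<phi>"
    have "neg_deriv (\<lambda>y. 1 * F y + (- 1) * G y) \<phi> = 0"
      unfolding neg_deriv_lin[OF F G] eq by simp
    then show "(LBINT y:{0<..}. (1 * F y + (- 1) * G y) * deriv \<phi> y) = 0"
      using \<phi> by (simp only: neg_deriv_eq set_integral_half_line if_True)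
  qed
  then show ?thesis unfolding AE_half_line by eventually_elim simp
qed

text \<open>The chosen primitive and \<open>F\<close> have the same distributional derivative and
  are integrable, so they agree almost everywhere. That is all the scalar product sees of the
  choice.\<close>

lemma primitive_neg_deriv:
  assumes mu: "0 < \<mu>" and F: "F \<in> L2_exp \<mu>"
  shows "primitive \<mu> (neg_deriv F) \<in> L2_exp \<mu>" "AE y in half_line. primitive \<mu> (neg_deriv F) y = F y"
proof -
  have "primitive \<mu> (neg_deriv F) \<in> L2_exp \<mu> \<and> neg_deriv F = (\<lambda>\<phi>. - dist_deriv (dist_of (primitive \<mu> (neg_deriv F))) \<phi>)"
    unfolding primitive_def by (rule someI[of _ F]) (use F in \<open>simp add: neg_deriv_def\<close>)
  then have *: "primitive \<mu> (neg_deriv F) \<in> L2_exp \<mu>" "neg_deriv (primitive \<mu> (neg_deriv F)) = neg_deriv F"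
    by (auto simp: neg_deriv_def)
  then show "primitive \<mu> (neg_deriv F) \<in> L2_exp \<mu>" by simp
  show "AE y in half_line. primitive \<mu> (neg_deriv F) y = F y"
    using * F mu by (intro neg_deriv_inject_AE L2_exp_integrable) auto
qed

lemma inner_minus1_neg_deriv:
  assumes mu: "0 < \<mu>" and F: "F \<in> L2_exp \<mu>" and G: "G \<in> L2_exp \<mu>"
  shows "inner_minus1 \<mu> (neg_deriv F) (neg_deriv G) = ip_exp \<mu> F G"
proof -
  note p = primitive_neg_deriv[OF mu F] and q = primitive_neg_deriv[OF mu G]
  note [measurable] = L2_exp_measurable[OF p(1)] L2_exp_measurable[OF q(1)] L2_exp_measurable[OF F] L2_exp_measurable[OF G]
  show ?thesis
    unfolding inner_minus1_def set_integral_half_line ip_exp_def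
  proof (rule integral_cong_AE)
    show "AE y in half_line. primitive \<mu> (neg_deriv F) y * primitive \<mu> (neg_deriv G) y * exp (\<mu> * y) = F y * G y * exp (\<mu> * y)"
      using p(2) q(2) by eventually_elim simp
  qed measurable
qed

lemma X_minus1_eq: "X_minus1 \<mu> = neg_deriv ` {F \<in> L2_exp \<mu>. integral\<^sup>L half_line F = 0}"
proof -
  \<comment> \<open>The space is defined without the minus sign; replacing \<open>F\<close> by
    \<open>- F\<close> preserves both of its conditions.\<close>
  have neg: "dist_deriv (dist_of F) = neg_deriv (\<lambda>y. - F y)" for F
    by (simp add: fun_eq_iff neg_deriv_eq dist_deriv_def dist_of_half_line test_fun_deriv)
  have L2: "(\<lambda>y. - F y) \<in> L2_exp \<mu>" if "F \<in> L2_exp \<mu>" for F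
    using L2_exp_scale[OF that, of "- 1"] by simp
  show ?thesis
  proof (intro set_eqI iffI)
    fix T assume "T \<in> X_minus1 \<mu>"
    then obtain F where F: "T = dist_deriv (dist_of F)" "F \<in> L2_exp \<mu>" "(LBINT y:{0<..}. F y) = 0"
      unfolding X_minus1_def by blast
    then show "T \<in> neg_deriv ` {F \<in> L2_exp \<mu>. integral\<^sup>L half_line F = 0}"
      by (intro image_eqI[of _ _ "\<lambda>y. - F y"]) (auto simp: neg L2 set_integral_half_line)
  next
    fix T assume "T \<in> neg_deriv ` {F \<in> L2_exp \<mu>. integral\<^sup>L half_line F = 0}"
    then obtain F where F: "T = neg_deriv F" "F \<in> L2_exp \<mu>" "integral\<^sup>L half_line F = 0" by blast
    then have "T = dist_deriv (dist_of (\<lambda>y. - F y))" by (simp add: neg)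
    then show "T \<in> X_minus1 \<mu>"
      unfolding X_minus1_def using F L2[of F] by (auto simp: set_integral_half_line intro!: exI[of _ "\<lambda>y. - F y"])
  qed
qed

lemma semi_inner_space_X_minus1:
  assumes mu: "0 < \<mu>"
  shows "semi_inner_space (X_minus1 \<mu>) (inner_minus1 \<mu>)"
proof -
  interpret L2: semi_inner_space "L2_exp \<mu>" "ip_exp \<mu>" by (rule semi_inner_space_L2_exp)
  note ip = inner_minus1_neg_deriv[OF mu]
  have lin: "(\<lambda>\<phi>. a * neg_deriv F \<phi> + b * neg_deriv G \<phi>) = neg_deriv (\<lambda>y. a * F y + b * G y)"
    if "F \<in> L2_exp \<mu>" "G \<in> L2_exp \<mu>" for a b F G
    using that mu by (simp add: neg_deriv_lin L2_exp_integrable)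
  show ?thesis
  proof
    fix T U a b assume "T \<in> X_minus1 \<mu>" "U \<in> X_minus1 \<mu>"
    then obtain F G where FG: "T = neg_deriv F" "U = neg_deriv G" "F \<in> L2_exp \<mu>" "G \<in> L2_exp \<mu>"
      "integral\<^sup>L half_line F = 0" "integral\<^sup>L half_line G = 0"
      unfolding X_minus1_eq by blast
    then show "(\<lambda>x. a * T x + b * U x) \<in> X_minus1 \<mu>"
      unfolding X_minus1_eq using mu
      by (auto simp: lin L2.lin_closed L2_exp_integrable intro!: imageI)
    show "inner_minus1 \<mu> T U = inner_minus1 \<mu> U T"
      using FG by (simp add: ip L2.ip_commute)
    show "0 \<le> inner_minus1 \<mu> T T"
      using FG by (simp add: ip L2.ip_nonneg)
    fix Z assume "Z \<in> X_minus1 \<mu>"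
    then obtain K where K: "Z = neg_deriv K" "K \<in> L2_exp \<mu>" unfolding X_minus1_eq by blast
    show "inner_minus1 \<mu> (\<lambda>x. a * T x + b * U x) Z = a * inner_minus1 \<mu> T Z + b * inner_minus1 \<mu> U Z"
      using FG K by (simp add: lin ip L2.lin_closed L2.ip_lin_left)
  qed
qed

lemma nrm_inner_minus1: "0 < \<mu> \<Longrightarrow> semi_inner_space.nrm (inner_minus1 \<mu>) = norm_minus1 \<mu>"
  by (simp add: fun_eq_iff norm_minus1_def semi_inner_space.nrm_def[OF semi_inner_space_X_minus1])

lemma norm_minus1_neg_deriv:
  "0 < \<mu> \<Longrightarrow> F \<in> L2_exp \<mu> \<Longrightarrow> norm_minus1 \<mu> (neg_deriv F) = semi_inner_space.nrm (ip_exp \<mu>) F"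
  by (simp add: norm_minus1_def inner_minus1_neg_deriv semi_inner_space.nrm_def[OF semi_inner_space_L2_exp])

lemma X_zero_iff:
  assumes mu: "0 < \<mu>"
  shows "h \<in> X_zero \<mu> \<longleftrightarrow> weighted_tail \<mu> h \<and> integral\<^sup>L half_line (tail_integral h) = 0"
proof (cases "weighted_tail \<mu> h")
  case True
  then interpret weighted_tail \<mu> h .
  show ?thesis using True h_measurable yh
    by (simp add: X_zero_def set_borel_measurable_half_line set_integral_half_line integral_H)
next
  case False
  then show ?thesis
    using mu by (auto simp: X_zero_def set_borel_measurable_half_line weighted_tail_def)
qed

section \<open>The operator as a distributional derivative\<close>

context weighted_tail
begin

lemma dist_of_eq_neg_deriv_H: "dist_of h = neg_deriv H"
  by (simp add: fun_eq_iff dist_of_half_line neg_deriv_eq integral_H_deriv_test_fun(1))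

lemma DERIV_V: "0 < y \<Longrightarrow> (V has_real_derivative H y - \<mu> * V y) (at y)"
  unfolding V_def[abs_def]
  by (auto intro!: derivative_eq_intros DERIV_W simp: exp_minus field_simps)

lemma V_integrable: "integrable half_line V"
  by (rule L2_exp_integrable[OF V_L2_exp mu])

text \<open>The weak form of \<open>V' = H - \<mu> * V\<close>, an equation that holds classically
  because \<open>H\<close> is continuous on the open half-line.\<close>

lemma integral_V_deriv_test_fun:
  assumes \<phi>: "test_fun \<phi>"
  shows "(\<integral>y. V y * deriv \<phi> y \<partial>half_line) = \<mu> * (\<integral>y. V y * \<phi> y \<partial>half_line) - (\<integral>y. H y * \<phi> y \<partial>half_line)"
proof -
  obtain a b where ab: "0 < a" "a < b" "\<And>x. x \<notin> {a..b} \<Longrightarrow> \<phi> x = 0"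
    using test_fun_support[OF \<phi>] by blast
  \<comment> \<open>The interval from \<open>s\<close> to \<open>t\<close> strictly contains the
    support of \<open>\<phi>\<close>, so the boundary values vanish.\<close>
  define s where "s = a / 2"
  define t where "t = b + 1"
  have st: "0 < s" "s < a" "b < t" "s \<le> t" using ab by (auto simp: s_def t_def)
  have sub: "{s..t} \<subseteq> {0<..}" using st by auto
  note d0 = deriv_eq_0_outside_support[of a b \<phi>, OF ab(3)]
  let ?D = "\<lambda>y. V y * deriv \<phi> y + (H y - \<mu> * V y) * \<phi> y"
  have cont: "continuous_on {s..t} ?D"
    by (intro continuous_intros continuous_on_subset[OF V_continuous_on sub] continuous_on_subset[OF H_continuous_on sub]
        test_fun_continuous_on \<phi> test_fun_deriv)
  have D: "((\<lambda>y. V y * \<phi> y) has_real_derivative ?D y) (at y)" if "0 < y" for y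
    using DERIV_mult[OF DERIV_V[OF that] test_fun_DERIV[OF \<phi>]] by (simp add: algebra_simps)
  have "(\<integral>y. indicator {s..t} y *\<^sub>R ?D y \<partial>lborel) = V t * \<phi> t - V s * \<phi> s"
    using st by (intro integral_FTC_atLeastAtMost cont)
      (auto simp: has_real_derivative_iff_has_vector_derivative[symmetric] intro!: has_field_derivative_at_within[OF D])
  also have "\<dots> = 0" using ab(3)[of s] ab(3)[of t] st by simp
  also have "(\<integral>y. indicator {s..t} y *\<^sub>R ?D y \<partial>lborel) = (\<integral>y. indicator {s..t} y * ?D y \<partial>half_line)"
    using set_integral_subset_half_line(1)[OF sub, of ?D] by (simp add: set_lebesgue_integral_def)
  also have "\<dots> = (\<integral>y. V y * deriv \<phi> y + (H y * \<phi> y - \<mu> * (V y * \<phi> y)) \<partial>half_line)"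
  proof (rule Bochner_Integration.integral_cong)
    fix y show "indicator {s..t} y * ?D y = V y * deriv \<phi> y + (H y * \<phi> y - \<mu> * (V y * \<phi> y))"
      using ab(3)[of y] d0[of y] st by (cases "y \<in> {a..b}") (auto simp: indicator_def algebra_simps)
  qed simp
  finally show ?thesis
    using integrable_mult_test_fun[OF V_integrable \<phi>] integrable_mult_test_fun[OF H_integrable \<phi>]
      integrable_mult_test_fun[OF V_integrable test_fun_deriv[OF \<phi>]]
    by simp
qed

definition K :: "real \<Rightarrow> real" where
  "K y = (- 1) * (y * h y) + ((- 1) * H y + 2 * \<mu> * V y)"

lemma K_L2_exp: "K \<in> L2_exp \<mu>"
  unfolding K_def[abs_def] 
  by (intro L2_exp_add L2_exp_scale yh H_L2_exp V_L2_exp)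

lemma conv_H_g:
  assumes "\<mu> = 2 / \<rho>" and y: "0 < y"
  shows "conv H (g \<rho>) y = 2 * \<mu> * V y"
proof -
  have int: "set_integrable lborel {0<..<y} (\<lambda>x. H x * exp (\<mu> * x))"
    using W_integrable[OF y] by (simp add: integrable_half_line_Iio)
  have "conv H (g \<rho>) y = (LBINT x:{0..y}. 2 * \<mu> * exp (- (\<mu> * y)) * (H x * exp (\<mu> * x)))"
    unfolding conv_def
  proof (rule set_lebesgue_integral_cong)
    show "\<forall>x. x \<in> {0..y} \<longrightarrow> H x * g \<rho> (y - x) = 2 * \<mu> * exp (- (\<mu> * y)) * (H x * exp (\<mu> * x))"
    proof (intro allI impI)
      fix x
      have "- 2 * (y - x) / \<rho> = - (\<mu> * y) + \<mu> * x" using assms by (simp add: algebra_simps diff_divide_distrib)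
      then have "g \<rho> (y - x) = 2 * \<mu> * (exp (- (\<mu> * y)) * exp (\<mu> * x))"
        unfolding g_def exp_add[symmetric] using assms by simp
      then show "H x * g \<rho> (y - x) = 2 * \<mu> * exp (- (\<mu> * y)) * (H x * exp (\<mu> * x))" by simp
    qed
  qed simp
  also have "\<dots> = 2 * \<mu> * exp (- (\<mu> * y)) * (LBINT x:{0..y}. H x * exp (\<mu> * x))" by simp
  also have "(LBINT x:{0..y}. H x * exp (\<mu> * x)) = W y"
  proof -
    have "(LBINT x:{0..y}. H x * exp (\<mu> * x)) = (LBINT x:{0<..<y}. H x * exp (\<mu> * x))"
      unfolding set_lebesgue_integral_def
    proof (rule integral_cong_AE)
      show "(\<lambda>x. indicator {0<..<y} x *\<^sub>R (H x * exp (\<mu> * x))) \<in> borel_measurable lborel"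
        using int by (auto simp: set_integrable_def)
      \<comment> \<open>Measurability of \<open>H\<close> is known only on the open half-line, so
        the values at the end points of the closed interval in \<open>conv\<close> are split off as
        multiples of indicators of points.\<close>
      have "(\<lambda>x. indicator {0..y} x *\<^sub>R (H x * exp (\<mu> * x)))
          = (\<lambda>x. indicator {0<..<y} x *\<^sub>R (H x * exp (\<mu> * x)) + (indicator {0} x * H 0 + indicator {y} x * (H y * exp (\<mu> * y))))"
        using y by (auto simp: fun_eq_iff indicator_def)
      also have "\<dots> \<in> borel_measurable lborel"
        using int by (intro borel_measurable_add) (auto simp: set_integrable_def)
      finally show "(\<lambda>x. indicator {0..y} x *\<^sub>R (H x * exp (\<mu> * x))) \<in> borel_measurable lborel" .
      show "AE x in lborel. indicator {0..y} x *\<^sub>R (H x * exp (\<mu> * x)) = indicator {0<..<y} x *\<^sub>R (H x * exp (\<mu> * x))"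
        using AE_lborel_singleton[of 0] AE_lborel_singleton[of y] by eventually_elim (auto simp: indicator_def)
    qed
    then show ?thesis by (simp add: W_def integrable_half_line_Iio)
  qed
  finally show ?thesis by (simp add: V_def)
qed

text \<open>In the sense of distributions \<open>y h' = (y h)' - h = (y h)' + H'\<close>, and the
  two remaining terms are \<open>- 2 * \<mu> * H + 2 * \<mu>^2 * V = - (2 * \<mu> * V)'\<close>.
  Together they make up the derivative of \<open>- K\<close>.\<close>

lemma L_eq_neg_deriv_K:
  assumes rho: "\<mu> = 2 / \<rho>"
  shows "L \<rho> h = neg_deriv K"
proof
  fix \<phi>
  show "L \<rho> h \<phi> = neg_deriv K \<phi>"
  proof (cases "test_fun \<phi>")
    case True
    note y\<phi> = test_fun_mult_y[OF True]
    have deriv_y\<phi>: "deriv (\<lambda>y. y * \<phi> y) = (\<lambda>y. \<phi> y + y * deriv \<phi> y)"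
      using DERIV_mult[OF DERIV_ident test_fun_DERIV[OF True]]
      by (auto simp: fun_eq_iff algebra_simps intro!: DERIV_imp_deriv)
    have yh_int: "integrable half_line (\<lambda>y. y * h y)" by (rule L2_exp_integrable[OF yh mu])
    note i = integrable_mult_test_fun[OF yh_int test_fun_deriv[OF True]]
      integrable_mult_test_fun[OF V_integrable test_fun_deriv[OF True]]
      integral_H_deriv_test_fun(2,3)[OF True]
    have 1: "dist_mult_y (dist_deriv (dist_of h)) \<phi> = - (\<integral>y. h y * \<phi> y \<partial>half_line) - (\<integral>y. y * h y * deriv \<phi> y \<partial>half_line)"
    proof -
      have "dist_mult_y (dist_deriv (dist_of h)) \<phi> = - (\<integral>y. h y * (\<phi> y + y * deriv \<phi> y) \<partial>half_line)"
        using True y\<phi> test_fun_deriv[OF y\<phi>]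
        by (simp add: dist_mult_y_def dist_deriv_def dist_of_half_line deriv_y\<phi>)
      also have "(\<lambda>y. h y * (\<phi> y + y * deriv \<phi> y)) = (\<lambda>y. h y * \<phi> y + y * h y * deriv \<phi> y)"
        by (simp add: fun_eq_iff algebra_simps)
      finally show ?thesis using i by simp
    qed
    have 2: "dist_of (conv H (g \<rho>)) \<phi> = 2 * \<mu> * (\<integral>y. V y * \<phi> y \<partial>half_line)"
    proof -
      have "(\<integral>y. conv H (g \<rho>) y * \<phi> y \<partial>half_line) = (\<integral>y. 2 * \<mu> * (V y * \<phi> y) \<partial>half_line)"
        by (rule Bochner_Integration.integral_cong) (auto simp: conv_H_g[OF rho])
      then show ?thesis using True by (simp add: dist_of_half_line)
    qed
    have "neg_deriv K \<phi> = - (\<integral>y. y * h y * deriv \<phi> y \<partial>half_line) - (\<integral>y. H y * deriv \<phi> y \<partial>half_line)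
        + 2 * \<mu> * (\<integral>y. V y * deriv \<phi> y \<partial>half_line)"
    proof -
      have "(\<lambda>y. K y * deriv \<phi> y) = (\<lambda>y. 2 * \<mu> * (V y * deriv \<phi> y) - y * h y * deriv \<phi> y - H y * deriv \<phi> y)"
        by (simp add: fun_eq_iff K_def algebra_simps)
      then show ?thesis using True i by (simp add: neg_deriv_eq)
    qed
    moreover have "L \<rho> h \<phi> = - (\<integral>y. h y * \<phi> y \<partial>half_line) - (\<integral>y. y * h y * deriv \<phi> y \<partial>half_line)
        - 2 * \<mu> * (\<integral>y. H y * \<phi> y \<partial>half_line) + \<mu> * (2 * \<mu> * (\<integral>y. V y * \<phi> y \<partial>half_line))"
      unfolding L_def 1 2 using rho True by (simp add: dist_of_half_line)
    ultimately show ?thesis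
      unfolding integral_V_deriv_test_fun[OF True] integral_H_deriv_test_fun(1)[OF True]
      by (simp add: algebra_simps)
  next
    case False
    then show ?thesis
      by (simp add: L_def neg_deriv_eq dist_mult_y_def dist_of_half_line)
  qed
qed

text \<open>\<open>V * exp (\<mu> * y) = W\<close>. By \<open>energy_identity\<close> the term with
  \<open>y * h\<close> contributes minus half the energy, and the term with \<open>W\<close> is at
  most half the energy, so only \<open>- ip_exp \<mu> H H\<close> remains.\<close>

lemma ip_H_K_le:
  assumes mean: "integral\<^sup>L half_line H = 0"
  shows "ip_exp \<mu> H K \<le> - ip_exp \<mu> H H"
proof -
  have "(\<lambda>y. H y * K y * exp (\<mu> * y)) = (\<lambda>y. 2 * \<mu> * (H y * W y) - y * h y * H y * exp (\<mu> * y) - H y * H y * exp (\<mu> * y))"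
    by (simp add: fun_eq_iff K_def V_def exp_minus algebra_simps)
  then have "ip_exp \<mu> H K = 2 * \<mu> * (\<integral>y. H y * W y \<partial>half_line) - (\<integral>y. y * h y * H y * exp (\<mu> * y) \<partial>half_line) - ip_exp \<mu> H H"
    using HW_integrable L2_exp_mult_integrable[OF yh H_L2_exp] L2_exp_mult_integrable[OF H_L2_exp H_L2_exp]
    by (simp add: ip_exp_def)
  then show ?thesis
    using convolution_energy_inequality[OF mean] energy_identity by simp
qed

end

lemma dissipativity:
  assumes rho: "0 < \<rho>" and h: "h \<in> X_zero (2 / \<rho>)"
  shows "inner_minus1 (2 / \<rho>) (dist_of h) (L \<rho> h) \<le> - (norm_minus1 (2 / \<rho>) (dist_of h))\<^sup>2"
proof -
  have mu: "0 < 2 / \<rho>" using rho by simp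
  have wt: "weighted_tail (2 / \<rho>) h" and mean: "integral\<^sup>L half_line (tail_integral h) = 0"
    using h mu by (simp_all add: X_zero_iff)
  interpret weighted_tail "2 / \<rho>" h by (rule wt)
  have "0 \<le> ip_exp (2 / \<rho>) H H" by (rule semi_inner_space.ip_nonneg[OF semi_inner_space_L2_exp H_L2_exp])
  then show ?thesis
    using ip_H_K_le[OF mean] mu H_L2_exp K_L2_exp
    by (simp add: norm_minus1_def dist_of_eq_neg_deriv_H L_eq_neg_deriv_K inner_minus1_neg_deriv)
qed

section \<open>Approximation in the weighted norm\<close>

lemma nrm_L2_exp_tendsto_0:
  assumes d: "\<And>n. d n \<in> borel_measurable half_line" and w: "w \<in> L2_exp \<mu>"
    and lim: "AE y in half_line. (\<lambda>n. d n y) \<longlonglongrightarrow> 0" and dom: "\<And>n y. 0 < y \<Longrightarrow> \<bar>d n y\<bar> \<le> w y"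
  shows "(\<lambda>n. semi_inner_space.nrm (ip_exp \<mu>) (d n)) \<longlonglongrightarrow> 0"
proof -
  note [measurable] = d
  have "(\<lambda>n. \<integral>y. d n y * d n y * exp (\<mu> * y) \<partial>half_line) \<longlonglongrightarrow> (\<integral>y. 0 \<partial>half_line)"
  proof (rule integral_dominated_convergence[where w = "\<lambda>y. w y * w y * exp (\<mu> * y)"])
    show "integrable half_line (\<lambda>y. w y * w y * exp (\<mu> * y))" by (intro L2_exp_mult_integrable w)
    show "AE y in half_line. (\<lambda>n. d n y * d n y * exp (\<mu> * y)) \<longlonglongrightarrow> 0"
      using lim by eventually_elim (auto intro!: tendsto_mult_left_zero tendsto_mult_zero)
    show "AE y in half_line. norm (d n y * d n y * exp (\<mu> * y)) \<le> w y * w y * exp (\<mu> * y)" for n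
      using AE_half_line_pos
    proof eventually_elim
      case (elim y)
      have "\<bar>d n y\<bar> * \<bar>d n y\<bar> * exp (\<mu> * y) \<le> w y * w y * exp (\<mu> * y)"
        using dom[OF elim, of n] by (intro mult_right_mono mult_mono) (auto intro: order_trans[OF abs_ge_zero])
      then show ?case by (simp add: abs_mult)
    qed
  qed measurable
  then have "(\<lambda>n. sqrt (ip_exp \<mu> (d n) (d n))) \<longlonglongrightarrow> sqrt 0"
    unfolding ip_exp_def by (intro tendsto_real_sqrt) simp
  then show ?thesis by (simp add: semi_inner_space.nrm_def[OF semi_inner_space_L2_exp])
qed

text \<open>Lebesgue's differentiation theorem with cubes that have the point as lower corner.
  Averages to the right are the ones that occur as tail integrals of difference quotients.\<close>

lemma forward_average_tendsto:
  fixes f :: "real \<Rightarrow> real"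
  assumes f: "integrable lborel f"
  shows "AE y in lborel. (\<lambda>n. real (Suc n) * (LBINT x:{y..y + 1 / real (Suc n)}. f x)) \<longlonglongrightarrow> f y"
proof -
  have set_int: "set_integrable lborel {a..b} f" for a b
    unfolding set_integrable_def by (intro integrable_mult_indicator f) simp
  have "f integrable_on cbox a b" for a b
    using set_borel_integral_eq_integral(1)[OF set_int] by (simp add: cbox_interval)
  then obtain N where N: "negligible N" and lim: "\<And>x e. x \<notin> N \<Longrightarrow> 0 < e \<Longrightarrow>
      \<exists>d>0. \<forall>h. 0 < h \<and> h < d \<longrightarrow> norm (integral (cbox x (x + h *\<^sub>R One)) f /\<^sub>R h ^ DIM(real) - f x) < e"
    using integrable_ccontinuous_explicit by metis
  \<comment> \<open>A negligible set is null for the completed measure; the statement then passes to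
    \<open>lborel\<close>.\<close>
  have "AE y in lebesgue. y \<notin> N"
    using N by (simp add: negligible_iff_null_sets AE_not_in)
  then have "AE y in lborel. y \<notin> N" by (simp add: AE_completion_iff)
  then show ?thesis
  proof eventually_elim
    case (elim y)
    show ?case
    proof (rule LIMSEQ_I)
      fix r :: real assume "0 < r"
      then obtain d where d: "0 < d" "\<And>h. 0 < h \<Longrightarrow> h < d \<Longrightarrow> norm (integral {y..y + h} f / h - f y) < r"
        using lim[OF elim \<open>0 < r\<close>] by (auto simp: cbox_interval divide_inverse mult.commute)
      have "\<forall>\<^sub>F n in sequentially. 1 / real (Suc n) < d"
        using LIMSEQ_inverse_real_of_nat d(1) by (auto simp: inverse_eq_divide intro: order_tendstoD)
      then obtain n0 where n0: "\<And>n. n0 \<le> n \<Longrightarrow> 1 / real (Suc n) < d" by (auto simp: eventually_sequentially)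
      show "\<exists>no. \<forall>n\<ge>no. norm (real (Suc n) * (LBINT x:{y..y + 1 / real (Suc n)}. f x) - f y) < r"
      proof (intro exI[of _ n0] allI impI)
        fix n assume "n0 \<le> n"
        from d(2)[OF _ n0[OF this]]
        show "norm (real (Suc n) * (LBINT x:{y..y + 1 / real (Suc n)}. f x) - f y) < r"
          by (simp add: set_borel_integral_eq_integral(2)[OF set_int] mult.commute)
      qed
    qed
  qed
qed

section \<open>Density of the domain\<close>

abbreviation nrm_exp :: "real \<Rightarrow> (real \<Rightarrow> real) \<Rightarrow> real" where
  "nrm_exp \<mu> \<equiv> semi_inner_space.nrm (ip_exp \<mu>)"

text \<open>Here \<open>u\<close> stands for the value at \<open>y\<close> of a function bounded by
  \<open>C\<close> and vanishing beyond \<open>R\<close>. The majorant is a multiple of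
  \<open>exp (- (\<mu> * y))\<close>, which belongs to the weighted space.\<close>

lemma bounded_support_L2_exp_bound:
  fixes y R \<mu> :: real
  assumes "0 < \<mu>" "0 \<le> C" "\<bar>u\<bar> \<le> C" "R \<le> y \<Longrightarrow> u = 0"
  shows "\<bar>u\<bar> \<le> C * exp (\<mu> * R) * exp (- (\<mu> * y))"
proof (cases "y < R")
  case True
  have "1 \<le> exp (\<mu> * (R - y))" using True assms by simp
  then have "C * 1 \<le> C * exp (\<mu> * (R - y))" using assms(2) by (rule mult_left_mono)
  also have "exp (\<mu> * (R - y)) = exp (\<mu> * R) * exp (- (\<mu> * y))"
    by (simp add: right_diff_distrib flip: exp_add)
  finally show ?thesis using assms(3) by (simp add: mult.assoc)
next
  case False
  then show ?thesis using assms by simp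
qed

text \<open>The tail integral of \<open>(f y - f (y + \<delta>)) / \<delta>\<close> telescopes to
  the average of \<open>f\<close> over \<open>[y, y + \<delta>]\<close>, so no derivative of
  \<open>f\<close> is taken. These averages inherit the bound \<open>B\<close> and vanish beyond
  \<open>R\<close>, and dominated convergence turns their pointwise limit into a limit in
  norm.\<close>

lemma bounded_support_approx:
  fixes f :: "real \<Rightarrow> real"
  assumes mu: "0 < \<mu>" and [measurable]: "f \<in> borel_measurable borel"
    and B: "\<And>y. \<bar>f y\<bar> \<le> B" and supp: "\<And>y. y \<notin> {0<..<R} \<Longrightarrow> f y = 0" and R: "0 < R" and e: "0 < \<epsilon>"
  obtains h where "weighted_tail \<mu> h" "nrm_exp \<mu> (\<lambda>y. f y - tail_integral h y) < \<epsilon>"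
proof -
  have B0: "0 \<le> B" using B[of 0] by simp
  have f: "integrable lborel f"
  proof (rule Bochner_Integration.integrable_bound)
    show "integrable lborel (\<lambda>y. B * indicator {0<..<R} y)" using R by simp
    show "AE y in lborel. norm (f y) \<le> norm (B * indicator {0<..<R} y)"
      using B B0 supp by (auto simp: indicator_def)
  qed (use assms(2) in simp)
  define \<delta> where "\<delta> n = 1 / real (Suc n)" for n
  have \<delta>: "0 < \<delta> n" for n by (simp add: \<delta>_def)
  \<comment> \<open>The shift is written as \<open>\<delta> n + 1 * y\<close> to match the affine
    change of variables for \<open>lborel\<close>.\<close>
  define h where "h n y = real (Suc n) * (f y - f (\<delta> n + 1 * y))" for n y
  define A where "A n y = real (Suc n) * (LBINT x:{y..y + \<delta> n}. f x)" for n y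
  have wt: "weighted_tail \<mu> (h n)" for n
  proof
    show "0 < \<mu>" by (rule mu)
    show hm: "h n \<in> borel_measurable half_line"
      unfolding h_def by (rule borel_imp_half_line) measurable
    show "(\<lambda>y. y * h n y) \<in> L2_exp \<mu>"
    proof (rule L2_exp_dominated)
      let ?C = "R * (real (Suc n) * (2 * B))"
      show "(\<lambda>y. ?C * exp (\<mu> * R) * exp (- (\<mu> * y))) \<in> L2_exp \<mu>"
        using mu by (intro L2_exp_scale exp_neg_L2_exp) simp
      show "(\<lambda>y. y * h n y) \<in> borel_measurable half_line" using hm by measurable
      fix y :: real assume y: "0 < y"
      have z: "y * h n y = 0" if "R \<le> y"
        using that \<delta>[of n] supp[of y] supp[of "\<delta> n + 1 * y"] by (simp add: h_def)
      have "\<bar>h n y\<bar> \<le> real (Suc n) * (2 * B)"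
        using B[of y] B[of "\<delta> n + 1 * y"] unfolding h_def abs_mult by (intro mult_mono) auto
      then have "\<bar>y * h n y\<bar> \<le> ?C"
      proof (cases "y < R")
        case True
        then show ?thesis
          using \<open>\<bar>h n y\<bar> \<le> _\<close> y unfolding abs_mult by (intro mult_mono) auto
      next
        case False
        then show ?thesis using z B0 R by simp
      qed
      from bounded_support_L2_exp_bound[OF mu _ this z]
      have "\<bar>y * h n y\<bar> \<le> ?C * exp (\<mu> * R) * exp (- (\<mu> * y))" using B0 R by simp
      also have "\<dots> \<le> \<bar>?C * exp (\<mu> * R) * exp (- (\<mu> * y))\<bar>" by (rule abs_ge_self)
      finally show "\<bar>y * h n y\<bar> \<le> \<bar>?C * exp (\<mu> * R) * exp (- (\<mu> * y))\<bar>" .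
    qed
  qed
  have set_int: "set_integrable lborel S f" if "S \<in> sets borel" for S
    unfolding set_integrable_def using that by (intro integrable_mult_indicator f) simp
  have tail: "tail_integral (h n) y = A n y" for n y
  proof -
    have shift: "(LBINT x:{y<..}. f (\<delta> n + 1 * x)) = (LBINT x:{y + \<delta> n<..}. f x)"
    proof -
      have "(LBINT x:{y + \<delta> n<..}. f x) = (\<integral>x. indicator {y + \<delta> n<..} (\<delta> n + 1 * x) *\<^sub>R f (\<delta> n + 1 * x) \<partial>lborel)"
        unfolding set_lebesgue_integral_def
        by (subst lborel_integral_real_affine[where c = 1 and t = "\<delta> n"]) simp_all
      then show ?thesis
        unfolding set_lebesgue_integral_def by (simp add: indicator_def add.commute)
    qed
    have "integrable lborel (\<lambda>x. f (\<delta> n + 1 * x))" by (intro lborel_integrable_real_affine f) simp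
    then have si: "set_integrable lborel {y<..} (\<lambda>x. f (\<delta> n + 1 * x))"
      unfolding set_integrable_def by (intro integrable_mult_indicator) simp_all
    have "tail_integral (h n) y = real (Suc n) * ((LBINT x:{y<..}. f x) - (LBINT x:{y<..}. f (\<delta> n + 1 * x)))"
      unfolding tail_integral_def h_def by (simp add: set_integral_diff(2)[OF set_int si, simplified])
    also have "(LBINT x:{y<..}. f x) = (LBINT x:{y<..y + \<delta> n} \<union> {y + \<delta> n<..}. f x)"
      using \<delta>[of n] by (intro arg_cong[where f = "\<lambda>S. set_lebesgue_integral lborel S f"]) auto
    also have "\<dots> = (LBINT x:{y<..y + \<delta> n}. f x) + (LBINT x:{y + \<delta> n<..}. f x)"
      by (intro set_integral_Un set_int) auto
    also have "(LBINT x:{y<..y + \<delta> n}. f x) = (LBINT x:{y..y + \<delta> n}. f x)"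
    proof (rule set_integral_cong_set)
      show "set_borel_measurable lborel {y<..y + \<delta> n} f" "set_borel_measurable lborel {y..y + \<delta> n} f"
        by (auto simp: set_borel_measurable_def)
      show "AE x in lborel. x \<in> {y..y + \<delta> n} \<longleftrightarrow> x \<in> {y<..y + \<delta> n}"
        using AE_lborel_singleton[of y] by eventually_elim auto
    qed
    finally show ?thesis by (simp only: shift A_def add_diff_cancel_right')
  qed
  have A_bound: "\<bar>A n y\<bar> \<le> B" for n y
  proof -
    have "\<bar>LBINT x:{y..y + \<delta> n}. f x\<bar> \<le> (\<integral>x. \<bar>indicator {y..y + \<delta> n} x *\<^sub>R f x\<bar> \<partial>lborel)"
      unfolding set_lebesgue_integral_def by (rule integral_abs_bound)
    also have "\<dots> \<le> (\<integral>x. B * indicator {y..y + \<delta> n} x \<partial>lborel)"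
    proof (rule integral_mono)
      show "integrable lborel (\<lambda>x. \<bar>indicator {y..y + \<delta> n} x *\<^sub>R f x\<bar>)"
        using set_int[of "{y..y + \<delta> n}"] by (intro integrable_abs) (simp add: set_integrable_def)
      show "integrable lborel (\<lambda>x. B * indicator {y..y + \<delta> n} x)"
        using less_imp_le[OF \<delta>[of n]] by (intro integrable_mult_right integrable_real_indicator) simp_all
      show "\<bar>indicator {y..y + \<delta> n} x *\<^sub>R f x\<bar> \<le> B * indicator {y..y + \<delta> n} x" for x
        using B by (auto simp: indicator_def)
    qed
    also have "\<dots> = B * \<delta> n" using \<delta>[of n] by simp
    finally have "\<bar>A n y\<bar> \<le> real (Suc n) * (B * \<delta> n)"
      unfolding A_def abs_mult by (intro mult_mono) auto
    then show ?thesis by (simp add: \<delta>_def)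
  qed
  have A_zero: "A n y = 0" if "R \<le> y" for n y
  proof -
    have "(LBINT x:{y..y + \<delta> n}. f x) = (LBINT x:{y..y + \<delta> n}. 0)"
      using that supp by (intro set_lebesgue_integral_cong) auto
    then show ?thesis by (simp add: A_def)
  qed
  have "(\<lambda>n. nrm_exp \<mu> (\<lambda>y. f y - tail_integral (h n) y)) \<longlonglongrightarrow> 0"
  proof (rule nrm_L2_exp_tendsto_0)
    show "(\<lambda>y. f y - tail_integral (h n) y) \<in> borel_measurable half_line" for n
      using weighted_tail.H_measurable[OF wt[of n]] borel_imp_half_line[OF assms(2)] by measurable
    show "(\<lambda>y. 2 * B * exp (\<mu> * R) * exp (- (\<mu> * y))) \<in> L2_exp \<mu>"
      using mu by (intro L2_exp_scale exp_neg_L2_exp) simp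
    have "AE y in lborel. (\<lambda>n. A n y) \<longlonglongrightarrow> f y"
      using forward_average_tendsto[OF f] by (simp only: A_def \<delta>_def)
    then have "AE y in lborel. (\<lambda>n. f y - A n y) \<longlonglongrightarrow> 0"
    proof eventually_elim
      case (elim y)
      from tendsto_diff[OF tendsto_const[of "f y"] this] show ?case by simp
    qed
    then show "AE y in half_line. (\<lambda>n. f y - tail_integral (h n) y) \<longlonglongrightarrow> 0"
      unfolding AE_half_line tail by eventually_elim simp
    fix n and y :: real
    have "\<bar>f y - A n y\<bar> \<le> 2 * B" using B[of y] A_bound[of n y] by linarith
    from bounded_support_L2_exp_bound[OF mu _ this, of R y]
    show "\<bar>f y - tail_integral (h n) y\<bar> \<le> 2 * B * exp (\<mu> * R) * exp (- (\<mu> * y))"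
      using B0 A_zero[of y n] supp[of y] by (simp add: tail)
  qed
  from order_tendstoD(2)[OF this e] obtain n where "nrm_exp \<mu> (\<lambda>y. f y - tail_integral (h n) y) < \<epsilon>"
    by (auto simp: eventually_sequentially)
  then show ?thesis using that wt by blast
qed

lemma tail_functions_dense:
  assumes mu: "0 < \<mu>" and F: "F \<in> L2_exp \<mu>" and e: "0 < \<epsilon>"
  obtains h where "weighted_tail \<mu> h" "nrm_exp \<mu> (\<lambda>y. F y - tail_integral h y) < \<epsilon>"
proof -
  interpret L2: semi_inner_space "L2_exp \<mu>" "ip_exp \<mu>" by (rule semi_inner_space_L2_exp)
  note [measurable] = L2_exp_measurable[OF F]
  \<comment> \<open>Extension by 0 gives a Borel function on the whole line, as the shifted
    integrals require.\<close>
  define F0 where "F0 y = indicator {0<..} y *\<^sub>R F y" for y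
  have F0 [measurable]: "F0 \<in> borel_measurable borel"
    using L2_exp_measurable[OF F] unfolding set_borel_measurable_half_line[symmetric]
    by (simp add: set_borel_measurable_def F0_def[abs_def])
  \<comment> \<open>One parameter truncates both the argument, to \<open>(0, k)\<close>, and the
    value, to \<open>[- k, k]\<close>.\<close>
  define f where "f k y = (if 0 < y \<and> y < real k then max (- real k) (min (real k) (F0 y)) else 0)" for k :: nat and y
  have fm: "f k \<in> borel_measurable borel" for k unfolding f_def by measurable
  have F0_eq: "F0 y = F y" if "0 < y" for y using that by (simp add: F0_def)
  have f_le: "\<bar>f k y\<bar> \<le> \<bar>F y\<bar>" and d_le: "\<bar>F y - f k y\<bar> \<le> \<bar>F y\<bar>" if "0 < y" for k y
    using that by (auto simp: f_def F0_eq)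
  have absF: "(\<lambda>y. \<bar>F y\<bar>) \<in> L2_exp \<mu>" by (rule L2_exp_dominated[OF F]) auto
  have "(\<lambda>k. nrm_exp \<mu> (\<lambda>y. F y - f k y)) \<longlonglongrightarrow> 0"
  proof (rule nrm_L2_exp_tendsto_0[OF _ absF])
    show "(\<lambda>y. F y - f k y) \<in> borel_measurable half_line" for k
      using borel_imp_half_line[OF fm[of k]] by measurable
    show "AE y in half_line. (\<lambda>k. F y - f k y) \<longlonglongrightarrow> 0"
      using AE_half_line_pos
    proof eventually_elim
      case (elim y)
      obtain N :: nat where N: "max y \<bar>F y\<bar> < real N" using reals_Archimedean2 by blast
      have "\<forall>\<^sub>F k in sequentially. F y - f k y = 0"
        unfolding eventually_sequentially
      proof (intro exI[of _ N] allI impI)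
        fix k assume "N \<le> k"
        then have "max y \<bar>F y\<bar> < real k" using N by linarith
        then show "F y - f k y = 0" using elim by (auto simp: f_def F0_eq)
      qed
      then show ?case by (rule tendsto_eventually)
    qed
  qed (rule d_le)
  then have "\<forall>\<^sub>F k in sequentially. nrm_exp \<mu> (\<lambda>y. F y - f k y) < \<epsilon> / 2"
    using e by (intro order_tendstoD(2)) auto
  then have "\<forall>\<^sub>F k in sequentially. nrm_exp \<mu> (\<lambda>y. F y - f k y) < \<epsilon> / 2 \<and> 0 < k"
    using eventually_gt_at_top[of "0::nat"] by eventually_elim simp
  then obtain k where k: "nrm_exp \<mu> (\<lambda>y. F y - f k y) < \<epsilon> / 2" "0 < k"
    by (auto simp: eventually_sequentially)
  obtain h where wt: "weighted_tail \<mu> h" and h: "nrm_exp \<mu> (\<lambda>y. f k y - tail_integral h y) < \<epsilon> / 2"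
  proof (rule bounded_support_approx[OF mu fm[of k], of "real k" "real k" "\<epsilon> / 2"])
    show "\<bar>f k y\<bar> \<le> real k" for y by (auto simp: f_def)
    show "f k y = 0" if "y \<notin> {0<..<real k}" for y using that by (auto simp: f_def)
  qed (use k e in auto)
  have fL2: "f k \<in> L2_exp \<mu>"
    by (rule L2_exp_dominated[OF F borel_imp_half_line[OF fm] f_le])
  have HL2: "tail_integral h \<in> L2_exp \<mu>" by (rule weighted_tail.H_L2_exp[OF wt])
  have "nrm_exp \<mu> (\<lambda>y. 1 * (F y - f k y) + 1 * (f k y - tail_integral h y))
      \<le> \<bar>1\<bar> * nrm_exp \<mu> (\<lambda>y. F y - f k y) + \<bar>1\<bar> * nrm_exp \<mu> (\<lambda>y. f k y - tail_integral h y)"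
    by (intro L2.nrm_lin L2.diff_closed F fL2 HL2)
  then have "nrm_exp \<mu> (\<lambda>y. F y - tail_integral h y) < \<epsilon>" using k h by simp
  then show ?thesis using that wt by blast
qed

text \<open>With \<open>\<eta> y = exp (- (\<mu> * y))\<close> the mean of a function is its scalar
  product with \<open>\<eta>\<close>. Since \<open>F\<close> has mean zero, the mean
  \<open>m\<close> of the approximant is bounded by the error \<open>d\<close>, and because the
  squared norm of \<open>\<eta>\<close> is \<open>1 / \<mu>\<close>, the correction
  \<open>\<mu> * m * \<eta>\<close> has norm at most that of \<open>d\<close>. Correcting the mean
  therefore at most doubles the error.\<close>

lemma X_zero_dense:
  assumes mu: "0 < \<mu>" and F: "F \<in> L2_exp \<mu>" and mean: "integral\<^sup>L half_line F = 0" and e: "0 < \<epsilon>"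
  obtains h where "h \<in> X_zero \<mu>" "nrm_exp \<mu> (\<lambda>y. F y - tail_integral h y) < \<epsilon>"
proof -
  interpret L2: semi_inner_space "L2_exp \<mu>" "ip_exp \<mu>" by (rule semi_inner_space_L2_exp)
  obtain h1 where wt1: "weighted_tail \<mu> h1" and h1: "nrm_exp \<mu> (\<lambda>y. F y - tail_integral h1 y) < \<epsilon> / 2"
    using tail_functions_dense[OF mu F, of "\<epsilon> / 2"] e by auto
  interpret h1: weighted_tail \<mu> h1 by (rule wt1)
  define \<eta> where "\<eta> y = exp (- (\<mu> * y))" for y
  have \<eta>L2: "\<eta> \<in> L2_exp \<mu>" unfolding \<eta>_def[abs_def] using mu by (intro exp_neg_L2_exp) simp
  have \<eta>_int: "integrable half_line \<eta>" "integral\<^sup>L half_line \<eta> = 1 / \<mu>"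
    unfolding \<eta>_def[abs_def] using exp_neg_integrable_half_line[OF mu] by auto
  define d where "d y = F y - tail_integral h1 y" for y
  have dL2: "d \<in> L2_exp \<mu>" unfolding d_def[abs_def] by (rule L2.diff_closed[OF F h1.H_L2_exp])
  define m where "m = integral\<^sup>L half_line h1.H"
  have m: "m = - ip_exp \<mu> d \<eta>"
  proof -
    have "ip_exp \<mu> d \<eta> = integral\<^sup>L half_line d"
      by (simp add: ip_exp_def \<eta>_def mult.assoc flip: exp_add)
    also have "\<dots> = - m"
      unfolding d_def[abs_def] m_def using L2_exp_integrable[OF F mu] h1.H_integrable mean by simp
    finally show ?thesis by simp
  qed
  have nrm_\<eta>: "nrm_exp \<mu> \<eta> * nrm_exp \<mu> \<eta> = 1 / \<mu>"
  proof -
    have "ip_exp \<mu> \<eta> \<eta> = integral\<^sup>L half_line \<eta>"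
      unfolding ip_exp_def by (intro Bochner_Integration.integral_cong refl) (simp add: \<eta>_def flip: exp_add)
    then show ?thesis using L2.nrm_square[OF \<eta>L2] \<eta>_int by (simp add: power2_eq_square)
  qed
  \<comment> \<open>The tail integral of \<open>\<mu> * \<eta>\<close> is \<open>\<eta>\<close>, and
    \<open>\<mu> * m * \<eta>\<close> has integral \<open>m\<close>, so the subtracted term removes
    the mean.\<close>
  define h where "h y = h1 y - \<mu> * m * (\<mu> * \<eta> y)" for y
  have y\<eta>: "(\<lambda>y. y * \<eta> y) \<in> L2_exp \<mu>"
  proof (rule L2_exp_dominated)
    \<comment> \<open>A quarter of the exponent is spent on the factor \<open>y\<close>; what is
      left still exceeds the half that membership in the space needs.\<close>
    show "(\<lambda>y. 4 / \<mu> * exp (- (3 / 4 * \<mu> * y))) \<in> L2_exp \<mu>"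
      using mu by (intro L2_exp_scale exp_neg_L2_exp) simp
    show "(\<lambda>y. y * \<eta> y) \<in> borel_measurable half_line"
      using L2_exp_measurable[OF \<eta>L2] by measurable
    fix y :: real assume y: "0 < y"
    have "\<mu> * y / 4 \<le> exp (\<mu> * y / 4)" using exp_ge_add_one_self[of "\<mu> * y / 4"] by linarith
    then have "y \<le> 4 / \<mu> * exp (\<mu> * y / 4)" using mu by (simp add: field_simps)
    then have "y * \<eta> y \<le> 4 / \<mu> * exp (\<mu> * y / 4) * \<eta> y" by (intro mult_right_mono) (auto simp: \<eta>_def)
    also have "\<dots> = 4 / \<mu> * exp (- (3 / 4 * \<mu> * y))"
      unfolding \<eta>_def mult.assoc by (simp flip: exp_add)
    finally show "\<bar>y * \<eta> y\<bar> \<le> \<bar>4 / \<mu> * exp (- (3 / 4 * \<mu> * y))\<bar>"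
      using y mu by (simp add: \<eta>_def abs_mult)
  qed
  have wt: "weighted_tail \<mu> h"
  proof
    show "h \<in> borel_measurable half_line"
      unfolding h_def[abs_def] using h1.h_measurable L2_exp_measurable[OF \<eta>L2] by measurable
    have "(\<lambda>y. 1 * (y * h1 y) + (- (\<mu> * m * \<mu>)) * (y * \<eta> y)) \<in> L2_exp \<mu>"
      by (intro L2_exp_lin h1.yh y\<eta>)
    also have "(\<lambda>y. 1 * (y * h1 y) + (- (\<mu> * m * \<mu>)) * (y * \<eta> y)) = (\<lambda>y. y * h y)"
      by (simp add: fun_eq_iff h_def algebra_simps)
    finally show "(\<lambda>y. y * h y) \<in> L2_exp \<mu>" .
  qed (rule mu)
  have tail: "tail_integral h y = h1.H y - \<mu> * m * \<eta> y" if y: "0 < y" for y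
  proof -
    have "tail_integral h y = (\<integral>x. indicator {y<..} x * h1 x - \<mu> * m * \<mu> * (indicator {y<..} x * \<eta> x) \<partial>half_line)"
      unfolding weighted_tail.H_eq[OF wt less_imp_le[OF y]]
      by (intro Bochner_Integration.integral_cong refl) (simp add: h_def algebra_simps)
    also have "\<dots> = h1.H y - \<mu> * m * \<mu> * (\<integral>x. indicator {y<..} x * \<eta> x \<partial>half_line)"
      using h1.h_integrable[OF y] integrable_half_line_indicator[OF \<eta>_int(1), of "{y<..}"] y
      by (simp add: h1.H_eq)
    also have "(\<integral>x. indicator {y<..} x * \<eta> x \<partial>half_line) = \<eta> y / \<mu>"
      unfolding \<eta>_def by (rule exp_neg_tail_integral[OF mu y])
    finally show ?thesis using mu by simp
  qed
  have "integral\<^sup>L half_line (tail_integral h) = (\<integral>y. h1.H y - \<mu> * m * \<eta> y \<partial>half_line)"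
    by (rule Bochner_Integration.integral_cong) (simp_all add: tail)
  also have "\<dots> = 0" using h1.H_integrable \<eta>_int mu by (simp add: m_def)
  finally have hX: "h \<in> X_zero \<mu>" using wt by (simp add: X_zero_iff[OF mu])
  have "nrm_exp \<mu> (\<lambda>y. F y - tail_integral h y) = nrm_exp \<mu> (\<lambda>y. 1 * d y + \<mu> * m * \<eta> y)"
    unfolding L2.nrm_def ip_exp_def
    by (intro arg_cong[where f = sqrt] Bochner_Integration.integral_cong refl) (simp add: tail d_def algebra_simps)
  also have "\<dots> \<le> \<bar>1\<bar> * nrm_exp \<mu> d + \<bar>\<mu> * m\<bar> * nrm_exp \<mu> \<eta>"
    by (rule L2.nrm_lin[OF dL2 \<eta>L2])
  also have "\<bar>\<mu> * m\<bar> * nrm_exp \<mu> \<eta> \<le> nrm_exp \<mu> d"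
  proof -
    have "\<bar>m\<bar> \<le> nrm_exp \<mu> d * nrm_exp \<mu> \<eta>"
      using L2.ip_Cauchy_Schwarz[OF dL2 \<eta>L2] by (simp add: m)
    then have "\<mu> * \<bar>m\<bar> * nrm_exp \<mu> \<eta> \<le> \<mu> * (nrm_exp \<mu> d * nrm_exp \<mu> \<eta>) * nrm_exp \<mu> \<eta>"
      using mu L2.nrm_nonneg[OF \<eta>L2] by (intro mult_right_mono mult_left_mono) auto
    also have "\<dots> = \<mu> * nrm_exp \<mu> d * (nrm_exp \<mu> \<eta> * nrm_exp \<mu> \<eta>)" by simp
    also have "\<dots> = nrm_exp \<mu> d" unfolding nrm_\<eta> using mu by simp
    finally show ?thesis using mu by (simp add: abs_mult)
  qed
  finally have "nrm_exp \<mu> (\<lambda>y. F y - tail_integral h y) < \<epsilon>"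
    using h1 by (simp add: d_def[abs_def])
  then show ?thesis using that hX by blast
qed

theorem lemma3p12:
  fixes \<rho> :: real
  assumes "\<rho> > 0"
  shows "(\<forall>h \<in> X_zero (2 / \<rho>).
            inner_minus1 (2 / \<rho>) (dist_of h) (L \<rho> h) \<le> - (norm_minus1 (2 / \<rho>) (dist_of h))\<^sup>2) \<and>
         (\<forall>S. semigroup_of_L \<rho> (2 / \<rho>) S \<longrightarrow>
            (\<forall>T \<in> X_minus1 (2 / \<rho>). \<forall>t \<ge> 0.
               norm_minus1 (2 / \<rho>) (S t T) \<le> norm_minus1 (2 / \<rho>) T * exp (- t)))"
proof (intro conjI ballI allI impI)
  fix h assume "h \<in> X_zero (2 / \<rho>)"
  then show "inner_minus1 (2 / \<rho>) (dist_of h) (L \<rho> h) \<le> - (norm_minus1 (2 / \<rho>) (dist_of h))\<^sup>2"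
    by (rule dissipativity[OF assms])
next
  fix S T and t :: real
  assume S: "semigroup_of_L \<rho> (2 / \<rho>) S" and T: "T \<in> X_minus1 (2 / \<rho>)" and t: "0 \<le> t"
  define \<mu> where "\<mu> = 2 / \<rho>"
  have mu: "0 < \<mu>" using assms by (simp add: \<mu>_def)
  note sp = semi_inner_space_X_minus1[OF mu] and nrm = nrm_inner_minus1[OF mu]
  have sg: "C0_semigroup (X_minus1 \<mu>) (norm_minus1 \<mu>) S"
    and gen: "generator_graph (X_minus1 \<mu>) (norm_minus1 \<mu>) S = {(dist_of h, L \<rho> h) | h. h \<in> X_zero \<mu>}"
    using S by (simp_all add: semigroup_of_L_def \<mu>_def)
  have "norm_minus1 \<mu> (S t T) \<le> norm_minus1 \<mu> T * exp (- t)"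
  proof (rule dissipative_semigroup_decay[OF sp, unfolded nrm, OF sg])
    fix T V assume "(T, V) \<in> generator_graph (X_minus1 \<mu>) (norm_minus1 \<mu>) S"
    then obtain h where "T = dist_of h" "V = L \<rho> h" "h \<in> X_zero \<mu>" unfolding gen by blast
    then show "inner_minus1 \<mu> T V \<le> - (norm_minus1 \<mu> T)\<^sup>2"
      using dissipativity[OF assms] by (simp add: \<mu>_def)
  next
    fix T and \<epsilon> :: real assume "T \<in> X_minus1 \<mu>" and e: "0 < \<epsilon>"
    then obtain F where F: "T = neg_deriv F" "F \<in> L2_exp \<mu>" "integral\<^sup>L half_line F = 0"
      unfolding X_minus1_eq by blast
    obtain h where h: "h \<in> X_zero \<mu>" "nrm_exp \<mu> (\<lambda>y. F y - tail_integral h y) < \<epsilon>"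
      using X_zero_dense[OF mu F(2,3) e] by blast
    interpret weighted_tail \<mu> h using h(1) by (simp add: X_zero_iff[OF mu])
    \<comment> \<open>\<open>neg_deriv\<close> is linear and isometric, so the approximation of
      \<open>F\<close> is an approximation of \<open>T\<close> in the space of
      distributions.\<close>
    have "(\<lambda>\<phi>. T \<phi> - dist_of h \<phi>) = (\<lambda>\<phi>. 1 * neg_deriv F \<phi> + (- 1) * neg_deriv H \<phi>)"
      by (simp add: F dist_of_eq_neg_deriv_H)
    also have "\<dots> = neg_deriv (\<lambda>y. 1 * F y + (- 1) * H y)"
      using F mu H_integrable by (simp only: neg_deriv_lin L2_exp_integrable)
    finally have "norm_minus1 \<mu> (\<lambda>\<phi>. T \<phi> - dist_of h \<phi>) < \<epsilon>"
      using h(2) L2_exp_lin[OF F(2) H_L2_exp, of 1 "- 1"] by (simp add: norm_minus1_neg_deriv[OF mu])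
    then show "\<exists>T' V. (T', V) \<in> generator_graph (X_minus1 \<mu>) (norm_minus1 \<mu>) S
        \<and> norm_minus1 \<mu> (\<lambda>\<phi>. T \<phi> - T' \<phi>) < \<epsilon>"
      unfolding gen using h(1) by blast
  qed (use T t in \<open>simp_all add: \<mu>_def\<close>)
  then show "norm_minus1 (2 / \<rho>) (S t T) \<le> norm_minus1 (2 / \<rho>) T * exp (- t)"
    by (simp add: \<mu>_def)
qed

end
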